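(* Let $N\ge 1$, let $c_1,\dots,c_{2N}$ be the Majorana operators of $N$ fermionic modes, and let $\mathcal{V}_G$ be the manifold of (faithful) fermionic Gaussian states on the $2^N$-dimensional Fock space. Let $\mathcal{L}$ be the generator of a differentiable Markovian semigroup $(\mathcal{E}_t)_{t\ge0}$ of completely positive trace-preserving maps, so that $\rho_t=\mathcal{E}_t(\rho_0)$ solves $\partial_t\rho_t=\mathcal{L}(\rho_t)$; in particular $\mathcal{L}$ maps hermitian operators to traceless hermitian operators. Let $\Omega_\rho=\sum_{i=1}^m w_i\,\Omega^{\alpha_i}_\rho$ with $w_i\ge0$, $\sum_i w_i=1$, $\alpha_i\in[0,1]$, where $$\Omega^{\alpha}_\rho(\sigma)=\tfrac12\left(\rho^{-\alpha}\sigma\rho^{\alpha-1}+\rho^{\alpha-1}\sigma\rho^{-\alpha}\right),$$ and let $M_\rho(A,B)=\operatorname{tr}[A^\dagger\Omega_\rho(B)]$ be the associated metric. Then for every $\rho\in\mathcal{V}_G$ the minimisation problem $$\inf_{A\in T_\rho\mathcal{V}_G} M_\rho\big(A-\mathcal{L}(\rho),\,A-\mathcal{L}(\rho)\big)$$ has a unique minimiser $A^\ast$, and $A^\ast$ is the unique element $A\in T_\rho\mathcal{V}_G$ satisfying $$\operatorname{tr}[c_{k}c_{l}\,A]=\operatorname{tr}[c_{k}c_{l}\,\mathcal{L}(\rho)]\quad\text{for all }1\le k<l\le 2N.$$ Equivalently, the locally optimal (time-dependent variational principle) approximation of the dynamics within $\mathcal{V}_G$, $\partial_t\rho_t=A^\ast(\rho_t)$,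 is the same for every such metric and coincides with the Gaussified dynamics, i.e. at each time the covariance matrix of the variational state evolves exactly as $\partial_t\Gamma_{kl}=\tfrac{i}{2}\operatorname{tr}([c_k,c_l]\mathcal{L}(\rho_t))$.
   Context: Majorana operators: for fermionic mode operators $a_j$ with $\{a_k^\dagger,a_l\}=\delta_{kl}$, set $c_{2j-1}=a_j^\dagger+a_j$, $c_{2j}=-i(a_j^\dagger-a_j)$, so $c_k$ are hermitian with $\{c_k,c_l\}=2\delta_{kl}$. A fermionic Gaussian state is a density operator of the form $\rho=\kappa\exp[-\tfrac{i}{2}c^TKc]$ with $K$ a real antisymmetric $2N\times2N$ matrix and $\kappa>0$ a normalisation constant; $\mathcal{V}_G$ denotes the set of all such states, a smooth manifold of full-rank density matrices. Its covariance matrix is $\Gamma_{kl}=\tfrac{i}{2}\operatorname{tr}([c_k,c_l]\rho)$. The tangent space $T_\rho\mathcal{V}_G$ is the real vector space of derivatives $\frac{d}{ds}\rho(s)|_{s=0}$ of smooth curves $\rho(s)$ in $\mathcal{V}_G$ with $\rho(0)=\rho$; it consists of traceless hermitian operators. The Gaussification $\mathcal{G}(\sigma)$ of a state $\sigma$ is the unique Gaussian state with the same covariance matrix as $\sigma$ (equivalently, obtained from $\sigma$'s two-point functions via Wick's theorem). *)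

theory Defs
  imports Complex_Main "Jordan_Normal_Form.Matrix"
begin

definition adj :: "complex mat \<Rightarrow> complex mat" where
  "adj A = mat (dim_col A) (dim_row A) (\<lambda>(i,j). cnj (A $$ (j,i)))"

definition tr :: "complex mat \<Rightarrow> complex" where
  "tr A = (\<Sum>i<dim_row A. A $$ (i,i))"

definition hermitian :: "nat \<Rightarrow> complex mat \<Rightarrow> bool" where
  "hermitian n A \<longleftrightarrow> A \<in> carrier_mat n n \<and> adj A = A"

definition qform :: "complex mat \<Rightarrow> complex vec \<Rightarrow> complex" where
  "qform A v = (\<Sum>i<dim_vec v. \<Sum>j<dim_vec v. cnj (v $ i) * A $$ (i,j) * v $ j)"

definition psd :: "nat \<Rightarrow> complex mat \<Rightarrow> bool" where
  "psd n A \<longleftrightarrow> hermitian n A \<and>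
     (\<forall>v \<in> carrier_vec n. Im (qform A v) = 0 \<and> Re (qform A v) \<ge> 0)"

definition posdef :: "nat \<Rightarrow> complex mat \<Rightarrow> bool" where
  "posdef n A \<longleftrightarrow> hermitian n A \<and>
     (\<forall>v \<in> carrier_vec n. v \<noteq> 0\<^sub>v n \<longrightarrow> Im (qform A v) = 0 \<and> Re (qform A v) > 0)"

definition unitary :: "nat \<Rightarrow> complex mat \<Rightarrow> bool" where
  "unitary n U \<longleftrightarrow> U \<in> carrier_mat n n \<and> adj U * U = 1\<^sub>m n"

definition faithful_state :: "nat \<Rightarrow> complex mat \<Rightarrow> bool" where
  "faithful_state n \<rho> \<longleftrightarrow> posdef n \<rho> \<and> tr \<rho> = 1"

definition mexp :: "nat \<Rightarrow> complex mat \<Rightarrow> complex mat" where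
  "mexp n H = mat n n (\<lambda>(i,j). \<Sum>k. (H ^\<^sub>m k) $$ (i,j) / of_nat (fact k))"

definition mpowr :: "nat \<Rightarrow> complex mat \<Rightarrow> real \<Rightarrow> complex mat" where
  "mpowr n \<rho> s = (SOME X. \<exists>U (lam::nat \<Rightarrow> real). unitary n U \<and> (\<forall>i<n. lam i > 0) \<and>
      \<rho> = U * mat_diag n (\<lambda>i. complex_of_real (lam i)) * adj U \<and>
      X = U * mat_diag n (\<lambda>i. complex_of_real (lam i powr s)) * adj U)"

definition CAR :: "nat \<Rightarrow> (nat \<Rightarrow> complex mat) \<Rightarrow> bool" where
  "CAR N a \<longleftrightarrow> (\<forall>k\<in>{1..N}. a k \<in> carrier_mat (2^N) (2^N)) \<and>
     (\<forall>k\<in>{1..N}. \<forall>l\<in>{1..N}.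
        adj (a k) * a l + a l * adj (a k) = (if k = l then 1\<^sub>m (2^N) else 0\<^sub>m (2^N) (2^N)) \<and>
        a k * a l + a l * a k = 0\<^sub>m (2^N) (2^N))"

definition majorana :: "(nat \<Rightarrow> complex mat) \<Rightarrow> nat \<Rightarrow> complex mat" where
  "majorana a k = (if odd k then adj (a ((k+1) div 2)) + a ((k+1) div 2)
                   else (-\<i>) \<cdot>\<^sub>m (adj (a (k div 2)) - a (k div 2)))"

definition quadratic_op :: "nat \<Rightarrow> (nat \<Rightarrow> complex mat) \<Rightarrow> (nat \<Rightarrow> nat \<Rightarrow> real) \<Rightarrow> complex mat" where
  "quadratic_op N a K = mat (2^N) (2^N) (\<lambda>pq.
      \<Sum>k\<in>{1..2*N}. \<Sum>l\<in>{1..2*N}. complex_of_real (K k l) * (majorana a k * majorana a l) $$ pq)"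

definition gaussian_states :: "nat \<Rightarrow> (nat \<Rightarrow> complex mat) \<Rightarrow> complex mat set" where
  "gaussian_states N a = {\<rho>. faithful_state (2^N) \<rho> \<and>
     (\<exists>(K::nat \<Rightarrow> nat \<Rightarrow> real) (\<kappa>::real).
        (\<forall>k\<in>{1..2*N}. \<forall>l\<in>{1..2*N}. K k l = - K l k) \<and> \<kappa> > 0 \<and>
        \<rho> = complex_of_real \<kappa> \<cdot>\<^sub>m mexp (2^N) ((- \<i> / 2) \<cdot>\<^sub>m quadratic_op N a K))}"

definition smooth_on :: "real set \<Rightarrow> (real \<Rightarrow> complex) \<Rightarrow> bool" where
  "smooth_on S f \<longleftrightarrow> (\<exists>D :: nat \<Rightarrow> real \<Rightarrow> complex. D 0 = f \<and>
      (\<forall>k. \<forall>s\<in>S. (D k has_vector_derivative D (Suc k) s) (at s within S)))"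

text \<open>derivatives at 0 of smooth curves in the Gaussian manifold through rho
  (smoothness and derivative entrywise, equivalently in the finite-dimensional matrix space)\<close>
definition tangent_space :: "nat \<Rightarrow> (nat \<Rightarrow> complex mat) \<Rightarrow> complex mat \<Rightarrow> complex mat set" where
  "tangent_space N a \<rho> = {A. A \<in> carrier_mat (2^N) (2^N) \<and>
     (\<exists>(\<gamma> :: real \<Rightarrow> complex mat) (e::real). e > 0 \<and> \<gamma> 0 = \<rho> \<and>
        (\<forall>s\<in>{-e<..<e}. \<gamma> s \<in> gaussian_states N a) \<and>
        (\<forall>i<2^N. \<forall>j<2^N. smooth_on {-e<..<e} (\<lambda>s. \<gamma> s $$ (i,j)) \<and>
            ((\<lambda>s. \<gamma> s $$ (i,j)) has_vector_derivative A $$ (i,j)) (at 0)))}"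

text \<open>(id_k tensor E) applied to a (k d) x (k d) block matrix\<close>
definition ampliate :: "nat \<Rightarrow> nat \<Rightarrow> (complex mat \<Rightarrow> complex mat) \<Rightarrow> complex mat \<Rightarrow> complex mat" where
  "ampliate k d E X = mat (k*d) (k*d) (\<lambda>(p,q).
      E (mat d d (\<lambda>(r,s). X $$ ((p div d)*d + r, (q div d)*d + s))) $$ (p mod d, q mod d))"

definition linear_map_on :: "nat \<Rightarrow> (complex mat \<Rightarrow> complex mat) \<Rightarrow> bool" where
  "linear_map_on d E \<longleftrightarrow> (\<forall>X\<in>carrier_mat d d. E X \<in> carrier_mat d d) \<and>
     (\<forall>X\<in>carrier_mat d d. \<forall>Y\<in>carrier_mat d d. E (X + Y) = E X + E Y) \<and>
     (\<forall>X\<in>carrier_mat d d. \<forall>c. E (c \<cdot>\<^sub>m X) = c \<cdot>\<^sub>m E X)"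

definition completely_positive :: "nat \<Rightarrow> (complex mat \<Rightarrow> complex mat) \<Rightarrow> bool" where
  "completely_positive d E \<longleftrightarrow>
     (\<forall>k\<ge>1. \<forall>X. psd (k*d) X \<longrightarrow> psd (k*d) (ampliate k d E X))"

definition trace_preserving :: "nat \<Rightarrow> (complex mat \<Rightarrow> complex mat) \<Rightarrow> bool" where
  "trace_preserving d E \<longleftrightarrow> (\<forall>X\<in>carrier_mat d d. tr (E X) = tr X)"

definition markov_semigroup_with_generator ::
  "nat \<Rightarrow> (real \<Rightarrow> complex mat \<Rightarrow> complex mat) \<Rightarrow> (complex mat \<Rightarrow> complex mat) \<Rightarrow> bool" where
  "markov_semigroup_with_generator d E L \<longleftrightarrow>
     (\<forall>t\<ge>0. linear_map_on d (E t) \<and> completely_positive d (E t) \<and> trace_preserving d (E t)) \<and>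
     (\<forall>X\<in>carrier_mat d d. E 0 X = X) \<and>
     (\<forall>s\<ge>0. \<forall>t\<ge>0. \<forall>X\<in>carrier_mat d d. E (s + t) X = E s (E t X)) \<and>
     (\<forall>X\<in>carrier_mat d d. L X \<in> carrier_mat d d \<and> (\<forall>i<d. \<forall>j<d.
        (\<forall>t\<ge>0. (\<lambda>u. E u X $$ (i,j)) differentiable (at t within {0..})) \<and>
        ((\<lambda>u. E u X $$ (i,j)) has_vector_derivative L X $$ (i,j)) (at 0 within {0..})))"

definition Omega_alpha :: "nat \<Rightarrow> real \<Rightarrow> complex mat \<Rightarrow> complex mat \<Rightarrow> complex mat" where
  "Omega_alpha n \<alpha> \<rho> \<sigma> = (1/2) \<cdot>\<^sub>m
     (mpowr n \<rho> (-\<alpha>) * \<sigma> * mpowr n \<rho> (\<alpha> - 1) + mpowr n \<rho> (\<alpha> - 1) * \<sigma> * mpowr n \<rho> (-\<alpha>))"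

definition Omega :: "nat \<Rightarrow> nat \<Rightarrow> (nat \<Rightarrow> real) \<Rightarrow> (nat \<Rightarrow> real) \<Rightarrow> complex mat \<Rightarrow> complex mat \<Rightarrow> complex mat" where
  "Omega n m w \<alpha> \<rho> \<sigma> = mat n n (\<lambda>pq.
     \<Sum>i\<in>{1..m}. complex_of_real (w i) * Omega_alpha n (\<alpha> i) \<rho> \<sigma> $$ pq)"

definition metric :: "nat \<Rightarrow> nat \<Rightarrow> (nat \<Rightarrow> real) \<Rightarrow> (nat \<Rightarrow> real) \<Rightarrow> complex mat \<Rightarrow> complex mat \<Rightarrow> complex mat \<Rightarrow> complex" where
  "metric n m w \<alpha> \<rho> A B = tr (adj A * Omega n m w \<alpha> \<rho> B)"

end

theory Submission
  imports Defs "Jordan_Normal_Form.Spectral_Radius" "Jordan_Normal_Form.Schur_Decomposition"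
begin

text \<open>
  Let \<open>Q\<close> be the space of all operators whose commutator with every Majorana operator \<open>c\<^sub>k\<close> is a linear
  combination of Majorana operators; by irreducibility of the \<open>c\<^sub>k\<close> it is spanned by \<open>1\<close> and the products
  \<open>c\<^sub>k c\<^sub>l\<close>. A faithful state \<open>\<rho>\<close> is Gaussian iff conjugation by \<open>\<rho>\<close> maps the span of the \<open>c\<^sub>k\<close> to itself.
  Every function of the modular operator \<open>X \<mapsto> \<rho> X \<rho>\<^sup>-\<^sup>1\<close> is a polynomial in it, because it is diagonalisable
  with finitely many eigenvalues, so all these functions leave \<open>Q\<close> invariant. Differentiating the quadratic
  identity \<open>\<Sum>\<^sub>k \<rho> c\<^sub>k \<otimes> \<rho> c\<^sub>k = \<Sum>\<^sub>k c\<^sub>k \<rho> \<otimes> c\<^sub>k \<rho>\<close> shows that the tangent space at \<open>\<rho>\<close> consists of the traceless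
  hermitian operators in \<open>Q \<rho>\<close>. Finally \<open>\<Omega>\<^sub>\<rho>(X \<rho>) = g(X)\<close> for a positive function \<open>g\<close> of the modular
  operator, so \<open>\<Omega>\<^sub>\<rho>\<close> maps \<open>Q \<rho>\<close> bijectively onto \<open>Q\<close>. Hence \<open>A - \<L>(\<rho>)\<close> is orthogonal to the tangent
  space iff its trace against all of \<open>Q\<close> vanishes, whatever the metric.
\<close>


section \<open>Matrices in an eigenbasis\<close>

text \<open>The tangent space is a real vector space, whereas functional calculus, commutants and
  projections are complex linear. So hermiticity is kept out of the linear algebra: the projection
  is onto the complex space \<open>Q \<rho>\<close>, and only its hermitian part is kept; it solves
  the same equations because \<open>Q\<close> is closed under adjoints. Tracelessness then comes
  from the trace equation for \<open>1 \<in> Q\<close>. A second obstacle is that Gaussianity is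
  defined by a matrix exponential, which is awkward to differentiate along an arbitrary curve. It is
  traded for invariance of the span of the \<open>c k\<close> under conjugation, a property that
  passes to products and scalar multiples. Irreducibility has to be derived: the dimension
  \<open>2^N\<close> is exactly such that the \<open>4^N\<close> monomials in the \<open>c k\<close>
  fill the matrix space.\<close>

declare index_mult_mat(1) [simp del]

lemma adj_carrier [simp]: "A \<in> carrier_mat m n \<Longrightarrow> adj A \<in> carrier_mat n m"
  by (auto simp: adj_def)

lemma adj_index [simp]: "i < dim_col A \<Longrightarrow> j < dim_row A \<Longrightarrow> adj A $$ (i,j) = cnj (A $$ (j,i))"
  by (auto simp: adj_def)

lemma adj_dim [simp]: "dim_row (adj A) = dim_col A" "dim_col (adj A) = dim_row A"
  by (auto simp: adj_def)

lemma adj_adj [simp]: "adj (adj A) = A"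
  by (rule eq_matI) auto

lemma adj_mult: "A \<in> carrier_mat m n \<Longrightarrow> B \<in> carrier_mat n k \<Longrightarrow> adj (A * B) = adj B * adj A"
  by (rule eq_matI) (auto simp: index_mult_mat(1) scalar_prod_def mult.commute)

lemma adj_add: "A \<in> carrier_mat m n \<Longrightarrow> B \<in> carrier_mat m n \<Longrightarrow> adj (A + B) = adj A + adj B"
  by (rule eq_matI) auto

lemma adj_minus: "A \<in> carrier_mat m n \<Longrightarrow> B \<in> carrier_mat m n \<Longrightarrow> adj (A - B) = adj A - adj B"
  by (rule eq_matI) auto

lemma adj_smult: "adj (c \<cdot>\<^sub>m A) = cnj c \<cdot>\<^sub>m adj A"
  by (rule eq_matI) auto

lemma adj_one [simp]: "adj (1\<^sub>m n) = 1\<^sub>m n"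
  by (rule eq_matI) auto

lemma adj_zero [simp]: "adj (0\<^sub>m m n) = 0\<^sub>m n m"
  by (rule eq_matI) auto

lemma adj_mat_diag: "adj (mat_diag n f) = mat_diag n (\<lambda>i. cnj (f i))"
  by (rule eq_matI) (auto simp: mat_diag_def)

lemma index_mult_sum:
  "A \<in> carrier_mat m n \<Longrightarrow> B \<in> carrier_mat n k \<Longrightarrow> i < m \<Longrightarrow> j < k \<Longrightarrow>
    (A * B) $$ (i,j) = (\<Sum>l<n. A $$ (i,l) * B $$ (l,j))"
  by (auto simp: index_mult_mat(1) scalar_prod_def atLeast0LessThan)

lemma smult_smult_mat: "a \<cdot>\<^sub>m (b \<cdot>\<^sub>m A) = (a * b) \<cdot>\<^sub>m (A :: complex mat)"
  by (rule eq_matI) (auto simp: mult.assoc)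

lemma one_smult_mat: "1 \<cdot>\<^sub>m (A :: complex mat) = A"
  by (rule eq_matI) auto

lemma tr_add: "A \<in> carrier_mat n n \<Longrightarrow> B \<in> carrier_mat n n \<Longrightarrow> tr (A + B) = tr A + tr B"
  by (auto simp: tr_def sum.distrib)

lemma tr_minus: "A \<in> carrier_mat n n \<Longrightarrow> B \<in> carrier_mat n n \<Longrightarrow> tr (A - B) = tr A - tr B"
  by (auto simp: tr_def sum_subtractf)

lemma tr_smult: "A \<in> carrier_mat n n \<Longrightarrow> tr (c \<cdot>\<^sub>m A) = c * tr A"
  by (auto simp: tr_def sum_distrib_left)

lemma tr_one [simp]: "tr (1\<^sub>m n) = of_nat n"
  by (auto simp: tr_def)

lemma tr_zero [simp]: "tr (0\<^sub>m n n) = 0"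
  by (auto simp: tr_def)

lemma tr_adj: "A \<in> carrier_mat n n \<Longrightarrow> tr (adj A) = cnj (tr A)"
  by (auto simp: tr_def)

lemma tr_comm:
  assumes "A \<in> carrier_mat m n" "B \<in> carrier_mat n m"
  shows "tr (A * B) = tr (B * A)"
proof -
  have "tr (A * B) = (\<Sum>i<m. \<Sum>l<n. A $$ (i,l) * B $$ (l,i))"
    using assms by (auto simp: tr_def index_mult_sum)
  also have "\<dots> = (\<Sum>l<n. \<Sum>i<m. B $$ (l,i) * A $$ (i,l))"
    by (subst sum.swap) (simp add: mult.commute)
  also have "\<dots> = tr (B * A)"
    using assms by (auto simp: tr_def index_mult_sum)
  finally show ?thesis .
qed

definition hadamard :: "nat \<Rightarrow> (nat \<Rightarrow> nat \<Rightarrow> complex) \<Rightarrow> complex mat \<Rightarrow> complex mat" where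
  "hadamard n F Y = mat n n (\<lambda>(i,j). F i j * Y $$ (i,j))"

lemma hadamard_carrier [simp]: "hadamard n F Y \<in> carrier_mat n n"
  by (simp add: hadamard_def)

lemma hadamard_index [simp]: "i < n \<Longrightarrow> j < n \<Longrightarrow> hadamard n F Y $$ (i,j) = F i j * Y $$ (i,j)"
  by (simp add: hadamard_def)

lemma hadamard_dim [simp]: "dim_row (hadamard n F Y) = n" "dim_col (hadamard n F Y) = n"
  by (simp_all add: hadamard_def)

text \<open>Multiplication of the matrix units of the eigenbasis \<open>U\<close> by the numbers \<open>F i j\<close>. Left and right
  multiplication by functions of \<open>\<rho>\<close>, commutators with \<open>log \<rho>\<close>, the modular operator and \<open>\<Omega>\<^sub>\<rho>\<close> are all of this form.\<close>

definition hmul :: "nat \<Rightarrow> complex mat \<Rightarrow> (nat \<Rightarrow> nat \<Rightarrow> complex) \<Rightarrow> complex mat \<Rightarrow> complex mat" where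
  "hmul n U F X = U * (hadamard n F (adj U * (X * U)) * adj U)"

text \<open>Matrices of all sizes share one type and have no common zero, so a finite sum is formed
  entrywise with the size as a parameter; the empty sum is then the zero matrix of that
  size.\<close>

definition mat_sum :: "nat \<Rightarrow> ('b \<Rightarrow> complex mat) \<Rightarrow> 'b set \<Rightarrow> complex mat" where
  "mat_sum n f S = mat n n (\<lambda>pq. \<Sum>k\<in>S. f k $$ pq)"

lemma mat_sum_carrier [simp]: "mat_sum n f S \<in> carrier_mat n n"
  by (simp add: mat_sum_def)

lemma mat_sum_dim [simp]: "dim_row (mat_sum n f S) = n" "dim_col (mat_sum n f S) = n"
  by (simp_all add: mat_sum_def)

lemma mat_sum_index [simp]: "i < n \<Longrightarrow> j < n \<Longrightarrow> mat_sum n f S $$ (i,j) = (\<Sum>k\<in>S. f k $$ (i,j))"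
  by (simp add: mat_sum_def)

locale square_mats =
  fixes n :: nat
begin

abbreviation M :: "complex mat set" where "M \<equiv> carrier_mat n n"

lemma M_closed [simp]:
  "A \<in> M \<Longrightarrow> B \<in> M \<Longrightarrow> A * B \<in> M"
  "A \<in> M \<Longrightarrow> B \<in> M \<Longrightarrow> A - B \<in> M"
  "mat_diag n f \<in> M"
  by (simp_all add: minus_carrier_mat)

lemma M_assoc: "A \<in> M \<Longrightarrow> B \<in> M \<Longrightarrow> C \<in> M \<Longrightarrow> A * B * C = A * (B * C)"
  by (rule assoc_mult_mat)

lemma M_distrib:
  "A \<in> M \<Longrightarrow> B \<in> M \<Longrightarrow> C \<in> M \<Longrightarrow> (A + B) * C = A * C + B * C"
  "A \<in> M \<Longrightarrow> B \<in> M \<Longrightarrow> C \<in> M \<Longrightarrow> C * (A + B) = C * A + C * B"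
  "A \<in> M \<Longrightarrow> B \<in> M \<Longrightarrow> C \<in> M \<Longrightarrow> (A - B) * C = A * C - B * C"
  "A \<in> M \<Longrightarrow> B \<in> M \<Longrightarrow> C \<in> M \<Longrightarrow> C * (A - B) = C * A - C * B"
  by (auto simp: add_mult_distrib_mat mult_add_distrib_mat minus_mult_distrib_mat mult_minus_distrib_mat)

lemma M_smult:
  "A \<in> M \<Longrightarrow> B \<in> M \<Longrightarrow> A * (c \<cdot>\<^sub>m B) = c \<cdot>\<^sub>m (A * B)"
  "A \<in> M \<Longrightarrow> B \<in> M \<Longrightarrow> (c \<cdot>\<^sub>m A) * B = c \<cdot>\<^sub>m (A * B)"
  by (rule mult_smult_distrib, auto, rule mult_smult_assoc_mat, auto)

lemma M_eqI: "A \<in> M \<Longrightarrow> B \<in> M \<Longrightarrow> (\<And>i j. i < n \<Longrightarrow> j < n \<Longrightarrow> A $$ (i,j) = B $$ (i,j)) \<Longrightarrow> A = B"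
  by (rule eq_matI) auto

lemmas M_algebra = M_assoc M_distrib M_smult

lemma M_index [simp]:
  "A \<in> M \<Longrightarrow> B \<in> M \<Longrightarrow> i < n \<Longrightarrow> j < n \<Longrightarrow> (A + B) $$ (i,j) = A $$ (i,j) + B $$ (i,j)"
  "A \<in> M \<Longrightarrow> B \<in> M \<Longrightarrow> i < n \<Longrightarrow> j < n \<Longrightarrow> (A - B) $$ (i,j) = A $$ (i,j) - B $$ (i,j)"
  "A \<in> M \<Longrightarrow> i < n \<Longrightarrow> j < n \<Longrightarrow> (c \<cdot>\<^sub>m A) $$ (i,j) = c * A $$ (i,j)"
  by auto

lemma M_mult_index: "A \<in> M \<Longrightarrow> B \<in> M \<Longrightarrow> i < n \<Longrightarrow> j < n \<Longrightarrow>
    (A * B) $$ (i,j) = (\<Sum>l<n. A $$ (i,l) * B $$ (l,j))"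
  by (rule index_mult_sum)

lemma M_adj:
  "A \<in> M \<Longrightarrow> B \<in> M \<Longrightarrow> adj (A * B) = adj B * adj A"
  "A \<in> M \<Longrightarrow> B \<in> M \<Longrightarrow> adj (A + B) = adj A + adj B"
  "A \<in> M \<Longrightarrow> B \<in> M \<Longrightarrow> adj (A - B) = adj A - adj B"
  by (auto simp: adj_mult adj_add adj_minus)

lemma M_tr:
  "A \<in> M \<Longrightarrow> B \<in> M \<Longrightarrow> tr (A + B) = tr A + tr B"
  "A \<in> M \<Longrightarrow> B \<in> M \<Longrightarrow> tr (A - B) = tr A - tr B"
  "A \<in> M \<Longrightarrow> tr (c \<cdot>\<^sub>m A) = c * tr A"
  "A \<in> M \<Longrightarrow> tr (adj A) = cnj (tr A)"
  by (auto simp: tr_add tr_minus tr_smult tr_adj)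

lemma M_tr_comm: "A \<in> M \<Longrightarrow> B \<in> M \<Longrightarrow> tr (A * B) = tr (B * A)"
  by (rule tr_comm)

lemma M_tr_cycle: "A \<in> M \<Longrightarrow> B \<in> M \<Longrightarrow> C \<in> M \<Longrightarrow> tr (A * (B * C)) = tr (B * (C * A))"
  using M_tr_comm[of A "B * C"] by (simp add: M_assoc)

lemma tr_mult_sum: "A \<in> M \<Longrightarrow> B \<in> M \<Longrightarrow> tr (A * B) = (\<Sum>i<n. \<Sum>l<n. A $$ (i,l) * B $$ (l,i))"
  by (auto simp: tr_def M_mult_index)

lemma mat_sum_mult_right: 
  assumes "A \<in> M" "\<And>k. k \<in> S \<Longrightarrow> f k \<in> M"
  shows "mat_sum n f S * A = mat_sum n (\<lambda>k. f k * A) S"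
proof (rule M_eqI)
  fix i j assume ij: "i < n" "j < n"
  have "(mat_sum n f S * A) $$ (i,j) = (\<Sum>l<n. \<Sum>k\<in>S. f k $$ (i,l) * A $$ (l,j))"
    using ij assms by (simp add: M_mult_index sum_distrib_right)
  also have "\<dots> = (\<Sum>k\<in>S. \<Sum>l<n. f k $$ (i,l) * A $$ (l,j))" by (rule sum.swap)
  finally show "(mat_sum n f S * A) $$ (i,j) = mat_sum n (\<lambda>k. f k * A) S $$ (i,j)"
    using ij assms by (simp add: M_mult_index)
qed (use assms in auto)

lemma mat_sum_mult_left: 
  assumes "A \<in> M" "\<And>k. k \<in> S \<Longrightarrow> f k \<in> M"
  shows "A * mat_sum n f S = mat_sum n (\<lambda>k. A * f k) S"
proof (rule M_eqI)
  fix i j assume ij: "i < n" "j < n"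
  have "(A * mat_sum n f S) $$ (i,j) = (\<Sum>l<n. \<Sum>k\<in>S. A $$ (i,l) * f k $$ (l,j))"
    using ij assms by (simp add: M_mult_index sum_distrib_left)
  also have "\<dots> = (\<Sum>k\<in>S. \<Sum>l<n. A $$ (i,l) * f k $$ (l,j))" by (rule sum.swap)
  finally show "(A * mat_sum n f S) $$ (i,j) = mat_sum n (\<lambda>k. A * f k) S $$ (i,j)"
    using ij assms by (simp add: M_mult_index)
qed (use assms in auto)

lemma tr_mat_sum: 
  assumes "\<And>k. k \<in> S \<Longrightarrow> f k \<in> M" 
  shows "tr (mat_sum n f S) = (\<Sum>k\<in>S. tr (f k))"
proof -
  have "tr (mat_sum n f S) = (\<Sum>i<n. \<Sum>k\<in>S. f k $$ (i,i))" by (simp add: tr_def)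
  also have "\<dots> = (\<Sum>k\<in>S. \<Sum>i<n. f k $$ (i,i))" by (rule sum.swap)
  also have "\<dots> = (\<Sum>k\<in>S. tr (f k))" using assms by (intro sum.cong) (auto simp: tr_def)
  finally show ?thesis .
qed

lemma mat_sum_cong: "(\<And>k. k \<in> S \<Longrightarrow> f k = g k) \<Longrightarrow> mat_sum n f S = mat_sum n g S"
  by (rule M_eqI) auto

lemma mat_sum_smult: "(\<And>k. k \<in> S \<Longrightarrow> f k \<in> M) \<Longrightarrow> c \<cdot>\<^sub>m mat_sum n f S = mat_sum n (\<lambda>k. c \<cdot>\<^sub>m f k) S"
  by (rule M_eqI) (auto simp: sum_distrib_left intro!: sum.cong)

lemma unitary_M:
  assumes "unitary n U"
  shows "U \<in> M" "adj U \<in> M" "adj U * U = 1\<^sub>m n" "U * adj U = 1\<^sub>m n"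
proof -
  show U: "U \<in> M" "adj U * U = 1\<^sub>m n" using assms by (auto simp: unitary_def)
  then show "adj U \<in> M" by simp
  then show "U * adj U = 1\<^sub>m n" using mat_mult_left_right_inverse[of "adj U" n U] U by auto
qed

lemma M_one [simp]: "A \<in> M \<Longrightarrow> A * 1\<^sub>m n = A" "A \<in> M \<Longrightarrow> 1\<^sub>m n * A = A" by auto

lemma unitary_cancel:
  assumes "unitary n U" "X \<in> M"
  shows "adj U * (U * X) = X" "U * (adj U * X) = X"
  using assms unitary_M[OF assms(1)] assoc_mult_mat[of "adj U" n n U n X n] assoc_mult_mat[of U n n "adj U" n X n] by auto

lemma hmul_closed [simp]: "unitary n U \<Longrightarrow> hmul n U F X \<in> M"
  using unitary_M[of U] by (auto simp: hmul_def)

lemma hmul_basis: "unitary n U \<Longrightarrow> X \<in> M \<Longrightarrow> adj U * (hmul n U F X * U) = hadamard n F (adj U * (X * U))"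
  using unitary_M[of U] by (simp add: hmul_def M_assoc unitary_cancel)

lemma basis_eqI: 
  assumes "unitary n U" "X \<in> M" "Y \<in> M" "adj U * (X * U) = adj U * (Y * U)" shows "X = Y"
proof -
  note U = unitary_M[OF assms(1)]
  have "X = U * ((adj U * (X * U)) * adj U)" using assms(1,2) U by (simp add: M_assoc unitary_cancel)
  also have "\<dots> = U * ((adj U * (Y * U)) * adj U)" using assms by simp
  also have "\<dots> = Y" using assms(1,3) U by (simp add: M_assoc unitary_cancel)
  finally show ?thesis .
qed

lemma hmul_eqI: 
  assumes "unitary n U" "X \<in> M" "Y \<in> M" 
    "\<And>i j. i < n \<Longrightarrow> j < n \<Longrightarrow> (adj U * (Y * U)) $$ (i,j) = F i j * (adj U * (X * U)) $$ (i,j)"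
  shows "hmul n U F X = Y"
proof (rule basis_eqI[OF assms(1)])
  note U = unitary_M[OF assms(1)]
  show "adj U * (hmul n U F X * U) = adj U * (Y * U)"
    unfolding hmul_basis[OF assms(1,2)]
    by (rule M_eqI) (use assms U in \<open>auto\<close>)
qed (use assms in auto)

lemma hmul_cong: 
  "(\<And>i j. i < n \<Longrightarrow> j < n \<Longrightarrow> F i j = G i j) \<Longrightarrow> hmul n U F X = hmul n U G X"
  unfolding hmul_def hadamard_def by (auto intro!: arg_cong[where f="\<lambda>Z. U * (Z * adj U)"] cong_mat)

lemma hmul_hmul:
  assumes "unitary n U" "X \<in> M"
  shows "hmul n U F (hmul n U G X) = hmul n U (\<lambda>i j. F i j * G i j) X"
  by (rule hmul_eqI) (use assms unitary_M[OF assms(1)] in \<open>auto simp: hmul_basis\<close>)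

lemma hmul_one:
  assumes "unitary n U" "X \<in> M"
  shows "hmul n U (\<lambda>i j. 1) X = X"
  by (rule hmul_eqI) (use assms unitary_M[OF assms(1)] in \<open>auto simp: hmul_basis\<close>)

lemma basis_linear:
  assumes "unitary n U" "X \<in> M" "Y \<in> M"
  shows "adj U * ((X + Y) * U) = adj U * (X * U) + adj U * (Y * U)"
    "adj U * ((X - Y) * U) = adj U * (X * U) - adj U * (Y * U)"
    "adj U * ((c \<cdot>\<^sub>m X) * U) = c \<cdot>\<^sub>m (adj U * (X * U))"
  using assms unitary_M[OF assms(1)] by (simp_all add: M_algebra)

lemma hmul_add:
  assumes "unitary n U" "X \<in> M" "Y \<in> M"
  shows "hmul n U F (X + Y) = hmul n U F X + hmul n U F Y"
  by (rule hmul_eqI) (use assms unitary_M[OF assms(1)] in 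
      \<open>auto simp: hmul_basis basis_linear distrib_left\<close>)

lemma hmul_minus:
  assumes "unitary n U" "X \<in> M" "Y \<in> M"
  shows "hmul n U F (X - Y) = hmul n U F X - hmul n U F Y"
  by (rule hmul_eqI) (use assms unitary_M[OF assms(1)] in 
      \<open>auto simp: hmul_basis basis_linear right_diff_distrib\<close>)

lemma hmul_smult:
  assumes "unitary n U" "X \<in> M"
  shows "hmul n U F (c \<cdot>\<^sub>m X) = c \<cdot>\<^sub>m hmul n U F X"
  by (rule hmul_eqI) (use assms unitary_M[OF assms(1)] in 
      \<open>auto simp: hmul_basis basis_linear\<close>)

lemma hmul_fun_add:
  assumes "unitary n U" "X \<in> M"
  shows "hmul n U (\<lambda>i j. F i j + G i j) X = hmul n U F X + hmul n U G X"
  by (rule hmul_eqI) (use assms unitary_M[OF assms(1)] in 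
      \<open>auto simp: hmul_basis basis_linear distrib_right\<close>)

lemma hmul_fun_smult:
  assumes "unitary n U" "X \<in> M"
  shows "hmul n U (\<lambda>i j. c * F i j) X = c \<cdot>\<^sub>m hmul n U F X"
  by (rule hmul_eqI) (use assms unitary_M[OF assms(1)] in 
      \<open>auto simp: hmul_basis basis_linear distrib_right\<close>)

text \<open>The adjoint swaps the two eigenbasis indices, hence the transposed and conjugated
  multiplier.\<close>

lemma hmul_adj:
  assumes "unitary n U" "X \<in> M"
  shows "adj (hmul n U F X) = hmul n U (\<lambda>i j. cnj (F j i)) (adj X)"
proof (rule hmul_eqI[symmetric])
  note U = unitary_M[OF assms(1)]
  fix i j assume ij: "i < n" "j < n"
  have *: "adj U * (adj Z * U) = adj (adj U * (Z * U))" if "Z \<in> M" for Z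
    using that U by (simp add: M_adj M_assoc)
  have "(adj U * (adj (hmul n U F X) * U)) $$ (i,j) = cnj ((adj U * (hmul n U F X * U)) $$ (j,i))"
    using ij U assms by (subst *) (auto)
  also have "\<dots> = cnj (F j i) * cnj ((adj U * (X * U)) $$ (j,i))"
    using ij assms by (simp add: hmul_basis)
  also have "cnj ((adj U * (X * U)) $$ (j,i)) = (adj U * (adj X * U)) $$ (i,j)"
    using ij U assms by (subst *) (auto)
  finally show "(adj U * (adj (hmul n U F X) * U)) $$ (i,j) = cnj (F j i) * (adj U * (adj X * U)) $$ (i,j)" .
qed (use assms in auto)

lemma tr_basis:
  assumes "unitary n U" "A \<in> M" "B \<in> M"
  shows "tr (A * B) = (\<Sum>i<n. \<Sum>l<n. (adj U * (A * U)) $$ (i,l) * (adj U * (B * U)) $$ (l,i))"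
proof -
  note U = unitary_M[OF assms(1)]
  have "tr ((adj U * (A * U)) * (adj U * (B * U))) = tr (adj U * (A * (B * U)))"
    using assms U by (simp add: M_assoc unitary_cancel)
  also have "\<dots> = tr (A * B)"
    using assms U by (subst M_tr_comm) (auto simp: M_assoc)
  finally show ?thesis using assms U by (subst (asm) tr_mult_sum) auto
qed

text \<open>The trace pairs entry \<open>(i,l)\<close> with entry \<open>(l,i)\<close>, so a
  multiplier changes sides with its indices swapped.\<close>

lemma tr_hmul_right:
  assumes "unitary n U" "A \<in> M" "B \<in> M"
  shows "tr (A * hmul n U F B) = tr (hmul n U (\<lambda>i j. F j i) A * B)"
  using assms by (subst (1 2) tr_basis[OF assms(1)]) 
    (auto simp: hmul_basis mult_ac intro!: sum.cong)

definition spec :: "complex mat \<Rightarrow> (nat \<Rightarrow> complex) \<Rightarrow> complex mat" where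
  "spec U f = U * (mat_diag n f * adj U)"

lemma spec_closed [simp]: "unitary n U \<Longrightarrow> spec U f \<in> M"
  using unitary_M[of U] by (simp add: spec_def)

lemma spec_mult: 
  assumes "unitary n U"
  shows "spec U f * spec U g = spec U (\<lambda>i. f i * g i)"
proof -
  note U = unitary_M[OF assms]
  have "mat_diag n f * (mat_diag n g * adj U) = (mat_diag n f * mat_diag n g) * adj U"
    using U by (intro M_assoc[symmetric]) auto
  then show ?thesis
    using U assms by (simp add: spec_def M_assoc unitary_cancel)
qed

lemma spec_one: "unitary n U \<Longrightarrow> spec U (\<lambda>i. 1) = 1\<^sub>m n"
  using unitary_M[of U] by (simp add: spec_def)

lemma spec_cong: "(\<And>i. i < n \<Longrightarrow> f i = g i) \<Longrightarrow> spec U f = spec U g"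
  unfolding spec_def mat_diag_def by (auto intro!: arg_cong[where f="\<lambda>Z. U * (Z * adj U)"] cong_mat)

lemma spec_adj: "unitary n U \<Longrightarrow> adj (spec U f) = spec U (\<lambda>i. cnj (f i))"
  using unitary_M[of U] by (simp add: spec_def M_adj M_assoc adj_mat_diag)

lemma spec_smult: "unitary n U \<Longrightarrow> spec U (\<lambda>i. c * f i) = c \<cdot>\<^sub>m spec U f"
proof -
  assume U: "unitary n U"
  have "mat_diag n (\<lambda>i. c * f i) = c \<cdot>\<^sub>m mat_diag n f" by (rule eq_matI) (auto simp: mat_diag_def)
  then show ?thesis using unitary_M[OF U] by (simp add: spec_def M_smult)
qed

lemma spec_add: "unitary n U \<Longrightarrow> spec U (\<lambda>i. f i + g i) = spec U f + spec U g"
proof -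
  assume U: "unitary n U"
  have "mat_diag n (\<lambda>i. f i + g i) = mat_diag n f + mat_diag n g" by (rule eq_matI) (auto simp: mat_diag_def)
  then show ?thesis using unitary_M[OF U] by (simp add: spec_def M_distrib)
qed

lemma mat_diag_sandwich:
  assumes "Z \<in> M" "i < n" "j < n"
  shows "(mat_diag n f * (Z * mat_diag n g)) $$ (i,j) = f i * g j * Z $$ (i,j)"
proof -
  have "(mat_diag n f * (Z * mat_diag n g)) $$ (i,j) = f i * (Z * mat_diag n g) $$ (i,j)"
    using assms by (subst mat_diag_mult_left[of _ n n]) auto
  also have "(Z * mat_diag n g) $$ (i,j) = Z $$ (i,j) * g j"
    using assms by (subst mat_diag_mult_right[of _ n n]) auto
  finally show ?thesis by simp
qed

text \<open>In the eigenbasis the left factor scales rows and the right factor scales columns. This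
  is how operator expressions in \<open>\<rho>\<close> become multipliers.\<close>

lemma spec_sandwich:
  assumes "unitary n U" "X \<in> M"
  shows "spec U f * (X * spec U g) = hmul n U (\<lambda>i j. f i * g j) X"
proof (rule hmul_eqI[symmetric])
  note U = unitary_M[OF assms(1)]
  have *: "adj U * ((spec U f * (X * spec U g)) * U) = mat_diag n f * ((adj U * (X * U)) * mat_diag n g)"
    using assms U by (simp add: spec_def M_assoc unitary_cancel)
  show "(adj U * ((spec U f * (X * spec U g)) * U)) $$ (i,j) = f i * g j * (adj U * (X * U)) $$ (i,j)"
    if "i < n" "j < n" for i j 
    unfolding * by (rule mat_diag_sandwich) (use that U assms in auto)
qed (use assms in auto)

lemma spec_mult_right: "unitary n U \<Longrightarrow> X \<in> M \<Longrightarrow> X * spec U g = hmul n U (\<lambda>i j. g j) X"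
  using spec_sandwich[of U X "\<lambda>i. 1" g] by (simp add: spec_one)

lemma spec_mult_left: "unitary n U \<Longrightarrow> X \<in> M \<Longrightarrow> spec U f * X = hmul n U (\<lambda>i j. f i) X"
  using spec_sandwich[of U X f "\<lambda>i. 1"] by (simp add: spec_one)

end

section \<open>Functional calculus and spectral theorem\<close>

lemma poly_interpolation:
  fixes f :: "'a :: field \<Rightarrow> 'a"
  assumes "finite S"
  shows "\<exists>p. \<forall>x\<in>S. poly p x = f x"
  using assms
proof (induction S)
  case (insert a S)
  then obtain p where p: "\<forall>x\<in>S. poly p x = f x" by blast
  \<comment> \<open>Newton's correction: \<open>q\<close> vanishes at the old nodes and not at
    \<open>a\<close>, so the value at \<open>a\<close> can be adjusted alone.\<close>
  define q where "q = (\<Prod>s\<in>S. [:-s, 1:])"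
  have q: "poly q a \<noteq> 0" "\<forall>x\<in>S. poly q x = 0"
    using insert by (auto simp: q_def poly_prod)
  have "\<forall>x\<in>insert a S. poly (p + smult ((f a - poly p a) / poly q a) q) x = f x"
    using p q by auto
  then show ?case by blast
qed auto

context square_mats
begin

definition mat_subspace :: "complex mat set \<Rightarrow> bool" where
  "mat_subspace V \<longleftrightarrow> V \<subseteq> M \<and> 0\<^sub>m n n \<in> V \<and> (\<forall>X\<in>V. \<forall>Y\<in>V. X + Y \<in> V) \<and> (\<forall>X\<in>V. \<forall>c. c \<cdot>\<^sub>m X \<in> V)"

lemma mat_subspaceD:
  assumes "mat_subspace V"
  shows "X \<in> V \<Longrightarrow> X \<in> M" "0\<^sub>m n n \<in> V" "X \<in> V \<Longrightarrow> Y \<in> V \<Longrightarrow> X + Y \<in> V" "X \<in> V \<Longrightarrow> c \<cdot>\<^sub>m X \<in> V"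
  using assms by (auto simp: mat_subspace_def)

lemma mat_subspace_minus: "mat_subspace V \<Longrightarrow> X \<in> V \<Longrightarrow> Y \<in> V \<Longrightarrow> X - Y \<in> V"
proof -
  assume *: "mat_subspace V" "X \<in> V" "Y \<in> V"
  then have "X \<in> M" "Y \<in> M" using mat_subspaceD(1) by blast+
  then have "X - Y = X + (-1) \<cdot>\<^sub>m Y" by (intro M_eqI) auto
  then show ?thesis using * mat_subspaceD(3,4) by simp
qed

lemma mat_subspace_mat_sum:
  assumes "mat_subspace V" "finite S" "\<And>k. k \<in> S \<Longrightarrow> f k \<in> V"
  shows "mat_sum n f S \<in> V"
  using assms(2,3)
proof (induction S)
  case empty
  have "mat_sum n f {} = 0\<^sub>m n n" by (rule M_eqI) auto
  then show ?case using mat_subspaceD(2)[OF assms(1)] by simp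
next
  case (insert k S)
  have "f k \<in> M" using insert.prems mat_subspaceD(1)[OF assms(1)] by auto
  then have "mat_sum n f (insert k S) = f k + mat_sum n f S" 
    using insert.hyps by (intro M_eqI) auto
  then show ?case using insert mat_subspaceD(3)[OF assms(1)] by auto
qed

text \<open>Horner's scheme: a constant term plus one more application of the multiplier
  \<open>T\<close>, both of which stay in \<open>V\<close>.\<close>

lemma hmul_poly_invariant:
  assumes "unitary n U" "mat_subspace V" "\<And>X. X \<in> V \<Longrightarrow> hmul n U T X \<in> V" "X \<in> V"
  shows "hmul n U (\<lambda>i j. poly p (T i j)) X \<in> V"
proof (induction p)
  case 0
  have X: "X \<in> M" using assms mat_subspaceD by blast
  have "hmul n U (\<lambda>i j. poly 0 (T i j)) X = 0 \<cdot>\<^sub>m X"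
    using hmul_fun_smult[OF assms(1) X, of 0 "\<lambda>i j. 1"] by (simp add: hmul_one assms X)
  then show ?case using assms mat_subspaceD by auto
next
  case (pCons a p)
  have X: "X \<in> M" using assms mat_subspaceD by blast
  have "hmul n U (\<lambda>i j. poly (pCons a p) (T i j)) X
      = hmul n U (\<lambda>i j. a * 1 + T i j * poly p (T i j)) X" by simp
  also have "\<dots> = hmul n U (\<lambda>i j. a * 1) X + hmul n U (\<lambda>i j. T i j * poly p (T i j)) X"
    by (rule hmul_fun_add[OF assms(1) X])
  also have "\<dots> = a \<cdot>\<^sub>m X + hmul n U T (hmul n U (\<lambda>i j. poly p (T i j)) X)"
    by (simp only: hmul_hmul[OF assms(1) X] hmul_fun_smult[OF assms(1) X] hmul_one[OF assms(1) X])
  finally show ?case using pCons.IH assms mat_subspaceD by simp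
qed

lemma hmul_fun_invariant:
  assumes "unitary n U" "mat_subspace V" "\<And>X. X \<in> V \<Longrightarrow> hmul n U T X \<in> V" "X \<in> V"
    and "\<And>i j. i < n \<Longrightarrow> j < n \<Longrightarrow> F i j = f (T i j)"
  shows "hmul n U F X \<in> V"
proof -
  let ?S = "(\<lambda>(i,j). T i j) ` ({..<n} \<times> {..<n})"
  obtain p where p: "\<forall>x\<in>?S. poly p x = f x" using poly_interpolation[of ?S f] by auto
  have "hmul n U F X = hmul n U (\<lambda>i j. poly p (T i j)) X"
    using p assms(5) by (intro hmul_cong) auto
  then show ?thesis using hmul_poly_invariant[OF assms(1-4)] by simp
qed

lemma hermitian_M: "hermitian n A \<Longrightarrow> A \<in> M" "hermitian n A \<Longrightarrow> adj A = A"
  by (auto simp: hermitian_def)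

lemma spec_eq: "unitary n U \<Longrightarrow> U * mat_diag n f * adj U = spec U f"
  using unitary_M[of U] by (simp add: spec_def M_assoc)

lemma spec_index: "unitary n U \<Longrightarrow> i < n \<Longrightarrow> j < n \<Longrightarrow> 
    spec U f $$ (i,j) = (\<Sum>l<n. U $$ (i,l) * (f l * cnj (U $$ (j,l))))"
  using unitary_M[of U] by (auto simp: spec_def M_mult_index mat_diag_mult_left[of _ n n])

lemma spec_pow: "unitary n U \<Longrightarrow> spec U f ^\<^sub>m k = spec U (\<lambda>i. f i ^ k)"
proof (induction k)
  case 0 
  then show ?case using carrier_matD[OF spec_closed[OF 0], of f] by (simp add: spec_one)
next
  case (Suc k)
  then show ?case by (simp add: spec_mult mult.commute)
qed

lemma mexp_spec:
  assumes "unitary n U"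
  shows "mexp n (spec U f) = spec U (\<lambda>i. exp (f i))"
proof (rule M_eqI)
  fix i j assume ij: "i < n" "j < n"
  have e: "(\<lambda>k. f l ^ k / of_nat (fact k)) sums exp (f l)" for l
    using exp_converges[of "f l"] by (simp add: scaleR_conv_of_real field_simps)
  have "(\<lambda>k. \<Sum>l<n. U $$ (i,l) * (f l ^ k / of_nat (fact k) * cnj (U $$ (j,l)))) sums
      (\<Sum>l<n. U $$ (i,l) * (exp (f l) * cnj (U $$ (j,l))))"
    by (intro sums_sum sums_mult sums_mult2 e)
  moreover have "(\<Sum>l<n. U $$ (i,l) * (f l ^ k / of_nat (fact k) * cnj (U $$ (j,l)))) = 
      (spec U f ^\<^sub>m k) $$ (i,j) / of_nat (fact k)" for k
    by (simp add: spec_pow assms spec_index ij sum_divide_distrib)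
  ultimately show "mexp n (spec U f) $$ (i,j) = spec U (\<lambda>i. exp (f i)) $$ (i,j)"
    using ij assms by (simp add: mexp_def spec_index sums_iff)
qed (use assms in \<open>auto simp: mexp_def\<close>)

text \<open>The transition matrix \<open>W\<close> between the two eigenbases can have a nonzero
  entry only where \<open>f i = g j\<close>, so it intertwines \<open>h\<close> of the eigenvalues
  as well. This makes \<open>mpowr\<close> independent of the eigendecomposition that its choice
  operator selects.\<close>

lemma spec_fun_unique:
  assumes U: "unitary n U" and V: "unitary n V" and eq: "spec U f = spec V g"
  shows "spec U (\<lambda>i. h (f i)) = spec V (\<lambda>i. h (g i))"
proof -
  note UM = unitary_M[OF U] and VM = unitary_M[OF V]
  define W where "W = adj U * V"
  have W: "W \<in> M" using UM VM by (simp add: W_def)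
  have "adj U * (spec U f * V) = mat_diag n f * W"
    using UM VM by (simp add: spec_def M_assoc unitary_cancel[OF U] unitary_cancel[OF V] W_def)
  moreover have "adj U * (spec V g * V) = W * mat_diag n g"
    using UM VM by (simp add: spec_def M_assoc unitary_cancel[OF U] unitary_cancel[OF V] W_def)
  ultimately have *: "mat_diag n f * W = W * mat_diag n g" using eq by simp
  have *: "f i * W $$ (i,j) = W $$ (i,j) * g j" if "i < n" "j < n" for i j
    using arg_cong[OF *, of "\<lambda>Z. Z $$ (i,j)"] that W
    by (simp add: mat_diag_mult_left[of _ n n] mat_diag_mult_right[of _ n n])
  have "h (f i) * W $$ (i,j) = W $$ (i,j) * h (g j)" if "i < n" "j < n" for i j
  proof -
    have "W $$ (i,j) = 0 \<or> f i = g j" using *[OF that] by (auto simp: mult.commute)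
    then show ?thesis by auto
  qed
  then have "mat_diag n (\<lambda>i. h (f i)) * W = W * mat_diag n (\<lambda>i. h (g i))"
    using W by (intro M_eqI) (auto simp: mat_diag_mult_left[of _ n n] mat_diag_mult_right[of _ n n])
  then have "U * ((mat_diag n (\<lambda>i. h (f i)) * W) * adj V) = U * ((W * mat_diag n (\<lambda>i. h (g i))) * adj V)"
    by simp
  then show ?thesis
    using UM VM by (simp add: spec_def M_assoc unitary_cancel[OF U] unitary_cancel[OF V] W_def)
qed

lemma mpowr_spec:
  assumes U: "unitary n U" and pos: "\<And>i. i < n \<Longrightarrow> lam i > 0"
  shows "mpowr n (spec U (\<lambda>i. complex_of_real (lam i))) s = spec U (\<lambda>i. complex_of_real (lam i powr s))"
  unfolding mpowr_def
proof (rule someI2_ex)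
  let ?r = "spec U (\<lambda>i. complex_of_real (lam i))"
  show "\<exists>X U' lam'. unitary n U' \<and> (\<forall>i<n. 0 < lam' i) \<and>
       ?r = U' * mat_diag n (\<lambda>i. complex_of_real (lam' i)) * adj U' \<and>
       X = U' * mat_diag n (\<lambda>i. complex_of_real (lam' i powr s)) * adj U'"
    using U pos by (intro exI[of _ "spec U (\<lambda>i. complex_of_real (lam i powr s))"] exI[of _ U] exI[of _ lam]) (simp add: spec_eq)
  fix X assume "\<exists>U' lam'. unitary n U' \<and> (\<forall>i<n. 0 < lam' i) \<and>
       ?r = U' * mat_diag n (\<lambda>i. complex_of_real (lam' i)) * adj U' \<and>
       X = U' * mat_diag n (\<lambda>i. complex_of_real (lam' i powr s)) * adj U'"
  then obtain U' lam' where V: "unitary n U'" and *: "?r = U' * mat_diag n (\<lambda>i. complex_of_real (lam' i)) * adj U'" 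
      "X = U' * mat_diag n (\<lambda>i. complex_of_real (lam' i powr s)) * adj U'" by blast
  have "spec U (\<lambda>i. complex_of_real (lam i)) = spec U' (\<lambda>i. complex_of_real (lam' i))"
    unfolding *(1) by (rule spec_eq[OF V])
  from spec_fun_unique[OF U V this, of "\<lambda>z. complex_of_real (Re z powr s)"]
  show "X = spec U (\<lambda>i. complex_of_real (lam i powr s))"
    unfolding *(2) spec_eq[OF V] by simp
qed

end

section \<open>Diagonalisation of hermitian matrices\<close>

lemma exists_unitary_first_column:
  fixes v :: "complex vec"
  assumes v: "v \<in> carrier_vec n" and v0: "v \<noteq> 0\<^sub>v n"
  shows "\<exists>W c. unitary n W \<and> c \<noteq> 0 \<and> col W 0 = c \<cdot>\<^sub>v v"
proof -
  interpret cof_vec_space n "TYPE(complex)" .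
  from v v0 have n: "n \<noteq> 0" by auto
  define b where "b = basis_completion v"
  from basis_completion[OF v v0, folded b_def]
  have span_b: "span (set b) = carrier_vec n" and dist_b: "distinct b" 
    and indep: "\<not> lin_dep (set b)" and b: "set b \<subseteq> carrier_vec n" and hdb: "hd b = v" 
    and len_b: "length b = n" by auto
  from hdb len_b n obtain vs where bv: "b = v # vs" by (cases b, auto)
  \<comment> \<open>Gram-Schmidt keeps the head \<open>v\<close> of the basis; only normalisation
    remains, which is where the scalar \<open>c 0\<close> comes from.\<close>
  define ws where "ws = gram_schmidt n b"
  from gram_schmidt_result[OF b dist_b indep refl, folded ws_def]
  have ws: "set ws \<subseteq> carrier_vec n" "corthogonal ws" "length ws = n" 
    by (auto simp: len_b)
  from gram_schmidt_hd[OF v, of vs, folded bv] have hdws: "hd ws = v" unfolding ws_def .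
  define c where "c j = complex_of_real (1 / sqrt (Re (ws ! j \<bullet>c ws ! j)))" for j
  define W where "W = mat n n (\<lambda>(i,j). c j * (ws ! j) $ i)"
  have carr: "ws ! j \<in> carrier_vec n" if "j < n" for j using ws that by auto
  have orth: "(ws ! i \<bullet>c ws ! j = 0) = (i \<noteq> j)" if "i < n" "j < n" for i j
    using ws that by (auto simp: corthogonal_def)
  have ip: "ws ! i \<bullet>c ws ! j = (\<Sum>k<n. (ws ! i) $ k * cnj ((ws ! j) $ k))" if "i < n" "j < n" for i j
    using carr[OF that(1)] carr[OF that(2)] by (auto simp: scalar_prod_def atLeast0LessThan)
  have pos: "ws ! j \<bullet>c ws ! j = complex_of_real (Re (ws ! j \<bullet>c ws ! j))" "Re (ws ! j \<bullet>c ws ! j) > 0" if "j < n" for j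
  proof -
    have *: "ws ! j \<bullet>c ws ! j = complex_of_real (\<Sum>k<n. (cmod ((ws ! j) $ k))\<^sup>2)"
      by (simp only: ip[OF that that] of_real_sum complex_norm_square)
    then show "ws ! j \<bullet>c ws ! j = complex_of_real (Re (ws ! j \<bullet>c ws ! j))" by (metis Re_complex_of_real)
    have "Re (ws ! j \<bullet>c ws ! j) \<ge> 0" unfolding * Re_complex_of_real by (simp add: sum_nonneg)
    moreover have "Re (ws ! j \<bullet>c ws ! j) \<noteq> 0" using orth[OF that that] * by (metis Re_complex_of_real of_real_0)
    ultimately show "Re (ws ! j \<bullet>c ws ! j) > 0" by simp
  qed
  have cc: "cnj (c j) = c j" for j by (simp add: c_def)
  have ws0: "ws ! 0 = v" using hdws n ws(3) by (cases ws) auto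
  have "adj W * W = 1\<^sub>m n"
  proof (rule eq_matI)
    fix i j assume "i < dim_row (1\<^sub>m n :: complex mat)" "j < dim_col (1\<^sub>m n :: complex mat)"
    then have ij: "i < n" "j < n" by auto
    have "(adj W * W) $$ (i,j) = (\<Sum>k<n. cnj (c i * (ws ! i) $ k) * (c j * (ws ! j) $ k))"
      using ij by (subst index_mult_sum[of _ n n _ n]) (auto simp: W_def)
    also have "\<dots> = c i * c j * (ws ! j \<bullet>c ws ! i)"
      using ij by (simp add: ip sum_distrib_left cc mult_ac)
    also have "\<dots> = (if i = j then 1 else 0)"
    proof (cases "i = j")
      case True
      have "c j * c j * complex_of_real (Re (ws ! j \<bullet>c ws ! j)) = 1"
        using pos(2)[OF ij(2)] unfolding c_def of_real_mult[symmetric] 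
        by (simp add: field_simps power2_eq_square[symmetric] del: of_real_mult)
      then show ?thesis using pos(1)[OF ij(2)] True by simp
    qed (use orth[OF ij(2,1)] in auto)
    finally show "(adj W * W) $$ (i,j) = 1\<^sub>m n $$ (i,j)" using ij by simp
  qed (auto simp: W_def)
  then have "unitary n W" by (auto simp: unitary_def W_def)
  moreover have "col W 0 = c 0 \<cdot>\<^sub>v v" using n v ws0
    by (intro eq_vecI) (auto simp: W_def)
  moreover have "c 0 \<noteq> 0" using pos(2)[of 0] n by (auto simp: c_def)
  ultimately show ?thesis by blast
qed

context square_mats
begin

lemma unitary_mult:
  assumes "unitary n U" "unitary n V" shows "unitary n (U * V)"
  using unitary_M[OF assms(1)] unitary_M[OF assms(2)]
  by (auto simp: unitary_def M_adj M_assoc unitary_cancel[OF assms(1)])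

end

text \<open>\<open>B\<close> is the block sum of the number \<open>e\<close> and the matrix
  \<open>D\<close>, so the block sum \<open>U1\<close> of 1 and \<open>U'\<close> diagonalises
  it.\<close>

lemma spectral_theorem_Suc:
  fixes D :: "complex mat"
  assumes U': "unitary m U'" and D: "D = U' * mat_diag m (\<lambda>i. complex_of_real (lam' i)) * adj U'"
    and B: "B \<in> carrier_mat (Suc m) (Suc m)" and BD: "\<And>i j. i < m \<Longrightarrow> j < m \<Longrightarrow> B $$ (Suc i, Suc j) = D $$ (i,j)"
    and B0: "B $$ (0,0) = complex_of_real e" "\<And>i. i < m \<Longrightarrow> B $$ (Suc i, 0) = 0" "\<And>i. i < m \<Longrightarrow> B $$ (0, Suc i) = 0"
  shows "\<exists>U lam. unitary (Suc m) U \<and> B = U * mat_diag (Suc m) (\<lambda>i. complex_of_real (lam i)) * adj U"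
proof -
  interpret m: square_mats m .
  interpret sm: square_mats "Suc m" .
  note U'M = m.unitary_M[OF U']
  define U1 where "U1 = mat (Suc m) (Suc m) (\<lambda>(i,j). case i of 0 \<Rightarrow> (case j of 0 \<Rightarrow> 1 | Suc _ \<Rightarrow> 0) 
     | Suc i' \<Rightarrow> (case j of 0 \<Rightarrow> 0 | Suc j' \<Rightarrow> U' $$ (i',j')))"
  have U1c: "U1 \<in> carrier_mat (Suc m) (Suc m)" by (simp add: U1_def)
  have U1i: "U1 $$ (0,0) = 1" "\<And>i. i < m \<Longrightarrow> U1 $$ (Suc i, 0) = 0" "\<And>i. i < m \<Longrightarrow> U1 $$ (0, Suc i) = 0"
     "\<And>i j. i < m \<Longrightarrow> j < m \<Longrightarrow> U1 $$ (Suc i, Suc j) = U' $$ (i,j)"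
    by (simp_all add: U1_def)
  have one: "(\<Sum>k<m. cnj (U' $$ (k,i)) * U' $$ (k,j)) = (if i = j then 1 else 0)" if "i < m" "j < m" for i j
    using arg_cong[OF U'M(3), of "\<lambda>Z. Z $$ (i,j)"] that U'M(1) by (simp add: m.M_mult_index)
  have "adj U1 * U1 = 1\<^sub>m (Suc m)"
  proof (rule sm.M_eqI)
    fix i j assume ij: "i < Suc m" "j < Suc m"
    have "(adj U1 * U1) $$ (i,j) = (\<Sum>k<Suc m. cnj (U1 $$ (k,i)) * U1 $$ (k,j))"
      using ij U1c by (simp add: sm.M_mult_index del: sum.lessThan_Suc)
    also have "\<dots> = (if i = j then 1 else 0)"
      using ij by (cases i; cases j) (auto simp: sum.lessThan_Suc_shift U1i one simp del: sum.lessThan_Suc)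
    finally show "(adj U1 * U1) $$ (i,j) = 1\<^sub>m (Suc m) $$ (i,j)" using ij by simp
  qed (use U1c in auto)
  then have uni: "unitary (Suc m) U1" using U1c by (simp add: unitary_def)
  define lam where "lam i = (case i of 0 \<Rightarrow> e | Suc i' \<Rightarrow> lam' i')" for i
  have De: "D $$ (i,j) = (\<Sum>l<m. U' $$ (i,l) * (complex_of_real (lam' l) * cnj (U' $$ (j,l))))" if "i < m" "j < m" for i j
    using that unfolding D m.spec_eq[OF U'] by (rule m.spec_index[OF U'])
  have "B = sm.spec U1 (\<lambda>i. complex_of_real (lam i))"
  proof (rule sm.M_eqI)
    fix i j assume ij: "i < Suc m" "j < Suc m"
    have "B $$ (i,j) = (\<Sum>l<Suc m. U1 $$ (i,l) * (complex_of_real (lam l) * cnj (U1 $$ (j,l))))"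
      using ij by (cases i; cases j) (auto simp: sum.lessThan_Suc_shift U1i BD B0 De lam_def simp del: sum.lessThan_Suc)
    then show "B $$ (i,j) = sm.spec U1 (\<lambda>i. complex_of_real (lam i)) $$ (i,j)" 
      using sm.spec_index[OF uni ij, of "\<lambda>i. complex_of_real (lam i)"] by simp
  qed (use B uni in auto)
  then show ?thesis using uni sm.spec_eq[OF uni] by metis
qed

theorem spectral_theorem:
  assumes "hermitian n A"
  shows "\<exists>U lam. unitary n U \<and> A = U * mat_diag n (\<lambda>i. complex_of_real (lam i)) * adj U"
  using assms
proof (induction n arbitrary: A)
  case 0
  then show ?case by (intro exI[of _ "1\<^sub>m 0"]) (auto simp: unitary_def hermitian_def intro!: eq_matI)
next
  case (Suc m)
  interpret sm: square_mats "Suc m" .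
  have A: "A \<in> carrier_mat (Suc m) (Suc m)" and adjA: "adj A = A" using Suc.prems by (auto simp: hermitian_def)
  obtain e where "eigenvalue A e" using spectrum_non_empty[OF A] by (auto simp: spectrum_def)
  then obtain v where v: "v \<in> carrier_vec (Suc m)" "v \<noteq> 0\<^sub>v (Suc m)" "A *\<^sub>v v = e \<cdot>\<^sub>v v"
    using A by (auto simp: eigenvalue_def eigenvector_def)
  obtain W c where W: "unitary (Suc m) W" and colW: "col W 0 = c \<cdot>\<^sub>v v"
    using exists_unitary_first_column[OF v(1,2)] by blast
  note WM = sm.unitary_M[OF W]
  \<comment> \<open>Deflation: the first basis vector is an eigenvector, so the first column of
    \<open>B\<close> is \<open>e\<close> followed by zeros, and by hermiticity so is the first
    row.\<close>
  define B where "B = adj W * (A * W)"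
  have B: "B \<in> carrier_mat (Suc m) (Suc m)" using WM A by (simp add: B_def)
  have adjB: "adj B = B" using WM A adjA by (simp add: B_def sm.M_adj sm.M_assoc)
  have AW: "(A * W) $$ (k,0) = e * W $$ (k,0)" if "k < Suc m" for k
  proof -
    have "col (A * W) 0 = A *\<^sub>v col W 0" using A WM(1) by (intro col_mult2) auto
    also have "\<dots> = c \<cdot>\<^sub>v (A *\<^sub>v v)" unfolding colW by (rule mult_mat_vec[OF A v(1)])
    also have "\<dots> = e \<cdot>\<^sub>v col W 0" unfolding v(3) colW by (simp add: smult_smult_assoc mult.commute)
    finally have "col (A * W) 0 $ k = (e \<cdot>\<^sub>v col W 0) $ k" by simp
    then show ?thesis using that A WM(1) by (auto simp: col_def)
  qed
  have B0: "B $$ (i,0) = (if i = 0 then e else 0)" if i: "i < Suc m" for i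
  proof -
    have "B $$ (i,0) = (\<Sum>k<Suc m. adj W $$ (i,k) * (e * W $$ (k,0)))"
      unfolding B_def using i A WM by (subst sm.M_mult_index) (auto intro!: sum.cong simp: AW simp del: sum.lessThan_Suc)
    also have "\<dots> = e * (adj W * W) $$ (i,0)" using i WM(1,2) 
      by (subst sm.M_mult_index) (auto simp: sum_distrib_left mult_ac simp del: sum.lessThan_Suc)
    finally show ?thesis using i WM(3) by simp
  qed
  have sym: "B $$ (i,j) = cnj (B $$ (j,i))" if "i < Suc m" "j < Suc m" for i j
    using arg_cong[OF adjB, of "\<lambda>Z. Z $$ (i,j)"] that B by simp
  have b00: "B $$ (0,0) = e" using B0[of 0] by simp
  have "e = cnj e" by (rule sym[OF zero_less_Suc zero_less_Suc, unfolded b00])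
  then have "Im e = Im (cnj e)" by (rule arg_cong)
  then have "Im e = 0" by simp
  then have e: "e = complex_of_real (Re e)" by (simp add: complex_eq_iff)
  define D where "D = mat m m (\<lambda>(i,j). B $$ (Suc i, Suc j))"
  have "hermitian m D" by (auto simp: hermitian_def D_def intro!: eq_matI sym[symmetric])
  then obtain U' lam' where U': "unitary m U'" "D = U' * mat_diag m (\<lambda>i. complex_of_real (lam' i)) * adj U'"
    using Suc.IH by blast
  have BS: "B $$ (0,0) = complex_of_real (Re e)" "\<And>i. i < m \<Longrightarrow> B $$ (Suc i, 0) = 0" 
    "\<And>i. i < m \<Longrightarrow> B $$ (0, Suc i) = 0"
  proof -
    show "B $$ (0,0) = complex_of_real (Re e)" unfolding b00 by (rule e)
    show col0: "B $$ (Suc i, 0) = 0" if "i < m" for i using that B0[of "Suc i"] by simp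
    show "B $$ (0, Suc i) = 0" if "i < m" for i 
      using that by (subst sym) (simp_all add: col0)
  qed
  have BD: "B $$ (Suc i, Suc j) = D $$ (i,j)" if "i < m" "j < m" for i j using that by (simp add: D_def)
  obtain U lam where U: "unitary (Suc m) U" "B = U * mat_diag (Suc m) (\<lambda>i. complex_of_real (lam i)) * adj U"
    using spectral_theorem_Suc[OF U' B BD BS] by blast
  note UM = sm.unitary_M[OF U(1)]
  have "A = W * (B * adj W)" using A WM by (simp add: B_def sm.M_assoc sm.unitary_cancel[OF W])
  also have "\<dots> = (W * U) * mat_diag (Suc m) (\<lambda>i. complex_of_real (lam i)) * adj (W * U)"
    unfolding U(2) using UM WM by (simp add: sm.M_adj sm.M_assoc)
  finally show ?case using sm.unitary_mult[OF W U(1)] by blast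
qed

section \<open>Positive definite matrices, weighted forms and orthogonal projection\<close>

context square_mats
begin

lemma hermitian_spec:
  assumes "hermitian n A"
  obtains U lam where "unitary n U" "A = spec U (\<lambda>i. complex_of_real (lam i))"
  using spectral_theorem[OF assms] spec_eq by metis

lemma qform_eq:
  assumes "A \<in> M" "v \<in> carrier_vec n"
  shows "qform A v = (\<Sum>i<n. cnj (v $ i) * (\<Sum>j<n. A $$ (i,j) * v $ j))"
  using assms by (simp add: qform_def sum_distrib_left mult_ac)

text \<open>The quadratic form at the \<open>k\<close>-th eigenvector, column \<open>k\<close> of
  \<open>U\<close>, is the eigenvalue.\<close>

lemma posdef_spec_pos:
  assumes U: "unitary n U" and pd: "posdef n (spec U (\<lambda>i. complex_of_real (lam i)))" and k: "k < n"
  shows "lam k > 0"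
proof -
  note UM = unitary_M[OF U]
  let ?A = "spec U (\<lambda>i. complex_of_real (lam i))"
  define v where "v = col U k"
  have v: "v \<in> carrier_vec n" "\<And>i. i < n \<Longrightarrow> v $ i = U $$ (i,k)" using UM k by (auto simp: v_def)
  have "adj U * (?A * U) = mat_diag n (\<lambda>i. complex_of_real (lam i))"
    using UM by (simp add: spec_def M_assoc unitary_cancel[OF U])
  then have "(adj U * (?A * U)) $$ (k,k) = complex_of_real (lam k)" using k by (simp add: mat_diag_def)
  moreover have "(adj U * (?A * U)) $$ (k,k) = qform ?A v"
    using UM U v k by (simp add: qform_eq M_mult_index)
  ultimately have q: "qform ?A v = complex_of_real (lam k)" by simp
  have "v \<noteq> 0\<^sub>v n"
  proof
    assume "v = 0\<^sub>v n"
    then have "U $$ (i,k) = 0" if "i < n" for i using v(2)[OF that] that by simp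
    then have "(adj U * U) $$ (k,k) = 0" using UM k by (subst M_mult_index) auto
    then show False using UM(3) k by simp
  qed
  then show ?thesis using pd q v(1) by (auto simp: posdef_def)
qed

text \<open>The quadratic form at \<open>v\<close> is the squared norm of \<open>Z v\<close>, which
  the left inverse \<open>W\<close> keeps from vanishing.\<close>

lemma posdef_adj_mult:
  assumes Z: "Z \<in> M" and W: "W \<in> M" "W * Z = 1\<^sub>m n"
  shows "posdef n (adj Z * Z)"
  unfolding posdef_def
proof (intro conjI ballI impI)
  show "hermitian n (adj Z * Z)" using Z by (simp add: hermitian_def M_adj)
  fix v :: "complex vec" assume v: "v \<in> carrier_vec n" 
  define y where "y i = (\<Sum>j<n. Z $$ (i,j) * v $ j)" for i
  have "qform (adj Z * Z) v = (\<Sum>i<n. \<Sum>j<n. \<Sum>k<n. cnj (v $ i) * (cnj (Z $$ (k,i)) * Z $$ (k,j) * v $ j))"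
    using Z v by (simp add: qform_def M_mult_index sum_distrib_left sum_distrib_right mult_ac)
  also have "\<dots> = (\<Sum>i<n. \<Sum>k<n. \<Sum>j<n. cnj (v $ i) * (cnj (Z $$ (k,i)) * Z $$ (k,j) * v $ j))"
    by (rule sum.cong[OF refl]) (rule sum.swap)
  also have "\<dots> = (\<Sum>k<n. \<Sum>i<n. \<Sum>j<n. cnj (v $ i) * (cnj (Z $$ (k,i)) * Z $$ (k,j) * v $ j))"
    by (rule sum.swap)
  also have "\<dots> = (\<Sum>k<n. cnj (y k) * y k)"
    unfolding y_def cnj_sum sum_product by (simp add: mult_ac)
  also have "\<dots> = (\<Sum>k<n. y k * cnj (y k))" by (simp only: mult.commute)
  also have "\<dots> = complex_of_real (\<Sum>k<n. (cmod (y k))\<^sup>2)"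
    by (simp only: of_real_sum complex_norm_square)
  finally have q: "qform (adj Z * Z) v = complex_of_real (\<Sum>k<n. (cmod (y k))\<^sup>2)" .
  show "Im (qform (adj Z * Z) v) = 0" unfolding q by (rule Im_complex_of_real)
  assume v0: "v \<noteq> 0\<^sub>v n"
  have "(\<Sum>k<n. (cmod (y k))\<^sup>2) \<noteq> 0"
  proof
    assume "(\<Sum>k<n. (cmod (y k))\<^sup>2) = 0"
    then have y0: "y k = 0" if "k < n" for k using that by (simp add: sum_nonneg_eq_0_iff)
    have "v $ i = 0" if i: "i < n" for i
    proof -
      have "v $ i = (\<Sum>j<n. (if i = j then 1 else 0) * v $ j)" using i by (simp add: if_distrib[of "\<lambda>x. x * _"] cong: if_cong)
      also have "\<dots> = (\<Sum>j<n. (W * Z) $$ (i,j) * v $ j)" unfolding W(2) using i by (intro sum.cong) auto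
      also have "\<dots> = (\<Sum>j<n. \<Sum>k<n. W $$ (i,k) * (Z $$ (k,j) * v $ j))"
        using W(1) Z i by (simp add: M_mult_index sum_distrib_right sum_distrib_left mult_ac)
      also have "\<dots> = (\<Sum>k<n. W $$ (i,k) * y k)"
        unfolding y_def sum_distrib_left by (rule sum.swap)
      finally show ?thesis using y0 by simp
    qed
    then have "v = 0\<^sub>v n" using v by (intro eq_vecI) auto
    then show False using v0 by simp
  qed
  moreover have "(\<Sum>k<n. (cmod (y k))\<^sup>2) \<ge> 0" by (simp add: sum_nonneg)
  ultimately show "Re (qform (adj Z * Z) v) > 0" unfolding q Re_complex_of_real by linarith
qed

text \<open>In the eigenbasis the form is diagonal, with weights \<open>G\<close> on the squared
  moduli of the matrix entries. Hence it is real, and definite once the weights are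
  positive.\<close>

lemma form_sum_squares:
  assumes U: "unitary n U" and A: "A \<in> M"
  shows "tr (adj A * hmul n U (\<lambda>i j. complex_of_real (G i j)) A) = 
    complex_of_real (\<Sum>i<n. \<Sum>l<n. G l i * (cmod ((adj U * (A * U)) $$ (l,i)))\<^sup>2)"
proof -
  note UM = unitary_M[OF U]
  have "adj U * (adj A * U) = adj (adj U * (A * U))" using A UM by (simp add: M_adj M_assoc)
  then have *: "(adj U * (adj A * U)) $$ (i,l) = cnj ((adj U * (A * U)) $$ (l,i))" if "i < n" "l < n" for i l
    using that A UM by simp
  have "tr (adj A * hmul n U (\<lambda>i j. complex_of_real (G i j)) A) = 
     (\<Sum>i<n. \<Sum>l<n. complex_of_real (G l i) * ((adj U * (A * U)) $$ (l,i) * cnj ((adj U * (A * U)) $$ (l,i))))"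
    using A U by (subst tr_basis[OF U]) (auto simp: hmul_basis * intro!: sum.cong)
  also have "\<dots> = (\<Sum>i<n. \<Sum>l<n. complex_of_real (G l i) * complex_of_real ((cmod ((adj U * (A * U)) $$ (l,i)))\<^sup>2))"
    by (simp only: complex_norm_square)
  finally show ?thesis by simp
qed

lemma form_pos:
  assumes U: "unitary n U" and A: "A \<in> M" and G: "\<And>i j. i < n \<Longrightarrow> j < n \<Longrightarrow> G i j > 0"
    and A0: "A \<noteq> 0\<^sub>m n n"
  shows "Re (tr (adj A * hmul n U (\<lambda>i j. complex_of_real (G i j)) A)) > 0"
proof -
  note UM = unitary_M[OF U]
  have "\<exists>l<n. \<exists>i<n. (adj U * (A * U)) $$ (l,i) \<noteq> 0"
  proof (rule ccontr)
    assume "\<not> ?thesis"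
    then have z: "\<And>l i. l < n \<Longrightarrow> i < n \<Longrightarrow> (adj U * (A * U)) $$ (l,i) = 0" by blast
    have "adj U * (A * U) = 0\<^sub>m n n" by (rule M_eqI) (use UM A z in auto)
    also have "\<dots> = adj U * (0\<^sub>m n n * U)" using UM(1,2) by simp
    finally have "A = 0\<^sub>m n n" by (rule basis_eqI[OF U A zero_carrier_mat])
    then show False using A0 by simp
  qed
  then obtain l i where li: "l < n" "i < n" "(adj U * (A * U)) $$ (l,i) \<noteq> 0" by blast
  define g where "g i l = G l i * (cmod ((adj U * (A * U)) $$ (l,i)))\<^sup>2" for i l
  have nn: "g i l \<ge> 0" if "i < n" "l < n" for i l using G[OF that(2,1)] by (simp add: g_def)
  have "0 < g i l" using G[OF li(1,2)] li(3) by (simp add: g_def)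
  also have "g i l \<le> sum (g i) {..<n}" by (rule member_le_sum) (use nn li in auto)
  also have "sum (g i) {..<n} \<le> (\<Sum>i<n. sum (g i) {..<n})"
    by (rule member_le_sum[where f = "\<lambda>i. sum (g i) {..<n}"]) (use nn li in \<open>auto intro!: sum_nonneg\<close>)
  finally show ?thesis unfolding form_sum_squares[OF U A] Re_complex_of_real by (simp add: g_def)
qed

definition mspan :: "complex mat set \<Rightarrow> complex mat set" where
  "mspan S = \<Inter>{V. mat_subspace V \<and> S \<subseteq> V}"

lemma mat_subspace_M: "mat_subspace M" by (auto simp: mat_subspace_def)

lemma mat_subspace_mspan: 
  assumes "S \<subseteq> M" shows "mat_subspace (mspan S)"
proof -
  have "mspan S \<subseteq> M" unfolding mspan_def using assms mat_subspace_M by blast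
  then show ?thesis unfolding mat_subspace_def mspan_def by auto
qed

lemma mspan_base: "X \<in> S \<Longrightarrow> X \<in> mspan S" by (auto simp: mspan_def)

lemma mspan_least: "mat_subspace V \<Longrightarrow> S \<subseteq> V \<Longrightarrow> mspan S \<subseteq> V" by (auto simp: mspan_def)

lemma mspan_mono: "S \<subseteq> T \<Longrightarrow> mspan S \<subseteq> mspan T" by (auto simp: mspan_def)

lemma mat_subspace_orth: "Z \<in> M \<Longrightarrow> mat_subspace {X \<in> M. tr (adj X * Z) = 0}"
  by (auto simp: mat_subspace_def M_adj M_distrib M_tr adj_smult M_smult)

text \<open>Gram-Schmidt for the form weighted by \<open>G\<close>, one generator at a time.
  Dependent generators are harmless: they only produce a zero correction vector
  \<open>b'\<close>.\<close>

lemma projection: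
  assumes U: "unitary n U" and G: "\<And>i j. i < n \<Longrightarrow> j < n \<Longrightarrow> G i j > 0"
    and S: "finite S" "S \<subseteq> M" and "\<sigma> \<in> M"
  shows "\<exists>x\<in>mspan S. \<forall>b\<in>S. tr (adj b * hmul n U (\<lambda>i j. complex_of_real (G i j)) (\<sigma> - x)) = 0"
  using S \<open>\<sigma> \<in> M\<close>
proof (induction S arbitrary: \<sigma>)
  case empty
  then show ?case using mat_subspace_mspan[of "{}"] mat_subspaceD(2) by blast
next
  case (insert b S)
  let ?O = "hmul n U (\<lambda>i j. complex_of_real (G i j))"
  have S: "S \<subseteq> M" and b: "b \<in> M" using insert.prems by auto
  note sub = mat_subspace_mspan[OF S]
  obtain x0 where x0: "x0 \<in> mspan S" "\<forall>s\<in>S. tr (adj s * ?O (\<sigma> - x0)) = 0"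
    using insert.IH[OF S insert.prems(2)] by blast
  \<comment> \<open>The induction hypothesis is applied to the new generator itself;
    \<open>b - y0\<close> is its part orthogonal to the old ones.\<close>
  obtain y0 where y0: "y0 \<in> mspan S" "\<forall>s\<in>S. tr (adj s * ?O (b - y0)) = 0"
    using insert.IH[OF S b] by blast
  have x0M: "x0 \<in> M" and y0M: "y0 \<in> M" using x0 y0 mat_subspaceD(1)[OF sub] by auto
  note carr = x0M y0M b insert.prems(2)
  have ext: "tr (adj y * ?O Z) = 0" if "\<forall>s\<in>S. tr (adj s * ?O Z) = 0" "y \<in> mspan S" "Z \<in> M" for y Z
    using mspan_least[OF mat_subspace_orth[of "?O Z"], of S] that S U by auto
  define b' where "b' = b - y0"
  have b'M: "b' \<in> M" using carr by (simp add: b'_def)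
  have bb: "b = b' + y0" using carr by (intro M_eqI) (auto simp: b'_def)
  \<comment> \<open>If \<open>b'\<close> is zero, so is the denominator, and division by zero gives
    \<open>c = 0\<close>; then \<open>x = x0\<close>.\<close>
  define c where "c = tr (adj b' * ?O (\<sigma> - x0)) / tr (adj b' * ?O b')"
  define x where "x = x0 + c \<cdot>\<^sub>m b'"
  have xM: "x \<in> M" using carr b'M by (simp add: x_def)
  have lin: "tr (adj s * ?O (\<sigma> - x)) = tr (adj s * ?O (\<sigma> - x0)) - c * tr (adj s * ?O b')" if "s \<in> M" for s
  proof -
    have "\<sigma> - x = (\<sigma> - x0) - c \<cdot>\<^sub>m b'" using carr b'M by (intro M_eqI) (auto simp: x_def)
    then show ?thesis using carr b'M that U 
      by (simp add: hmul_minus[OF U] hmul_smult[OF U] M_distrib M_smult M_tr)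
  qed
  have on_S: "\<forall>s\<in>S. tr (adj s * ?O (\<sigma> - x)) = 0"
    using lin x0(2) y0(2) S by (auto simp: b'_def)
  have "tr (adj b' * ?O (\<sigma> - x)) = 0"
  proof (cases "b' = 0\<^sub>m n n")
    case True
    moreover have "0\<^sub>m n n * ?O (\<sigma> - x) = 0\<^sub>m n n" 
      using U by (intro left_mult_zero_mat[of _ n n]) simp
    ultimately show ?thesis by simp
  next
    case False
    then have "tr (adj b' * ?O b') \<noteq> 0" using form_pos[OF U b'M G False] by force
    then show ?thesis using lin[OF b'M] by (simp add: c_def)
  qed
  moreover have "tr (adj y0 * ?O (\<sigma> - x)) = 0" using ext[OF on_S y0(1)] carr xM by simp
  ultimately have "tr (adj b * ?O (\<sigma> - x)) = 0"
    using carr b'M xM U unfolding bb by (simp add: M_adj M_distrib M_tr)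
  moreover have "x \<in> mspan (insert b S)"
  proof -
    note sub' = mat_subspace_mspan[OF insert.prems(1)]
    have "x0 \<in> mspan (insert b S)" "y0 \<in> mspan (insert b S)" "b \<in> mspan (insert b S)"
      using x0 y0 mspan_mono[of S "insert b S"] mspan_base[of b "insert b S"] by auto
    then show ?thesis unfolding x_def b'_def using mat_subspace_minus[OF sub'] mat_subspaceD(3,4)[OF sub'] by simp
  qed
  ultimately show ?case using on_S by blast
qed

end

section \<open>Majorana operators\<close>

text \<open>Abstracts from the mode operators: only hermiticity, the Clifford relations and the
  dimension are kept. The primed assumptions use the literal index set and are restated below over
  \<open>I\<close>.\<close>

locale clifford = square_mats n for n :: nat +
  fixes N :: nat and c :: "nat \<Rightarrow> complex mat"
  assumes n_eq: "n = 2 ^ N"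
    and c_M': "k \<in> {1..2*N} \<Longrightarrow> c k \<in> carrier_mat n n"
    and c_adj': "k \<in> {1..2*N} \<Longrightarrow> adj (c k) = c k"
    and c_anticomm': "k \<in> {1..2*N} \<Longrightarrow> l \<in> {1..2*N} \<Longrightarrow> c k * c l + c l * c k = (if k = l then 2 else 0) \<cdot>\<^sub>m 1\<^sub>m n"
begin

definition I :: "nat set" where "I = {1..2*N}"

lemma finite_I [simp]: "finite I" by (simp add: I_def)

lemma card_I [simp]: "card I = 2*N" by (simp add: I_def)

lemmas c_M = c_M'[folded I_def]
lemmas c_adj = c_adj'[folded I_def]
lemmas c_anticomm = c_anticomm'[folded I_def]

lemma n_pos: "n > 0" by (simp add: n_eq)

lemma of_nat_n [simp]: "(of_nat n :: complex) \<noteq> 0" using n_pos by simp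

lemma c_square: 
  assumes "k \<in> I" shows "c k * c k = 1\<^sub>m n"
proof (rule M_eqI)
  fix i j assume ij: "i < n" "j < n"
  have "(c k * c k + c k * c k) $$ (i,j) = (2 \<cdot>\<^sub>m 1\<^sub>m n) $$ (i,j)" 
    using c_anticomm[OF assms assms] by simp
  then show "(c k * c k) $$ (i,j) = 1\<^sub>m n $$ (i,j)" using ij c_M[OF assms] by (simp split: if_splits)
qed (use c_M[OF assms] in auto)

lemma c_swap: 
  assumes "k \<in> I" "l \<in> I" shows "c k * c l = (if k = l then 2 else 0) \<cdot>\<^sub>m 1\<^sub>m n - c l * c k"
  unfolding c_anticomm[OF assms, symmetric] using c_M assms by (intro M_eqI) auto

lemma c_anti: 
  assumes "k \<in> I" "l \<in> I" "k \<noteq> l" shows "c k * c l = (-1) \<cdot>\<^sub>m (c l * c k)"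
  using c_swap[OF assms(1,2)] assms(3) c_M[OF assms(1)] c_M[OF assms(2)] by (intro M_eqI) auto

lemma tr_cc: 
  assumes "k \<in> I" "l \<in> I" shows "tr (c k * c l) = (if k = l then of_nat n else 0)"
proof (cases "k = l")
  case False
  have "tr (c k * c l) = - tr (c l * c k)"
    using c_anti[OF assms False] c_M assms by (simp add: M_tr)
  also have "tr (c l * c k) = tr (c k * c l)" using c_M assms by (intro M_tr_comm) auto
  finally show ?thesis using False by simp
qed (use c_square assms in simp)

primrec mono :: "nat \<Rightarrow> nat set \<Rightarrow> complex mat" where
  "mono 0 S = 1\<^sub>m n"
| "mono (Suc m) S = mono m S * (if Suc m \<in> S then c (Suc m) else 1\<^sub>m n)"

lemma mono_M: "m \<le> 2*N \<Longrightarrow> mono m S \<in> M"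
  by (induction m) (auto simp: c_M I_def)

lemma mono_unitary: "m \<le> 2*N \<Longrightarrow> mono m S * adj (mono m S) = 1\<^sub>m n"
proof (induction m)
  case (Suc m)
  then have k: "Suc m \<in> I" and P: "mono m S \<in> M" using mono_M by (auto simp: I_def)
  have "c (Suc m) * (c (Suc m) * adj (mono m S)) = (c (Suc m) * c (Suc m)) * adj (mono m S)"
    using c_M[OF k] P by (intro M_assoc[symmetric]) auto
  then show ?case using Suc c_M[OF k] P c_adj[OF k] c_square[OF k] by (auto simp: M_adj M_assoc)
qed simp

text \<open>Moving \<open>c k\<close> through a monomial costs a sign for each factor other than
  \<open>c k\<close> itself.\<close>

fun csign :: "nat \<Rightarrow> nat \<Rightarrow> nat set \<Rightarrow> complex" where
  "csign k 0 S = 1"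
| "csign k (Suc m) S = csign k m S * (if Suc m \<in> S \<and> Suc m \<noteq> k then -1 else 1)"

lemma csign_card: "csign k m S = (-1) ^ card (S \<inter> {1..m} - {k})"
proof (induction m)
  case (Suc m)
  have e: "S \<inter> {1..Suc m} - {k} = (if Suc m \<in> S \<and> Suc m \<noteq> k then insert (Suc m) (S \<inter> {1..m} - {k}) else S \<inter> {1..m} - {k})"
    by (auto simp: le_Suc_eq)
  show ?case unfolding e using Suc by auto
qed simp

lemma c_mono: 
  assumes "k \<in> I" "m \<le> 2*N"
  shows "c k * mono m S = csign k m S \<cdot>\<^sub>m (mono m S * c k)"
  using assms(2)
proof (induction m)
  case 0
  then show ?case using c_M[OF assms(1)] by (auto intro!: eq_matI)
next
  case (Suc m)
  then have k: "Suc m \<in> I" and P: "mono m S \<in> M" using mono_M by (auto simp: I_def)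
  note carr = c_M[OF k] P c_M[OF assms(1)]
  have IH: "c k * mono m S = csign k m S \<cdot>\<^sub>m (mono m S * c k)" using Suc by simp
  have as: "c k * (mono m S * Z) = csign k m S \<cdot>\<^sub>m (mono m S * (c k * Z))" if "Z \<in> M" for Z
  proof -
    have "c k * (mono m S * Z) = (c k * mono m S) * Z" using carr that by (intro M_assoc[symmetric])
    then show ?thesis unfolding IH using carr that by (simp add: M_smult M_assoc)
  qed
  show ?case
  proof (cases "Suc m \<in> S")
    case True
    have "c k * c (Suc m) = (if Suc m \<noteq> k then -1 else 1) \<cdot>\<^sub>m (c (Suc m) * c k)"
    proof (cases "Suc m = k")
      case True
      then show ?thesis using carr by (auto intro!: eq_matI)
    next
      case False
      then show ?thesis using c_anti[OF assms(1) k] by auto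
    qed
    then show ?thesis using True carr as[of "c (Suc m)"]
      by (simp add: M_smult M_assoc smult_smult_mat)
  next
    case False
    then show ?thesis using carr IH by simp
  qed
qed

text \<open>The sign is governed by the parity of \<open>card (S - {k}) + card (T - {k})\<close>. If
  \<open>card S + card T\<close> is even, a \<open>k\<close> in exactly one of the sets makes it
  odd. If it is odd, a \<open>k\<close> in both sets or in neither leaves it odd.\<close>

lemma sign_exists:
  assumes S: "S \<subseteq> I" and T: "T \<subseteq> I" and ne: "S \<noteq> T"
  shows "\<exists>k\<in>I. csign k (2*N) S * csign k (2*N) T = -1"
proof -
  have fin: "finite S" "finite T" using finite_subset[OF S] finite_subset[OF T] by auto
  have cs: "csign k (2*N) S = (-1) ^ card (S - {k})"
    if "S \<subseteq> I" for k S using that by (simp add: csign_card Int_absorb2 I_def)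
  have "\<exists>k\<in>I. odd (card (S - {k}) + card (T - {k}))"
  proof (cases "even (card S + card T)")
    case True
    obtain k where k: "k \<in> I" "(k \<in> S) \<noteq> (k \<in> T)" using S T ne by blast
    then show ?thesis using True fin card_gt_0_iff[of S] card_gt_0_iff[of T]
      by (intro bexI[of _ k]) (auto simp: card_Diff_singleton_if)
  next
    case False
    \<comment> \<open>Otherwise \<open>T\<close> is the complement of \<open>S\<close>, and the two
      cardinalities add up to the even number \<open>2*N\<close>.\<close>
    have "\<exists>k\<in>I. (k \<in> S) = (k \<in> T)"
    proof (rule ccontr)
      assume "\<not> ?thesis"
      then have *: "T = I - S" using S T by blast
      have "card T = 2*N - card S" unfolding * using S fin by (simp add: card_Diff_subset)
      moreover have "card S \<le> 2*N" using card_mono[OF _ S] by simp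
      ultimately show False using False by simp
    qed
    then obtain k where k: "k \<in> I" "(k \<in> S) = (k \<in> T)" by blast
    have "card S > 0" "card T > 0" if "k \<in> S" using that k fin by (auto simp: card_gt_0_iff)
    then show ?thesis using k False 
      by (intro bexI[of _ k]) (auto simp: card_Diff_singleton_if)
  qed
  then obtain k where "k \<in> I" "odd (card (S - {k}) + card (T - {k}))" by blast
  then show ?thesis by (intro bexI[of _ k]) (simp_all add: cs[OF S] cs[OF T] flip: power_add)
qed

definition mon :: "nat set \<Rightarrow> complex mat" where "mon S = mono (2*N) S"

lemma mon_M [simp]: "mon S \<in> M" unfolding mon_def by (rule mono_M) simp

lemma mon_unitary: "mon S * adj (mon S) = 1\<^sub>m n" unfolding mon_def by (rule mono_unitary) simp

text \<open>For different sets some \<open>c k\<close> anticommutes with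
  \<open>adj (mon S) * mon T\<close>; as \<open>c k\<close> squares to 1, cyclicity shows that the
  trace equals its negative.\<close>

lemma mon_orthogonal:
  assumes S: "S \<subseteq> I" and T: "T \<subseteq> I"
  shows "tr (adj (mon S) * mon T) = (if S = T then of_nat n else 0)"
proof (cases "S = T")
  case True
  have "tr (adj (mon S) * mon S) = tr (mon S * adj (mon S))" by (rule M_tr_comm) auto
  then show ?thesis using True mon_unitary by simp
next
  case False
  obtain k where k: "k \<in> I" and s: "csign k (2*N) S * csign k (2*N) T = -1" using sign_exists[OF S T False] by blast
  define s where "s = csign k (2*N) S" 
  define t where "t = csign k (2*N) T"
  have st: "s * t = -1" "s * s = 1" "cnj s = s" using s by (auto simp: s_def t_def csign_card simp flip: power_add)
  note ck = c_M[OF k]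
  have 1: "c k * mon S = s \<cdot>\<^sub>m (mon S * c k)" "c k * mon T = t \<cdot>\<^sub>m (mon T * c k)"
    unfolding s_def t_def mon_def by (rule c_mono[OF k], simp)+
  have "adj (c k * mon S) = adj (s \<cdot>\<^sub>m (mon S * c k))" using 1 by simp
  then have "adj (mon S) * c k = s \<cdot>\<^sub>m (c k * adj (mon S))" using ck c_adj[OF k] st by (simp add: M_adj adj_smult)
  then have "s \<cdot>\<^sub>m (adj (mon S) * c k) = c k * adj (mon S)" using ck st by (simp add: smult_smult_mat one_smult_mat)
  then have 2: "c k * adj (mon S) = s \<cdot>\<^sub>m (adj (mon S) * c k)" by simp
  let ?X = "adj (mon S) * mon T"
  have "c k * ?X = (c k * adj (mon S)) * mon T" using ck by (simp add: M_assoc)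
  also have "\<dots> = s \<cdot>\<^sub>m (adj (mon S) * (c k * mon T))" unfolding 2 using ck by (simp add: M_assoc M_smult)
  also have "\<dots> = (-1) \<cdot>\<^sub>m (?X * c k)" unfolding 1 using ck st by (simp add: M_assoc M_smult smult_smult_mat)
  finally have 3: "c k * ?X = (-1) \<cdot>\<^sub>m (?X * c k)" .
  have "tr ?X = tr ((c k * c k) * ?X)" by (simp add: c_square[OF k])
  also have "\<dots> = tr (c k * (c k * ?X))" using ck by (simp add: M_assoc)
  also have "\<dots> = - tr (c k * (?X * c k))" unfolding 3 using ck by (simp add: M_smult M_tr)
  also have "tr (c k * (?X * c k)) = tr ((?X * c k) * c k)" using ck by (intro M_tr_comm) auto
  also have "(?X * c k) * c k = ?X * (c k * c k)" using ck by (simp add: M_assoc)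
  finally show ?thesis using False by (simp add: c_square[OF k])
qed

text \<open>The trace-orthogonality of the \<open>4\<^sup>N\<close> monomials says that a square matrix is unitary up to a
  scalar; reading off its orthogonal rows instead of its columns gives completeness.\<close>

lemma mon_complete:
  assumes "i < n" "j < n" "k < n" "l < n"
  shows "(\<Sum>S\<in>Pow I. mon S $$ (i,j) * cnj (mon S $$ (k,l))) = (if i = k \<and> j = l then of_nat n else 0)"
proof -
  define K where "K = n * n"
  have cK: "card (Pow I) = K" by (simp add: K_def n_eq card_Pow power_add mult_2)
  obtain h where h: "bij_betw h {0..<K} (Pow I)" using ex_bij_betw_nat_finite[of "Pow I"] cK by auto
  obtain g where g: "bij_betw g {0..<K} ({..<n} \<times> {..<n})" 
    using ex_bij_betw_nat_finite[of "{..<n} \<times> {..<n}"] by (auto simp: K_def)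
  \<comment> \<open>Rows are matrix positions, columns are monomials. \<open>V\<close> is square
    because \<open>2^(2*N) = n * n\<close>, which is what turns the left inverse below into a right
    inverse.\<close>
  define V where "V = mat K K (\<lambda>(p,s). mon (h s) $$ g p)"
  have V: "V \<in> carrier_mat K K" by (simp add: V_def)
  have hP: "h s \<subseteq> I" if "s < K" for s 
    using bij_betw_apply[OF h, of s] that by simp
  have "adj V * V = of_nat n \<cdot>\<^sub>m 1\<^sub>m K"
  proof (rule eq_matI)
    fix s t assume "s < dim_row (of_nat n \<cdot>\<^sub>m 1\<^sub>m K :: complex mat)" "t < dim_col (of_nat n \<cdot>\<^sub>m 1\<^sub>m K :: complex mat)"
    then have st: "s < K" "t < K" by auto
    have "(adj V * V) $$ (s,t) = (\<Sum>p<K. cnj (mon (h s) $$ g p) * mon (h t) $$ g p)"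
      using st V by (subst index_mult_sum[of _ K K _ K]) (auto simp: V_def)
    also have "\<dots> = (\<Sum>p\<in>{..<n} \<times> {..<n}. cnj (mon (h s) $$ p) * mon (h t) $$ p)"
      using sum.reindex_bij_betw[OF g, of "\<lambda>p. cnj (mon (h s) $$ p) * mon (h t) $$ p"] by (simp add: atLeast0LessThan)
    also have "\<dots> = (\<Sum>a<n. \<Sum>b<n. cnj (mon (h s) $$ (a,b)) * mon (h t) $$ (a,b))"
      by (simp add: sum.cartesian_product case_prod_unfold)
    also have "\<dots> = (\<Sum>b<n. \<Sum>a<n. cnj (mon (h s) $$ (a,b)) * mon (h t) $$ (a,b))" by (rule sum.swap)
    also have "\<dots> = tr (adj (mon (h s)) * mon (h t))"
      by (subst tr_mult_sum) (auto simp: carrier_matD[OF mon_M])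
    also have "\<dots> = (if s = t then of_nat n else 0)"
      using mon_orthogonal[OF hP[OF st(1)] hP[OF st(2)]] inj_on_eq_iff[OF bij_betw_imp_inj_on[OF h]] st by simp
    finally show "(adj V * V) $$ (s,t) = (of_nat n \<cdot>\<^sub>m 1\<^sub>m K) $$ (s,t)" using st by simp
  qed (use V in auto)
  then have inv: "((1 / of_nat n) \<cdot>\<^sub>m adj V) * V = 1\<^sub>m K"
    using V by (subst mult_smult_assoc_mat[of _ K K _ K]) (use n_pos in \<open>simp_all add: smult_smult_mat one_smult_mat\<close>)
  have VV: "V * ((1 / of_nat n) \<cdot>\<^sub>m adj V) = 1\<^sub>m K"
    by (rule mat_mult_left_right_inverse[OF _ V inv]) (use V in simp)
  have "(i,j) \<in> g ` {0..<K}" "(k,l) \<in> g ` {0..<K}" using assms unfolding bij_betw_imp_surj_on[OF g] by simp_all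
  then obtain p q where p: "p < K" "g p = (i,j)" and q: "q < K" "g q = (k,l)" by fastforce
  have "(if p = q then 1 else 0) = (V * ((1 / of_nat n) \<cdot>\<^sub>m adj V)) $$ (p,q)" unfolding VV using p q by simp
  also have "\<dots> = (\<Sum>s<K. mon (h s) $$ (i,j) * (1 / of_nat n * cnj (mon (h s) $$ (k,l))))"
    using p q V by (subst index_mult_sum[of _ K K _ K]) (auto simp: V_def)
  also have "\<dots> = (\<Sum>s<K. mon (h s) $$ (i,j) * cnj (mon (h s) $$ (k,l))) / of_nat n"
    by (simp add: sum_divide_distrib)
  also have "(\<Sum>s<K. mon (h s) $$ (i,j) * cnj (mon (h s) $$ (k,l))) = (\<Sum>S\<in>Pow I. mon S $$ (i,j) * cnj (mon S $$ (k,l)))"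
    using sum.reindex_bij_betw[OF h, of "\<lambda>S. mon S $$ (i,j) * cnj (mon S $$ (k,l))"] by (simp add: atLeast0LessThan)
  finally have "(\<Sum>S\<in>Pow I. mon S $$ (i,j) * cnj (mon S $$ (k,l))) = (if p = q then of_nat n else 0)"
    using n_pos by (simp add: field_simps split: if_splits)
  moreover have "p = q \<longleftrightarrow> i = k \<and> j = l"
    using inj_on_eq_iff[OF bij_betw_imp_inj_on[OF g], of p q] p q by simp
  ultimately show ?thesis by simp
qed

text \<open>Schur's lemma by averaging: conjugation by each monomial fixes \<open>X\<close>, while
  by \<open>mon_complete\<close> the sum of all these conjugates is \<open>n * tr X\<close> times
  the identity.\<close>

lemma commutant_scalar:
  assumes X: "X \<in> M" and comm: "\<And>k. k \<in> I \<Longrightarrow> X * c k = c k * X"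
  shows "X = (tr X / of_nat n) \<cdot>\<^sub>m 1\<^sub>m n"
proof (rule M_eqI)
  have commm: "X * mono m S = mono m S * X" if "m \<le> 2*N" for m S
    using that
  proof (induction m)
    case (Suc m)
    then have k: "Suc m \<in> I" and P: "mono m S \<in> M" using mono_M by (auto simp: I_def)
    note carr = X P c_M[OF k]
    have "X * (mono m S * c (Suc m)) = (X * mono m S) * c (Suc m)" using carr by (simp add: M_assoc)
    also have "\<dots> = mono m S * (c (Suc m) * X)" using carr Suc comm[OF k] by (simp add: M_assoc)
    finally show ?case using Suc carr by (simp add: M_assoc)
  qed (use X in simp)
  have conj: "mon S * (X * adj (mon S)) = X" for S
  proof -
    have "mon S * (X * adj (mon S)) = (mon S * X) * adj (mon S)" using X by (simp add: M_assoc)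
    also have "mon S * X = X * mon S" unfolding mon_def by (rule commm[symmetric]) simp
    also have "(X * mon S) * adj (mon S) = X * (mon S * adj (mon S))" using X by (simp add: M_assoc)
    finally show ?thesis using X mon_unitary by simp
  qed
  fix i k assume ik: "i < n" "k < n"
  have ent: "X $$ (i,k) = (\<Sum>j<n. \<Sum>l<n. X $$ (j,l) * (mon S $$ (i,j) * cnj (mon S $$ (k,l))))" for S
  proof -
    have "X $$ (i,k) = (mon S * (X * adj (mon S))) $$ (i,k)" by (simp add: conj)
    also have "\<dots> = (\<Sum>j<n. \<Sum>l<n. X $$ (j,l) * (mon S $$ (i,j) * cnj (mon S $$ (k,l))))"
      using X ik by (simp add: M_mult_index carrier_matD[OF mon_M] sum_distrib_left mult_ac)
    finally show ?thesis .
  qed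
  have "of_nat (n * n) * X $$ (i,k) = (\<Sum>S\<in>Pow I. X $$ (i,k))"
    by (simp add: n_eq card_Pow power_add mult_2)
  also have "\<dots> = (\<Sum>S\<in>Pow I. \<Sum>j<n. \<Sum>l<n. X $$ (j,l) * (mon S $$ (i,j) * cnj (mon S $$ (k,l))))"
    by (rule sum.cong[OF refl]) (rule ent)
  also have "\<dots> = (\<Sum>j<n. \<Sum>S\<in>Pow I. \<Sum>l<n. X $$ (j,l) * (mon S $$ (i,j) * cnj (mon S $$ (k,l))))" by (rule sum.swap)
  also have "\<dots> = (\<Sum>j<n. \<Sum>l<n. \<Sum>S\<in>Pow I. X $$ (j,l) * (mon S $$ (i,j) * cnj (mon S $$ (k,l))))" 
    by (rule sum.cong[OF refl]) (rule sum.swap)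
  also have "\<dots> = (\<Sum>j<n. \<Sum>l<n. X $$ (j,l) * (if i = k \<and> j = l then of_nat n else 0))"
    using mon_complete ik by (simp flip: sum_distrib_left)
  also have "\<dots> = (\<Sum>j<n. X $$ (j,j) * (if i = k then of_nat n else 0))"
  proof (rule sum.cong[OF refl])
    fix j assume "j \<in> {..<n}"
    then have "(\<Sum>l<n. X $$ (j,l) * (if i = k \<and> j = l then of_nat n else 0)) = (\<Sum>l<n. if j = l then X $$ (j,l) * (if i = k then of_nat n else 0) else 0)"
      by (intro sum.cong) auto
    then show "(\<Sum>l<n. X $$ (j,l) * (if i = k \<and> j = l then of_nat n else 0)) = X $$ (j,j) * (if i = k then of_nat n else 0)"
      using \<open>j \<in> {..<n}\<close> by simp
  qed
  also have "\<dots> = tr X * (if i = k then of_nat n else 0)"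
    using X by (simp add: tr_def sum_distrib_right)
  finally show "X $$ (i,k) = ((tr X / of_nat n) \<cdot>\<^sub>m 1\<^sub>m n) $$ (i,k)"
    using ik by (auto simp: field_simps)
qed (use X in auto)

end

section \<open>The span of the Majorana operators and the operators quadratic in them\<close>

context clifford
begin

definition maj_span :: "complex mat set" where "maj_span = mspan (c ` I)"

lemma maj_span_sub: "mat_subspace maj_span"
  unfolding maj_span_def by (rule mat_subspace_mspan) (use c_M in auto)

lemmas maj_span_M = mat_subspaceD(1)[OF maj_span_sub]

lemma c_in_maj_span: "k \<in> I \<Longrightarrow> c k \<in> maj_span"
  unfolding maj_span_def by (rule mspan_base) simp

lemma maj_span_least: "mat_subspace V \<Longrightarrow> (\<And>k. k \<in> I \<Longrightarrow> c k \<in> V) \<Longrightarrow> y \<in> maj_span \<Longrightarrow> y \<in> V"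
  using mspan_least[of V "c ` I"] by (auto simp: maj_span_def)

lemma maj_span_adj: 
  assumes "y \<in> maj_span" shows "adj y \<in> maj_span"
proof -
  have "mat_subspace {y \<in> M. adj y \<in> maj_span}"
    using mat_subspaceD[OF maj_span_sub] by (auto simp: mat_subspace_def M_adj adj_smult)
  then have "y \<in> {y \<in> M. adj y \<in> maj_span}" 
    by (rule maj_span_least) (use assms in \<open>auto simp: c_M c_adj c_in_maj_span\<close>)
  then show ?thesis by simp
qed

text \<open>The \<open>c k\<close> are trace-orthogonal with \<open>tr (c k * c k) = n\<close>, so
  the expansion holds for each of them, and it is linear in \<open>y\<close>.\<close>

lemma maj_span_expand:
  assumes "y \<in> maj_span"
  shows "y = mat_sum n (\<lambda>k. (tr (y * c k) / of_nat n) \<cdot>\<^sub>m c k) I"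
proof -
  define co where "co y k = tr (y * c k) / of_nat n" for y k
  have add: "co (x + y) k = co x k + co y k" if "x \<in> M" "y \<in> M" "k \<in> I" for x y k
    using that c_M[OF that(3)] by (simp add: co_def M_distrib M_tr add_divide_distrib)
  have smult: "co (a \<cdot>\<^sub>m x) k = a * co x k" if "x \<in> M" "k \<in> I" for x a k
    using that c_M[OF that(2)] by (simp add: co_def M_smult M_tr)
  have zero: "co (0\<^sub>m n n) k = 0" if "k \<in> I" for k
    using left_mult_zero_mat[OF c_M[OF that]] by (simp add: co_def)
  have cc: "co (c k) l = (if k = l then 1 else 0)" if "k \<in> I" "l \<in> I" for k l
    using that n_pos by (simp add: co_def tr_cc)
  let ?V = "{y \<in> M. \<forall>i<n. \<forall>j<n. y $$ (i,j) = (\<Sum>k\<in>I. co y k * c k $$ (i,j))}"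
  have "mat_subspace ?V" unfolding mat_subspace_def
    by (auto simp: add smult zero distrib_right sum.distrib sum_distrib_left mult.assoc)
  then have "y \<in> ?V"
  proof (rule maj_span_least)
    fix k assume k: "k \<in> I"
    have "(\<Sum>l\<in>I. co (c k) l * c l $$ (i,j)) = c k $$ (i,j)" for i j
    proof -
      have "(\<Sum>l\<in>I. co (c k) l * c l $$ (i,j)) = (\<Sum>l\<in>I. if k = l then c l $$ (i,j) else 0)"
        by (rule sum.cong) (auto simp: cc k)
      then show ?thesis using k by simp
    qed
    then show "c k \<in> ?V" using c_M[OF k] by simp
  qed (use assms in simp)
  then have "y \<in> M" "\<And>i j. i < n \<Longrightarrow> j < n \<Longrightarrow> y $$ (i,j) = (\<Sum>k\<in>I. co y k * c k $$ (i,j))" by auto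
  then show ?thesis by (intro M_eqI) (auto simp: co_def c_M intro!: sum.cong)
qed

text \<open>Defined by commutators and not as a span, because this form is easily carried through
  conjugation; \<open>quadratics_decompose\<close> recovers the span description.\<close>

definition quadratics :: "complex mat set" where
  "quadratics = {X \<in> M. \<forall>k\<in>I. X * c k - c k * X \<in> maj_span}"

lemma quadratics_M: "X \<in> quadratics \<Longrightarrow> X \<in> M" by (simp add: quadratics_def)

lemma quadratics_commutator:
  assumes X: "X \<in> quadratics" and y: "y \<in> maj_span" shows "X * y - y * X \<in> maj_span"
proof -
  have XM: "X \<in> M" using X quadratics_M by simp
  have *: "X * (y + z) - (y + z) * X = (X * y - y * X) + (X * z - z * X)" if "y \<in> M" "z \<in> M" for y z
    using that XM by (intro M_eqI) (auto simp: M_distrib)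
  have **: "X * (a \<cdot>\<^sub>m y) - (a \<cdot>\<^sub>m y) * X = a \<cdot>\<^sub>m (X * y - y * X)" if "y \<in> M" for a y
    using that XM by (intro M_eqI) (auto simp: M_smult right_diff_distrib)
  have ***: "X * 0\<^sub>m n n - 0\<^sub>m n n * X = 0\<^sub>m n n" using XM by (intro M_eqI) auto
  have "mat_subspace {y \<in> M. X * y - y * X \<in> maj_span}"
    unfolding mat_subspace_def using mat_subspaceD[OF maj_span_sub] by (auto simp: * ** ***)
  then have "y \<in> {y \<in> M. X * y - y * X \<in> maj_span}"
    by (rule maj_span_least) (use X y c_M in \<open>auto simp: quadratics_def\<close>)
  then show ?thesis by simp
qed

lemma quadratics_sub: "mat_subspace quadratics"
proof -
  have *: "(X + Y) * c k - c k * (X + Y) = (X * c k - c k * X) + (Y * c k - c k * Y)" if "X \<in> M" "Y \<in> M" "k \<in> I" for X Y k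
    using that c_M[OF that(3)] by (intro M_eqI) (auto simp: M_distrib)
  have **: "(a \<cdot>\<^sub>m X) * c k - c k * (a \<cdot>\<^sub>m X) = a \<cdot>\<^sub>m (X * c k - c k * X)" if "X \<in> M" "k \<in> I" for a X k
    using that c_M[OF that(2)] by (intro M_eqI) (auto simp: M_smult right_diff_distrib)
  have ***: "0\<^sub>m n n * c k - c k * 0\<^sub>m n n = 0\<^sub>m n n" if "k \<in> I" for k using c_M[OF that] by (intro M_eqI) auto
  show ?thesis unfolding mat_subspace_def quadratics_def using mat_subspaceD[OF maj_span_sub] by (auto simp: * ** *** simp del: One_nat_def)
qed

lemma one_quadratics: "1\<^sub>m n \<in> quadratics"
proof -
  have "1\<^sub>m n * c k - c k * 1\<^sub>m n = 0\<^sub>m n n" if "k \<in> I" for k using c_M[OF that] by (intro M_eqI) auto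
  then show ?thesis using mat_subspaceD(2)[OF maj_span_sub] by (auto simp: quadratics_def)
qed

text \<open>Moving \<open>c m\<close> past both factors produces two signs that cancel, so only the
  two contraction terms remain.\<close>

lemma cc_commutator:
  assumes k: "k \<in> I" and l: "l \<in> I" and m: "m \<in> I"
  shows "(c k * c l) * c m - c m * (c k * c l) = (if l = m then 2 else 0) \<cdot>\<^sub>m c k - (if k = m then 2 else 0) \<cdot>\<^sub>m c l"
proof -
  note M = c_M[OF k] c_M[OF l] c_M[OF m]
  have 1: "c k * (c l * c m) = (if l = m then 2 else 0) \<cdot>\<^sub>m c k - c k * (c m * c l)"
    unfolding c_swap[OF l m] using M by (simp add: M_distrib M_smult)
  have "c k * (c m * c l) = (c k * c m) * c l" using M by (simp add: M_assoc)
  also have "\<dots> = (if k = m then 2 else 0) \<cdot>\<^sub>m c l - c m * (c k * c l)"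
    unfolding c_swap[OF k m] using M by (simp add: M_distrib M_smult M_assoc)
  finally have 2: "c k * (c m * c l) = (if k = m then 2 else 0) \<cdot>\<^sub>m c l - c m * (c k * c l)" .
  show ?thesis using M 1 2 by (intro M_eqI) (auto simp: M_assoc)
qed

lemma cc_quadratics:
  assumes k: "k \<in> I" and l: "l \<in> I"
  shows "c k * c l \<in> quadratics"
proof -
  have "(c k * c l) * c m - c m * (c k * c l) \<in> maj_span" if "m \<in> I" for m
    unfolding cc_commutator[OF k l that] using mat_subspace_minus[OF maj_span_sub] mat_subspaceD(4)[OF maj_span_sub] c_in_maj_span k l by blast
  then show ?thesis using c_M[OF k] c_M[OF l] by (simp add: quadratics_def)
qed

lemma quadratics_adj: 
  assumes X: "X \<in> quadratics" shows "adj X \<in> quadratics"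
proof -
  have "adj X * c k - c k * adj X \<in> maj_span" if k: "k \<in> I" for k
  proof -
    have "adj X * c k - c k * adj X = (-1) \<cdot>\<^sub>m adj (X * c k - c k * X)"
      using quadratics_M[OF X] c_M[OF k] c_adj[OF k] by (intro M_eqI) (auto simp: M_adj)
    moreover have "X * c k - c k * X \<in> maj_span" using X k by (simp add: quadratics_def)
    ultimately show ?thesis using maj_span_adj mat_subspaceD(4)[OF maj_span_sub] by simp
  qed
  then show ?thesis using quadratics_M[OF X] by (simp add: quadratics_def)
qed

definition quad :: "(nat \<Rightarrow> nat \<Rightarrow> complex) \<Rightarrow> complex mat" where
  "quad z = mat_sum n (\<lambda>k. mat_sum n (\<lambda>l. z k l \<cdot>\<^sub>m (c k * c l)) I) I"

lemma quad_M [simp]: "quad z \<in> M" by (simp add: quad_def)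

lemma quad_index: "i < n \<Longrightarrow> j < n \<Longrightarrow> quad z $$ (i,j) = (\<Sum>k\<in>I. \<Sum>l\<in>I. z k l * (c k * c l) $$ (i,j))"
  unfolding quad_def using c_M by (auto intro!: sum.cong)

lemma quad_in:
  assumes "mat_subspace V" "\<And>k l. k \<in> I \<Longrightarrow> l \<in> I \<Longrightarrow> c k * c l \<in> V"
  shows "quad z \<in> V"
  unfolding quad_def by (intro mat_subspace_mat_sum[OF assms(1)] mat_subspaceD(4)[OF assms(1)] assms(2)) auto

lemma quad_quadratics: "quad z \<in> quadratics"
  by (rule quad_in[OF quadratics_sub cc_quadratics])

text \<open>Only the antisymmetric part of \<open>z\<close> survives, since the symmetric part
  contributes a scalar to \<open>quad z\<close>.\<close>

lemma quad_commutator: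
  assumes m: "m \<in> I"
  shows "quad z * c m - c m * quad z = mat_sum n (\<lambda>k. (2 * (z k m - z m k)) \<cdot>\<^sub>m c k) I"
proof (rule M_eqI)
  fix i j assume ij: "i < n" "j < n"
  have q1: "quad z * c m = mat_sum n (\<lambda>k. mat_sum n (\<lambda>l. z k l \<cdot>\<^sub>m ((c k * c l) * c m)) I) I"
    unfolding quad_def using c_M m
    by (subst mat_sum_mult_right) (auto intro!: mat_sum_cong simp: mat_sum_mult_right M_smult simp del: assoc_mult_mat)
  have q2: "c m * quad z = mat_sum n (\<lambda>k. mat_sum n (\<lambda>l. z k l \<cdot>\<^sub>m (c m * (c k * c l))) I) I"
    unfolding quad_def using c_M m
    by (subst mat_sum_mult_left) (auto intro!: mat_sum_cong simp: mat_sum_mult_left M_smult)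
  have e: "((c k * c l) * c m) $$ (i,j) - (c m * (c k * c l)) $$ (i,j) = 
      (if l = m then 2 else 0) * c k $$ (i,j) - (if k = m then 2 else 0) * c l $$ (i,j)" if "k \<in> I" "l \<in> I" for k l
  proof -
    have "((c k * c l) * c m) $$ (i,j) - (c m * (c k * c l)) $$ (i,j) = ((c k * c l) * c m - c m * (c k * c l)) $$ (i,j)"
      using ij c_M that m by simp
    also have "\<dots> = (if l = m then 2 else 0) * c k $$ (i,j) - (if k = m then 2 else 0) * c l $$ (i,j)"
      unfolding cc_commutator[OF that m] using ij c_M[OF that(1)] c_M[OF that(2)] by simp
    finally show ?thesis .
  qed
  have "(quad z * c m - c m * quad z) $$ (i,j) = 
     (\<Sum>k\<in>I. \<Sum>l\<in>I. z k l * ((c k * c l) * c m) $$ (i,j)) - (\<Sum>k\<in>I. \<Sum>l\<in>I. z k l * (c m * (c k * c l)) $$ (i,j))"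
    unfolding q1 q2 using ij c_M m by (simp del: assoc_mult_mat)
  also have "\<dots> = (\<Sum>k\<in>I. \<Sum>l\<in>I. z k l * (((c k * c l) * c m) $$ (i,j) - (c m * (c k * c l)) $$ (i,j)))"
    by (simp add: sum_subtractf right_diff_distrib del: assoc_mult_mat)
  also have "\<dots> = (\<Sum>k\<in>I. \<Sum>l\<in>I. (if l = m then 2 * z k l * c k $$ (i,j) else 0) - (if k = m then 2 * z k l * c l $$ (i,j) else 0))"
    by (intro sum.cong refl, subst e) auto
  also have "\<dots> = (\<Sum>k\<in>I. \<Sum>l\<in>I. if l = m then 2 * z k l * c k $$ (i,j) else 0) - (\<Sum>k\<in>I. \<Sum>l\<in>I. if k = m then 2 * z k l * c l $$ (i,j) else 0)"
    by (simp add: sum_subtractf)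
  also have "(\<Sum>k\<in>I. \<Sum>l\<in>I. if k = m then 2 * z k l * c l $$ (i,j) else 0) = (\<Sum>l\<in>I. \<Sum>k\<in>I. if k = m then 2 * z k l * c l $$ (i,j) else 0)"
    by (rule sum.swap)
  finally show "(quad z * c m - c m * quad z) $$ (i,j) = mat_sum n (\<lambda>k. (2 * (z k m - z m k)) \<cdot>\<^sub>m c k) I $$ (i,j)"
    using ij m c_M by (simp add: sum_subtractf[symmetric] algebra_simps)
qed (use c_M m in auto)

text \<open>For antisymmetric \<open>z\<close> the commutator of \<open>quad z\<close> with
  \<open>c l\<close> has coefficient \<open>4 * z k l\<close> at \<open>c k\<close>, and
  \<open>tr (c k * c k) = n\<close>. This gives the normalisation.\<close>

definition qcoeff :: "complex mat \<Rightarrow> nat \<Rightarrow> nat \<Rightarrow> complex" where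
  "qcoeff X k l = tr ((X * c l - c l * X) * c k) / (4 * of_nat n)"

text \<open>By cyclicity the numerator is the trace of \<open>X\<close> against
  \<open>c l * c k - c k * c l\<close>.\<close>

lemma qcoeff_antisym:
  assumes "X \<in> M" and k: "k \<in> I" and l: "l \<in> I"
  shows "qcoeff X k l = - qcoeff X l k"
proof -
  note M = assms(1) c_M[OF k] c_M[OF l]
  have "tr (c l * (X * c k)) = tr (X * (c k * c l))" "tr (c k * (X * c l)) = tr (X * (c l * c k))"
    using M by (auto intro: M_tr_cycle)
  then show ?thesis using M by (simp add: qcoeff_def M_distrib M_assoc M_tr minus_divide_left)
qed

lemma tr_quad:
  assumes "\<And>k. k \<in> I \<Longrightarrow> z k k = 0"
  shows "tr (quad z) = 0"
  unfolding quad_def using assms c_M by (simp add: tr_mat_sum M_tr tr_cc)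

text \<open>\<open>X\<close> and \<open>quad (qcoeff X)\<close> have the same commutator with each
  \<open>c m\<close>, so their difference lies in the commutant and is a scalar. The scalar is read
  off from the trace: the diagonal of \<open>qcoeff X\<close> vanishes, so the quadratic part is
  traceless.\<close>

lemma quadratics_decompose:
  assumes X: "X \<in> quadratics"
  shows "X = quad (qcoeff X) + (tr X / of_nat n) \<cdot>\<^sub>m 1\<^sub>m n"
proof -
  let ?Z = "quad (qcoeff X)"
  have XM: "X \<in> M" using quadratics_M[OF X] .
  have "(X - ?Z) * c m = c m * (X - ?Z)" if m: "m \<in> I" for m
  proof -
    note cm = c_M[OF m]
    have "?Z * c m - c m * ?Z = mat_sum n (\<lambda>k. (tr ((X * c m - c m * X) * c k) / of_nat n) \<cdot>\<^sub>m c k) I"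
      unfolding quad_commutator[OF m]
    proof (rule mat_sum_cong)
      fix k assume k: "k \<in> I"
      have "2 * (qcoeff X k m - qcoeff X m k) = 4 * qcoeff X k m" 
        using qcoeff_antisym[OF XM m k] by simp
      also have "\<dots> = tr ((X * c m - c m * X) * c k) / of_nat n" by (simp add: qcoeff_def)
      finally show "(2 * (qcoeff X k m - qcoeff X m k)) \<cdot>\<^sub>m c k = (tr ((X * c m - c m * X) * c k) / of_nat n) \<cdot>\<^sub>m c k" by simp
    qed
    also have "\<dots> = X * c m - c m * X" using X m by (intro maj_span_expand[symmetric]) (simp add: quadratics_def)
    finally have *: "?Z * c m - c m * ?Z = X * c m - c m * X" .
    show ?thesis
    proof (rule M_eqI)
      fix i j assume "i < n" "j < n"
      then show "((X - ?Z) * c m) $$ (i,j) = (c m * (X - ?Z)) $$ (i,j)"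
        using arg_cong[OF *, of "\<lambda>Z. Z $$ (i,j)"] XM cm by (simp add: M_distrib algebra_simps)
    qed (use XM cm in auto)
  qed
  then have *: "X - ?Z = (tr (X - ?Z) / of_nat n) \<cdot>\<^sub>m 1\<^sub>m n" using XM by (intro commutant_scalar) auto
  have "qcoeff X k k = 0" if "k \<in> I" for k using qcoeff_antisym[OF XM that that] by simp
  then have "tr (X - ?Z) = tr X" using XM tr_quad[of "qcoeff X"] by (simp add: M_tr)
  then have "X - ?Z = (tr X / of_nat n) \<cdot>\<^sub>m 1\<^sub>m n" using * by simp
  moreover have "X = ?Z + (X - ?Z)" using XM by (intro M_eqI) auto
  ultimately show ?thesis by simp
qed

text \<open>Induction principle for linear statements about \<open>quadratics\<close>.\<close>

lemma quadratics_in: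
  assumes "mat_subspace V" "1\<^sub>m n \<in> V" "\<And>k l. k \<in> I \<Longrightarrow> l \<in> I \<Longrightarrow> c k * c l \<in> V" "X \<in> quadratics"
  shows "X \<in> V"
  by (subst quadratics_decompose[OF assms(4)]) (intro mat_subspaceD[OF assms(1)] quad_in assms)

text \<open>For invertible \<open>P\<close> this says, without mentioning the inverse, that
  conjugation by \<open>P\<close> maps the span of the \<open>c k\<close> into itself. Closure under
  products is then immediate.\<close>

definition preserves :: "complex mat \<Rightarrow> bool" where
  "preserves P \<longleftrightarrow> (\<forall>y\<in>maj_span. \<exists>z\<in>maj_span. P * y = z * P)"

lemma preserves_mult:
  assumes "P \<in> M" "R \<in> M" "preserves P" "preserves R"
  shows "preserves (P * R)"
  unfolding preserves_def
proof
  fix y assume y: "y \<in> maj_span"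
  then obtain z where z: "z \<in> maj_span" "R * y = z * R" using assms by (auto simp: preserves_def)
  then obtain x where x: "x \<in> maj_span" "P * z = x * P" using assms by (auto simp: preserves_def)
  have M: "y \<in> M" "z \<in> M" "x \<in> M" using y z x maj_span_M by auto
  have "P * R * y = P * (z * R)" using M assms z by (simp add: M_assoc)
  also have "\<dots> = (P * z) * R" using M assms by (simp add: M_assoc)
  also have "\<dots> = x * (P * R)" unfolding x(2) using M assms by (simp add: M_assoc)
  finally show "\<exists>x\<in>maj_span. P * R * y = x * (P * R)" using x(1) by blast
qed

lemma preserves_smult:
  assumes "P \<in> M" "preserves P"
  shows "preserves (a \<cdot>\<^sub>m P)"
  unfolding preserves_def
proof
  fix y assume y: "y \<in> maj_span"
  then obtain z where z: "z \<in> maj_span" "P * y = z * P" using assms by (auto simp: preserves_def)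
  then have "a \<cdot>\<^sub>m P * y = z * (a \<cdot>\<^sub>m P)" using y maj_span_M assms by (simp add: M_smult)
  then show "\<exists>z\<in>maj_span. a \<cdot>\<^sub>m P * y = z * (a \<cdot>\<^sub>m P)" using z(1) by blast
qed

text \<open>Conjugation by \<open>spec U f\<close> is the multiplier by the eigenvalue ratios
  \<open>f i / f j\<close>. This lemma and the next translate between the two descriptions.\<close>

lemma preserves_specI:
  assumes U: "unitary n U" and f: "\<forall>i<n. f i \<noteq> 0"
    and inv: "\<And>y. y \<in> maj_span \<Longrightarrow> hmul n U (\<lambda>i j. f i / f j) y \<in> maj_span"
  shows "preserves (spec U f)"
  unfolding preserves_def
proof
  fix y assume y: "y \<in> maj_span"
  have "hmul n U (\<lambda>i j. f i / f j) y * spec U f = hmul n U (\<lambda>i j. f j * (f i / f j)) y"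
    using U maj_span_M[OF y] by (simp add: spec_mult_right hmul_hmul)
  also have "\<dots> = hmul n U (\<lambda>i j. f i) y" by (rule hmul_cong) (simp add: f)
  also have "\<dots> = spec U f * y" using U maj_span_M[OF y] by (simp add: spec_mult_left)
  finally show "\<exists>z\<in>maj_span. spec U f * y = z * spec U f" using inv[OF y] by metis
qed

lemma preserves_specD:
  assumes U: "unitary n U" and f: "\<forall>i<n. f i \<noteq> 0" and p: "preserves (spec U f)" and y: "y \<in> maj_span"
  shows "hmul n U (\<lambda>i j. f i / f j) y \<in> maj_span"
proof -
  obtain z where z: "z \<in> maj_span" "spec U f * y = z * spec U f" using p y by (auto simp: preserves_def)
  note M = maj_span_M[OF y] maj_span_M[OF z(1)]
  have "hmul n U (\<lambda>i j. f i / f j) y = (spec U f * y) * spec U (\<lambda>i. 1 / f i)"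
    using U M by (simp add: M_assoc spec_sandwich)
  also have "\<dots> = z * (spec U f * spec U (\<lambda>i. 1 / f i))" unfolding z(2) using U M by (simp add: M_assoc)
  also have "spec U f * spec U (\<lambda>i. 1 / f i) = spec U (\<lambda>i. 1)"
    unfolding spec_mult[OF U] by (rule spec_cong) (simp add: f)
  finally show ?thesis using U M z(1) by (simp add: spec_one)
qed

lemma preserves_spec_fun:
  assumes U: "unitary n U" and f: "\<forall>i<n. f i \<noteq> 0" and p: "preserves (spec U f)" and y: "y \<in> maj_span"
    and F: "\<And>i j. i < n \<Longrightarrow> j < n \<Longrightarrow> F i j = g (f i / f j)"
  shows "hmul n U F y \<in> maj_span"
  by (rule hmul_fun_invariant[where T = "\<lambda>i j. f i / f j" and f = g, OF U maj_span_sub _ y])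
     (auto intro: preserves_specD[OF U f p] F)

text \<open>Conjugation by \<open>P = spec U f\<close> is an algebra automorphism. So the commutator
  of the conjugate of \<open>X\<close> with \<open>c k\<close> is the conjugate of the commutator of
  \<open>X\<close> with \<open>R * c k * P\<close>, where \<open>R\<close> inverts \<open>P\<close>.
  The latter operator is again in the span, being obtained from \<open>c k\<close> by the function
  \<open>1 / z\<close> of the ratio multiplier.\<close>

lemma preserves_quadratics_fun:
  assumes U: "unitary n U" and f: "\<forall>i<n. f i \<noteq> 0" and p: "preserves (spec U f)" and X: "X \<in> quadratics"
    and F: "\<And>i j. i < n \<Longrightarrow> j < n \<Longrightarrow> F i j = g (f i / f j)"
  shows "hmul n U F X \<in> quadratics"
proof (rule hmul_fun_invariant[where T = "\<lambda>i j. f i / f j" and f = g, OF U quadratics_sub _ X])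
  fix X assume X: "X \<in> quadratics"
  let ?P = "spec U f" and ?R = "spec U (\<lambda>i. 1 / f i)"
  have PR: "?P * ?R = 1\<^sub>m n" "?R * ?P = 1\<^sub>m n"
    unfolding spec_mult[OF U] spec_one[OF U, symmetric] by (rule spec_cong, simp add: f)+
  have XM: "X \<in> M" using X quadratics_M by simp
  have cancel: "?P * (?R * A) = A" "?R * (?P * A) = A" if "A \<in> M" for A
    using that U PR M_assoc[of ?P ?R A] M_assoc[of ?R ?P A] by simp_all
  have h: "hmul n U (\<lambda>i j. f i / f j) A = ?P * (A * ?R)" if "A \<in> M" for A
    using U that by (simp add: spec_sandwich)
  have "?P * (X * ?R) * c k - c k * (?P * (X * ?R)) \<in> maj_span" if k: "k \<in> I" for k
  proof -
    let ?y = "?R * (c k * ?P)"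
    have "?y = hmul n U (\<lambda>i j. (1 / f i) * f j) (c k)" using U c_M[OF k] by (simp add: spec_sandwich)
    also have "\<dots> \<in> maj_span" by (rule preserves_spec_fun[OF U f p c_in_maj_span[OF k], of _ "\<lambda>z. 1 / z"]) auto
    finally have y: "?y \<in> maj_span" .
    have "X * ?y - ?y * X \<in> maj_span" by (rule quadratics_commutator[OF X y])
    then have "?P * ((X * ?y - ?y * X) * ?R) \<in> maj_span"
      using preserves_specD[OF U f p] h maj_span_M by metis
    moreover have "?P * ((X * ?y - ?y * X) * ?R) = ?P * (X * ?R) * c k - c k * (?P * (X * ?R))"
      using U XM c_M[OF k] PR by (simp add: M_distrib M_assoc cancel)
    ultimately show ?thesis by simp
  qed
  then show "hmul n U (\<lambda>i j. f i / f j) X \<in> quadratics" unfolding h[OF XM] quadratics_def using U XM by simp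
qed (rule F)

text \<open>The commutator with \<open>spec U mu\<close> is the multiplier by
  \<open>mu i - mu j\<close>. Conjugation by the exponential is the function
  \<open>exp (s * z)\<close> of it and so preserves the same span.\<close>

lemma preserves_exp:
  assumes U: "unitary n U" and X: "spec U mu \<in> quadratics"
  shows "preserves (spec U (\<lambda>i. exp (s * mu i)))"
proof (rule preserves_specI[OF U])
  have *: "hmul n U (\<lambda>i j. mu i - mu j) y \<in> maj_span" if y: "y \<in> maj_span" for y
  proof -
    note yM = maj_span_M[OF y]
    have "hmul n U (\<lambda>i j. mu i + (-1) * mu j) y = hmul n U (\<lambda>i j. mu i) y + (-1) \<cdot>\<^sub>m hmul n U (\<lambda>i j. mu j) y"
      using yM by (simp only: hmul_fun_add[OF U] hmul_fun_smult[OF U])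
    also have "\<dots> = spec U mu * y - y * spec U mu"
      using U yM by (intro M_eqI) (auto simp: spec_mult_left spec_mult_right)
    finally show ?thesis using quadratics_commutator[OF X y] by simp
  qed
  fix y assume "y \<in> maj_span"
  then show "hmul n U (\<lambda>i j. exp (s * mu i) / exp (s * mu j)) y \<in> maj_span"
    by (intro hmul_fun_invariant[where T = "\<lambda>i j. mu i - mu j" and f = "\<lambda>z. exp (s * z)", OF U maj_span_sub *])
       (auto simp: exp_diff right_diff_distrib)
qed simp

text \<open>Since \<open>ln (lam i) - ln (lam j) = ln (lam i / lam j)\<close>, the commutator with
  the logarithm is a function of conjugation by the operator itself.\<close>

lemma quadratics_of_preserves:
  assumes U: "unitary n U" and lam: "\<And>i. i < n \<Longrightarrow> lam i > 0" and p: "preserves (spec U (\<lambda>i. complex_of_real (lam i)))"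
  shows "spec U (\<lambda>i. complex_of_real (ln (lam i))) \<in> quadratics"
proof -
  let ?X = "spec U (\<lambda>i. complex_of_real (ln (lam i)))"
  have "?X * c k - c k * ?X \<in> maj_span" if k: "k \<in> I" for k
  proof -
    note kM = c_M[OF k]
    have "hmul n U (\<lambda>i j. complex_of_real (ln (lam i)) + (-1) * complex_of_real (ln (lam j))) (c k)
       = hmul n U (\<lambda>i j. complex_of_real (ln (lam i))) (c k) + (-1) \<cdot>\<^sub>m hmul n U (\<lambda>i j. complex_of_real (ln (lam j))) (c k)"
      using kM by (simp only: hmul_fun_add[OF U] hmul_fun_smult[OF U])
    also have "\<dots> = ?X * c k - c k * ?X"
      using U kM by (intro M_eqI) (auto simp: spec_mult_left spec_mult_right)
    moreover have "hmul n U (\<lambda>i j. complex_of_real (ln (lam i)) + (-1) * complex_of_real (ln (lam j))) (c k) \<in> maj_span"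
      by (rule preserves_spec_fun[OF U _ p c_in_maj_span[OF k], of _ "\<lambda>z. complex_of_real (ln (Re z))"])
         (use lam in \<open>auto simp: ln_div less_imp_neq[symmetric] simp flip: of_real_divide\<close>)
    ultimately show ?thesis by simp
  qed
  then show ?thesis using U by (simp add: quadratics_def)
qed

end

section \<open>Gaussian states and their tangent spaces\<close>

lemma has_vector_derivative_unique_at:
  assumes "(f has_vector_derivative a) (at (x::real))" "(f has_vector_derivative b) (at x)"
  shows "a = b"
  using has_derivative_unique[OF assms[unfolded has_vector_derivative_def]] by (metis scaleR_one)

text \<open>Choosing a derivative inside \<open>A\<close> for each member defines an operator on
  \<open>A\<close>, whose iterates serve as all higher derivatives.\<close>

lemma smooth_on_closed_family:
  assumes closed: "\<And>f. f \<in> A \<Longrightarrow> \<exists>f'\<in>A. \<forall>s. (f has_vector_derivative f' s) (at s)" and f: "f \<in> A"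
  shows "smooth_on S f"
proof -
  obtain d where d: "\<And>f. f \<in> A \<Longrightarrow> d f \<in> A \<and> (\<forall>s. (f has_vector_derivative d f s) (at s))"
    using closed by metis
  have "(d ^^ k) f \<in> A" for k by (induction k) (use d f in auto)
  then have "((d ^^ k) f has_vector_derivative (d ^^ Suc k) f s) (at s within S)" for k s
    using d unfolding has_vector_derivative_def by (auto intro: has_derivative_subset[of _ _ _ UNIV])
  then show ?thesis unfolding smooth_on_def by (intro exI[of _ "\<lambda>k. (d ^^ k) f"]) auto
qed

text \<open>Large enough for the entries of the unnormalised curve in \<open>tangentI\<close>, and
  closed under derivatives, so that smoothness needs no formula for higher derivatives.\<close>

inductive_set exp_alg :: "(real \<Rightarrow> complex) set" where
  exp: "(\<lambda>s. exp (of_real s * \<nu>)) \<in> exp_alg"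
| const: "(\<lambda>s. a) \<in> exp_alg"
| add: "f \<in> exp_alg \<Longrightarrow> g \<in> exp_alg \<Longrightarrow> (\<lambda>s. f s + g s) \<in> exp_alg"
| mult: "f \<in> exp_alg \<Longrightarrow> g \<in> exp_alg \<Longrightarrow> (\<lambda>s. f s * g s) \<in> exp_alg"

lemma exp_has_vector_derivative:
  "((\<lambda>s. exp (of_real s * \<nu>)) has_vector_derivative \<nu> * exp (of_real s * \<nu>)) (at s)" for \<nu> :: complex
proof -
  have "((\<lambda>s. complex_of_real s * \<nu>) has_derivative (\<lambda>h. complex_of_real h * \<nu>)) (at s)"
    by (auto intro!: derivative_eq_intros)
  from has_derivative_compose[OF this DERIV_exp[THEN has_field_derivative_imp_has_derivative]]
  show ?thesis by (simp add: has_vector_derivative_def scaleR_conv_of_real mult_ac)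
qed

lemma exp_alg_deriv: "f \<in> exp_alg \<Longrightarrow> \<exists>f'\<in>exp_alg. \<forall>s. (f has_vector_derivative f' s) (at s)"
proof (induction rule: exp_alg.induct)
  case (exp \<nu>)
  show ?case by (intro bexI[of _ "\<lambda>s. \<nu> * exp (of_real s * \<nu>)"] allI exp_has_vector_derivative)
      (intro exp_alg.intros)
next
  case (const a)
  show ?case by (intro bexI[of _ "\<lambda>s. 0"]) (auto intro: exp_alg.intros)
next
  case (add f g)
  then obtain f' g' where "f' \<in> exp_alg" "g' \<in> exp_alg" "\<forall>s. (f has_vector_derivative f' s) (at s)" "\<forall>s. (g has_vector_derivative g' s) (at s)" by blast
  then show ?case
    by (intro bexI[of _ "\<lambda>s. f' s + g' s"]) (auto intro!: derivative_intros exp_alg.intros)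
next
  case (mult f g)
  then obtain f' g' where "f' \<in> exp_alg" "g' \<in> exp_alg" "\<forall>s. (f has_vector_derivative f' s) (at s)" "\<forall>s. (g has_vector_derivative g' s) (at s)" by blast
  with mult.hyps show ?case
    by (intro bexI[of _ "\<lambda>s. f s * g' s + f' s * g s"]) (auto intro!: has_vector_derivative_mult exp_alg.intros)
qed

lemma exp_alg_sum: "finite S \<Longrightarrow> (\<And>k. k \<in> S \<Longrightarrow> f k \<in> exp_alg) \<Longrightarrow> (\<lambda>s. \<Sum>k\<in>S. f k s) \<in> exp_alg"
  by (induction S rule: finite_induct) (auto intro: exp_alg.intros)

lemma has_vector_derivative_inverse:
  fixes t :: "real \<Rightarrow> complex"
  assumes "(t has_vector_derivative t') (at s)" "t s \<noteq> 0"
  shows "((\<lambda>s. inverse (t s)) has_vector_derivative - (inverse (t s) * t' * inverse (t s))) (at s)"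
  using has_derivative_inverse[OF assms(2) assms(1)[unfolded has_vector_derivative_def]]
  by (simp add: has_vector_derivative_def)

text \<open>Adjoins \<open>1 / t\<close> to \<open>exp_alg\<close>, where \<open>t\<close> will be
  the trace that normalises the curve.\<close>

inductive_set frac_alg :: "(real \<Rightarrow> complex) \<Rightarrow> (real \<Rightarrow> complex) set" for t where
  base: "f \<in> exp_alg \<Longrightarrow> f \<in> frac_alg t"
| inv: "(\<lambda>s. inverse (t s)) \<in> frac_alg t"
| add: "f \<in> frac_alg t \<Longrightarrow> g \<in> frac_alg t \<Longrightarrow> (\<lambda>s. f s + g s) \<in> frac_alg t"
| mult: "f \<in> frac_alg t \<Longrightarrow> g \<in> frac_alg t \<Longrightarrow> (\<lambda>s. f s * g s) \<in> frac_alg t"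

lemma frac_alg_deriv: 
  assumes t: "t \<in> exp_alg" "\<And>s. t s \<noteq> 0"
  shows "f \<in> frac_alg t \<Longrightarrow> \<exists>f'\<in>frac_alg t. \<forall>s. (f has_vector_derivative f' s) (at s)"
proof (induction rule: frac_alg.induct)
  case (base f)
  then show ?case using exp_alg_deriv[OF base] frac_alg.base by blast
next
  case inv
  obtain t' where t': "t' \<in> exp_alg" "\<forall>s. (t has_vector_derivative t' s) (at s)" using exp_alg_deriv[OF t(1)] by blast
  have "(\<lambda>s. (-1) * (inverse (t s) * t' s * inverse (t s))) \<in> frac_alg t"
    by (intro frac_alg.mult frac_alg.inv frac_alg.base t' exp_alg.const)
  then show ?case using t' t(2) 
    by (intro bexI[of _ "\<lambda>s. (-1) * (inverse (t s) * t' s * inverse (t s))"]) (auto dest!: has_vector_derivative_inverse)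
next
  case (add f g)
  then obtain f' g' where "f' \<in> frac_alg t" "g' \<in> frac_alg t" "\<forall>s. (f has_vector_derivative f' s) (at s)" "\<forall>s. (g has_vector_derivative g' s) (at s)" by blast
  then show ?case
    by (intro bexI[of _ "\<lambda>s. f' s + g' s"]) (auto intro!: derivative_intros frac_alg.add)
next
  case (mult f g)
  then obtain f' g' where "f' \<in> frac_alg t" "g' \<in> frac_alg t" "\<forall>s. (f has_vector_derivative f' s) (at s)" "\<forall>s. (g has_vector_derivative g' s) (at s)" by blast
  with mult.hyps show ?case
    by (intro bexI[of _ "\<lambda>s. f s * g' s + f' s * g s"]) (auto intro!: has_vector_derivative_mult frac_alg.add frac_alg.mult)
qed

lemma frac_alg_smooth: "t \<in> exp_alg \<Longrightarrow> (\<And>s. t s \<noteq> 0) \<Longrightarrow> f \<in> frac_alg t \<Longrightarrow> smooth_on S f"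
  by (rule smooth_on_closed_family[of "frac_alg t", OF frac_alg_deriv])

context square_mats
begin

definition mat_deriv :: "(real \<Rightarrow> complex mat) \<Rightarrow> complex mat \<Rightarrow> bool" where
  "mat_deriv \<gamma> A \<longleftrightarrow> A \<in> M \<and> (\<forall>s. \<gamma> s \<in> M) \<and> 
     (\<forall>i<n. \<forall>j<n. ((\<lambda>s. \<gamma> s $$ (i,j)) has_vector_derivative A $$ (i,j)) (at 0))"

lemma mat_deriv_left: 
  assumes "mat_deriv \<gamma> A" "Y \<in> M" shows "mat_deriv (\<lambda>s. Y * \<gamma> s) (Y * A)"
  using assms unfolding mat_deriv_def
  by (auto simp: M_mult_index intro!: has_vector_derivative_sum has_vector_derivative_mult_right)

lemma mat_deriv_right: 
  assumes "mat_deriv \<gamma> A" "Y \<in> M" shows "mat_deriv (\<lambda>s. \<gamma> s * Y) (A * Y)"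
  using assms unfolding mat_deriv_def
  by (auto simp: M_mult_index intro!: has_vector_derivative_sum has_vector_derivative_mult_left)

lemma mat_deriv_index: "mat_deriv \<gamma> A \<Longrightarrow> i < n \<Longrightarrow> j < n \<Longrightarrow> ((\<lambda>s. \<gamma> s $$ (i,j)) has_vector_derivative A $$ (i,j)) (at 0)"
  by (simp add: mat_deriv_def)

lemma mat_deriv_tr: 
  assumes "mat_deriv \<gamma> A" shows "((\<lambda>s. tr (\<gamma> s)) has_vector_derivative tr A) (at 0)"
proof -
  have "tr (\<gamma> s) = (\<Sum>i<n. \<gamma> s $$ (i,i))" "tr A = (\<Sum>i<n. A $$ (i,i))" for s
    using assms by (auto simp: mat_deriv_def tr_def carrier_matD(1)[of "\<gamma> s" n n])
  then show ?thesis using mat_deriv_index[OF assms] by (auto intro!: has_vector_derivative_sum)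
qed

lemma mat_deriv_hermitian:
  assumes "mat_deriv \<gamma> A" "\<And>s. hermitian n (\<gamma> s)" shows "hermitian n A"
proof -
  have A: "A \<in> M" using assms by (simp add: mat_deriv_def)
  have "adj A = A"
  proof (rule M_eqI)
    fix i j assume ij: "i < n" "j < n"
    have e: "\<gamma> s $$ (i,j) = cnj (\<gamma> s $$ (j,i))" for s
    proof -
      have "\<gamma> s \<in> M" "adj (\<gamma> s) = \<gamma> s" using assms(2) hermitian_M by auto
      then show ?thesis using ij adj_index[of i "\<gamma> s" j] by simp
    qed
    have "((\<lambda>s. cnj (\<gamma> s $$ (j,i))) has_vector_derivative cnj (A $$ (j,i))) (at 0)"
      by (rule bounded_linear.has_vector_derivative[OF bounded_linear_cnj mat_deriv_index[OF assms(1) ij(2,1)]])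
    then have "((\<lambda>s. \<gamma> s $$ (i,j)) has_vector_derivative cnj (A $$ (j,i))) (at 0)" 
      by (simp only: e[symmetric])
    then have "cnj (A $$ (j,i)) = A $$ (i,j)"
      using mat_deriv_index[OF assms(1) ij] has_vector_derivative_unique_at by blast
    then show "adj A $$ (i,j) = A $$ (i,j)" using ij A by simp
  qed (use A in auto)
  then show ?thesis using A by (simp add: hermitian_def)
qed

lemma posdef_scale_adj_mult:
  assumes Z: "Z \<in> M" and W: "W \<in> M" "W * Z = 1\<^sub>m n" and r: "r > 0"
  shows "posdef n (complex_of_real r \<cdot>\<^sub>m (adj Z * Z))"
proof -
  let ?q = "complex_of_real (sqrt r)"
  have q: "?q * ?q = complex_of_real r" using r by (simp flip: of_real_mult)
  have "posdef n (adj (?q \<cdot>\<^sub>m Z) * (?q \<cdot>\<^sub>m Z))"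
    by (rule posdef_adj_mult[of _ "inverse ?q \<cdot>\<^sub>m W"]) (use Z W r in \<open>auto simp: M_smult intro!: eq_matI\<close>)
  moreover have "adj (?q \<cdot>\<^sub>m Z) * (?q \<cdot>\<^sub>m Z) = complex_of_real r \<cdot>\<^sub>m (adj Z * Z)"
    using Z by (intro M_eqI) (auto simp: adj_smult M_smult q[symmetric])
  ultimately show ?thesis by simp
qed

lemma tr_adj_mult_pos:
  assumes Z: "Z \<in> M" and W: "W \<in> M" "W * Z = 1\<^sub>m n" and n: "n > 0"
  obtains t where "t > 0" "tr (adj Z * Z) = complex_of_real t"
proof -
  \<comment> \<open>With the identity as eigenbasis and all weights 1, the form of
    \<open>form_pos\<close> is the squared Hilbert-Schmidt norm.\<close>
  have U: "unitary n (1\<^sub>m n)" by (auto simp: unitary_def)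
  have h: "hmul n (1\<^sub>m n) (\<lambda>i j. complex_of_real 1) Z = Z"
    using hmul_one[OF U Z] by simp
  have "Z \<noteq> 0\<^sub>m n n"
  proof
    assume "Z = 0\<^sub>m n n"
    then have "(1\<^sub>m n :: complex mat) = 0\<^sub>m n n" using W right_mult_zero_mat[OF W(1), of n] by simp
    then have "(1\<^sub>m n :: complex mat) $$ (0,0) = 0\<^sub>m n n $$ (0,0)" by simp
    then show False using n by simp
  qed
  from form_pos[OF U Z _ this, of "\<lambda>i j. 1"] have "Re (tr (adj Z * Z)) > 0" unfolding h by simp
  moreover have "tr (adj Z * Z) = complex_of_real (Re (tr (adj Z * Z)))"
    using form_sum_squares[OF U Z, of "\<lambda>i j. 1"] unfolding h by (metis Re_complex_of_real)
  ultimately show ?thesis using that by blast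
qed

end

section \<open>Gaussian states as the faithful states that preserve the Majorana span\<close>

context clifford
begin

definition gauss :: "complex mat \<Rightarrow> bool" where
  "gauss \<rho> \<longleftrightarrow> faithful_state n \<rho> \<and> (\<exists>(K::nat \<Rightarrow> nat \<Rightarrow> real) (\<kappa>::real).
     (\<forall>k\<in>I. \<forall>l\<in>I. K k l = - K l k) \<and> \<kappa> > 0 \<and>
     \<rho> = complex_of_real \<kappa> \<cdot>\<^sub>m mexp n ((- \<i> / 2) \<cdot>\<^sub>m quad (\<lambda>k l. complex_of_real (K k l))))"

lemma quad_smult: "a \<cdot>\<^sub>m quad z = quad (\<lambda>k l. a * z k l)"
  by (rule M_eqI) (auto simp: quad_index sum_distrib_left mult.assoc)

lemma quad_adj: "adj (quad z) = quad (\<lambda>k l. cnj (z l k))"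
proof (rule M_eqI)
  fix i j assume ij: "i < n" "j < n"
  have "cnj ((c k * c l) $$ (j,i)) = (c l * c k) $$ (i,j)" if "k \<in> I" "l \<in> I" for k l
  proof -
    have "adj (c k * c l) = c l * c k" using c_M that c_adj by (simp add: M_adj)
    moreover have "adj (c k * c l) $$ (i,j) = cnj ((c k * c l) $$ (j,i))" using ij c_M[OF that(1)] c_M[OF that(2)] by simp
    ultimately show ?thesis by simp
  qed
  then have "adj (quad z) $$ (i,j) = (\<Sum>k\<in>I. \<Sum>l\<in>I. cnj (z k l) * (c l * c k) $$ (i,j))"
    using ij carrier_matD[OF quad_M[of z]] by (simp add: quad_index)
  also have "\<dots> = (\<Sum>l\<in>I. \<Sum>k\<in>I. cnj (z k l) * (c l * c k) $$ (i,j))" by (rule sum.swap)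
  finally show "adj (quad z) $$ (i,j) = quad (\<lambda>k l. cnj (z l k)) $$ (i,j)" using ij by (simp add: quad_index)
qed auto

lemma quad_cong: "(\<And>k l. k \<in> I \<Longrightarrow> l \<in> I \<Longrightarrow> z k l = z' k l) \<Longrightarrow> quad z = quad z'"
  by (rule M_eqI) (auto simp: quad_index)

text \<open>A real antisymmetric \<open>K\<close> makes the exponent hermitian, hence diagonalisable
  with real eigenvalues, and the exponential of a quadratic operator preserves the span of the
  \<open>c k\<close>.\<close>

lemma gauss_spec:
  assumes "gauss \<rho>"
  obtains U lam where "unitary n U" "\<And>i. lam i > 0" "\<rho> = spec U (\<lambda>i. complex_of_real (lam i))" "preserves \<rho>"
proof -
  obtain K \<kappa> where K: "\<And>k l. k \<in> I \<Longrightarrow> l \<in> I \<Longrightarrow> K k l = - K l k" and \<kappa>: "\<kappa> > 0"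
    and \<rho>: "\<rho> = complex_of_real \<kappa> \<cdot>\<^sub>m mexp n ((- \<i> / 2) \<cdot>\<^sub>m quad (\<lambda>k l. complex_of_real (K k l)))"
    using assms unfolding gauss_def by blast
  define z where "z k l = (- \<i> / 2) * complex_of_real (K k l)" for k l
  have "hermitian n (quad z)"
    unfolding hermitian_def quad_adj
  proof (intro conjI quad_M quad_cong)
    fix k l assume "k \<in> I" "l \<in> I"
    then have "K l k = - K k l" using K by blast
    then show "cnj (z l k) = z k l" by (simp add: z_def)
  qed
  then obtain U mu where U: "unitary n U" and mu: "quad z = spec U (\<lambda>i. complex_of_real (mu i))"
    by (rule hermitian_spec)
  have r: "\<rho> = complex_of_real \<kappa> \<cdot>\<^sub>m spec U (\<lambda>i. exp (complex_of_real (mu i)))"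
    unfolding \<rho> quad_smult z_def[symmetric] mu mexp_spec[OF U] ..
  show ?thesis
  proof (rule that[OF U])
    show "\<kappa> * exp (mu i) > 0" for i using \<kappa> by simp
    show "\<rho> = spec U (\<lambda>i. complex_of_real (\<kappa> * exp (mu i)))"
      unfolding r by (simp add: spec_smult[OF U, symmetric] exp_of_real)
    have "spec U (\<lambda>i. complex_of_real (mu i)) \<in> quadratics" unfolding mu[symmetric] by (rule quad_quadratics)
    from preserves_exp[OF U this, of 1]
    show "preserves \<rho>" unfolding r using U by (intro preserves_smult) auto
  qed
qed

text \<open>The logarithm of \<open>\<rho>\<close> is hermitian and in \<open>quadratics\<close>.
  Hermiticity makes its coefficients imaginary, which yields a real \<open>K\<close>, and its scalar
  part becomes the normalisation \<open>exp h\<close>.\<close>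

lemma gaussI:
  assumes \<rho>: "faithful_state n \<rho>" and p: "preserves \<rho>"
  shows "gauss \<rho>"
proof -
  have "hermitian n \<rho>" using \<rho> by (simp add: faithful_state_def posdef_def)
  then obtain U lam where U: "unitary n U" and lam: "\<rho> = spec U (\<lambda>i. complex_of_real (lam i))"
    by (rule hermitian_spec)
  have pos: "lam i > 0" if "i < n" for i
    using posdef_spec_pos[OF U _ that] \<rho> unfolding lam by (simp add: faithful_state_def)
  define X where "X = spec U (\<lambda>i. complex_of_real (ln (lam i)))"
  have XQ: "X \<in> quadratics" unfolding X_def by (rule quadratics_of_preserves[OF U pos p[unfolded lam]])
  have XM: "X \<in> M" and Xadj: "adj X = X" using U by (simp_all add: X_def spec_adj)
  define z where "z = qcoeff X"
  have z_imag: "Re (z k l) = 0" if k: "k \<in> I" and l: "l \<in> I" for k l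
  proof -
    note M = XM c_M[OF k] c_M[OF l]
    have "cnj (tr ((X * c l - c l * X) * c k)) = tr (adj ((X * c l - c l * X) * c k))" using M by (simp add: M_tr)
    also have "adj ((X * c l - c l * X) * c k) = (-1) \<cdot>\<^sub>m (c k * (X * c l - c l * X))"
      using M Xadj c_adj[OF k] c_adj[OF l] by (intro M_eqI) (auto simp: M_adj M_distrib)
    also have "tr \<dots> = - tr (c k * (X * c l - c l * X))" using M by (simp add: M_tr)
    also have "tr (c k * (X * c l - c l * X)) = tr ((X * c l - c l * X) * c k)" using M by (intro M_tr_comm) auto
    finally have "Re (tr ((X * c l - c l * X) * c k)) = 0"
      by (simp add: complex_eq_iff)
    then show ?thesis by (simp add: z_def qcoeff_def complex_is_Real_iff Re_divide)
  qed
  \<comment> \<open>Solves \<open>z k l = (- \<i> / 2) * K k l\<close> for imaginary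
    \<open>z k l\<close>.\<close>
  define K where "K k l = - 2 * Im (z k l)" for k l
  have zK: "z k l = (- \<i> / 2) * complex_of_real (K k l)" if "k \<in> I" "l \<in> I" for k l
    using z_imag[OF that] by (simp add: K_def complex_eq_iff)
  have "tr (adj X) = cnj (tr X)" using XM by (simp add: M_tr)
  then have "tr X = complex_of_real (Re (tr X))" using Xadj by (simp add: complex_eq_iff)
  define h where "h = Re (tr X) / n"
  have h: "tr X / of_nat n = complex_of_real h" using \<open>tr X = complex_of_real (Re (tr X))\<close> 
    by (simp add: h_def)
  have "X = quad z + complex_of_real h \<cdot>\<^sub>m 1\<^sub>m n" using quadratics_decompose[OF XQ] unfolding h z_def .
  then have "quad z = X + complex_of_real (- h) \<cdot>\<^sub>m 1\<^sub>m n" 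
    using XM by (intro M_eqI) auto
  also have "\<dots> = spec U (\<lambda>i. complex_of_real (ln (lam i)) + complex_of_real (-h) * 1)"
    unfolding spec_add[OF U] spec_smult[OF U] spec_one[OF U] X_def ..
  finally have "mexp n (quad z) = spec U (\<lambda>i. exp (complex_of_real (ln (lam i)) + complex_of_real (-h) * 1))"
    by (simp only: mexp_spec[OF U])
  then have "complex_of_real (exp h) \<cdot>\<^sub>m mexp n (quad z) = spec U (\<lambda>i. complex_of_real (exp h) * exp (complex_of_real (ln (lam i)) + complex_of_real (-h) * 1))"
    by (simp only: spec_smult[OF U])
  also have "\<dots> = \<rho>"
    unfolding lam
  proof (rule spec_cong)
    fix i assume "i < n"
    then have "exp h * exp (ln (lam i) + - h) = lam i" using pos by (simp add: exp_diff)
    then show "complex_of_real (exp h) * exp (complex_of_real (ln (lam i)) + complex_of_real (-h) * 1) = complex_of_real (lam i)"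
      by (metis exp_of_real mult.right_neutral of_real_add of_real_mult)
  qed
  finally have r: "\<rho> = complex_of_real (exp h) \<cdot>\<^sub>m mexp n (quad z)" by simp
  have "quad z = (- \<i> / 2) \<cdot>\<^sub>m quad (\<lambda>k l. complex_of_real (K k l))"
    unfolding quad_smult by (rule quad_cong[OF zK])
  then have r': "\<rho> = complex_of_real (exp h) \<cdot>\<^sub>m mexp n ((- \<i> / 2) \<cdot>\<^sub>m quad (\<lambda>k l. complex_of_real (K k l)))"
    using r by simp
  have "K k l = - K l k" if "k \<in> I" "l \<in> I" for k l
    using qcoeff_antisym[OF XM that] by (simp add: K_def z_def)
  then show ?thesis unfolding gauss_def using \<rho> r' exp_gt_zero by blast
qed

text \<open>Quadratic in \<open>\<rho>\<close> and free of its inverse, hence easy to differentiate along a curve of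
  Gaussian states.\<close>

lemma gauss_bilinear:
  assumes "gauss \<rho>" and Y: "Y \<in> M"
  shows "mat_sum n (\<lambda>k. tr (Y * (\<rho> * c k)) \<cdot>\<^sub>m (\<rho> * c k)) I = mat_sum n (\<lambda>k. tr (Y * (c k * \<rho>)) \<cdot>\<^sub>m (c k * \<rho>)) I"
proof -
  obtain U lam where U: "unitary n U" and lam: "\<And>i. lam i > 0" and \<rho>: "\<rho> = spec U (\<lambda>i. complex_of_real (lam i))" 
    and p: "preserves \<rho>" using assms(1) by (rule gauss_spec) (rule that)
  let ?l = "\<lambda>i. complex_of_real (lam i)"
  have nz: "\<forall>i<n. ?l i \<noteq> 0" using lam by (auto simp: less_imp_neq[symmetric])
  define R where "R = spec U (\<lambda>i. 1 / ?l i)"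
  have PR: "\<rho> * R = 1\<^sub>m n" "R * \<rho> = 1\<^sub>m n"
    unfolding R_def \<rho> spec_mult[OF U] spec_one[OF U, symmetric] by (rule spec_cong, use nz in simp)+
  have M: "\<rho> \<in> M" "R \<in> M" using U by (simp_all add: \<rho> R_def)
  have cancel: "\<rho> * (R * A) = A" "R * (\<rho> * A) = A" if "A \<in> M" for A
    using that M PR M_assoc[of \<rho> R A] M_assoc[of R \<rho> A] by simp_all
  \<comment> \<open>The matrix of conjugation by \<open>\<rho>\<close> in the basis
    \<open>c k\<close>.\<close>
  define u where "u k l = tr ((\<rho> * (c k * R)) * c l) / of_nat n" for k l
  have 1: "\<rho> * c k = mat_sum n (\<lambda>l. u k l \<cdot>\<^sub>m (c l * \<rho>)) I" if k: "k \<in> I" for k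
  proof -
    have "hmul n U (\<lambda>i j. ?l i / ?l j) (c k) \<in> maj_span" 
      by (rule preserves_specD[OF U nz p[unfolded \<rho>] c_in_maj_span[OF k]])
    moreover have "hmul n U (\<lambda>i j. ?l i / ?l j) (c k) = \<rho> * (c k * R)"
      using U c_M[OF k] by (simp add: \<rho> R_def spec_sandwich)
    ultimately have "\<rho> * (c k * R) = mat_sum n (\<lambda>l. u k l \<cdot>\<^sub>m c l) I"
      unfolding u_def by (intro maj_span_expand) simp
    then have "(\<rho> * (c k * R)) * \<rho> = mat_sum n (\<lambda>l. u k l \<cdot>\<^sub>m c l) I * \<rho>" by simp
    then show ?thesis using M c_M k PR by (simp add: M_assoc mat_sum_mult_right M_smult cong: mat_sum_cong)
  qed
  \<comment> \<open>The inverse conjugation has the transposed matrix, because conjugation leaves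
    the trace form invariant: \<open>u\<close> is complex orthogonal. This is why the sum over
    \<open>k\<close> does not change.\<close>
  have 2: "c l * \<rho> = mat_sum n (\<lambda>k. u k l \<cdot>\<^sub>m (\<rho> * c k)) I" if l: "l \<in> I" for l
  proof -
    have "hmul n U (\<lambda>i j. (1 / ?l i) * ?l j) (c l) \<in> maj_span" 
      by (rule preserves_spec_fun[OF U nz p[unfolded \<rho>] c_in_maj_span[OF l], of _ "\<lambda>z. 1 / z"]) simp
    moreover have "hmul n U (\<lambda>i j. (1 / ?l i) * ?l j) (c l) = R * (c l * \<rho>)"
      unfolding \<rho> R_def using U c_M[OF l] by (intro spec_sandwich[symmetric])
    ultimately have "R * (c l * \<rho>) \<in> maj_span" by simp
    from maj_span_expand[OF this] 
    have "R * (c l * \<rho>) = mat_sum n (\<lambda>k. (tr (R * (c l * \<rho>) * c k) / of_nat n) \<cdot>\<^sub>m c k) I" .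
    also have "\<dots> = mat_sum n (\<lambda>k. u k l \<cdot>\<^sub>m c k) I"
    proof (rule mat_sum_cong)
      fix k assume k: "k \<in> I"
      have "tr ((R * c l) * (\<rho> * c k)) = tr ((\<rho> * c k) * (R * c l))"
        using M c_M[OF k] c_M[OF l] by (intro M_tr_comm) auto
      then show "(tr (R * (c l * \<rho>) * c k) / of_nat n) \<cdot>\<^sub>m c k = u k l \<cdot>\<^sub>m c k"
        using M c_M[OF k] c_M[OF l] by (simp add: u_def M_assoc)
    qed
    finally have "\<rho> * (R * (c l * \<rho>)) = \<rho> * mat_sum n (\<lambda>k. u k l \<cdot>\<^sub>m c k) I" by simp
    then show ?thesis using M c_M l by (simp add: cancel mat_sum_mult_left M_smult cong: mat_sum_cong)
  qed
  \<comment> \<open>The first tensor factor of the quadratic identity is represented by its trace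
    against an arbitrary \<open>Y\<close>, which avoids tensor products.\<close>
  show ?thesis
  proof (rule M_eqI)
    fix i j assume ij: "i < n" "j < n"
    have "mat_sum n (\<lambda>k. tr (Y * (\<rho> * c k)) \<cdot>\<^sub>m (\<rho> * c k)) I $$ (i,j) = (\<Sum>k\<in>I. tr (Y * (\<rho> * c k)) * (\<rho> * c k) $$ (i,j))"
      using ij M c_M by simp
    also have "\<dots> = (\<Sum>k\<in>I. tr (Y * (\<rho> * c k)) * (\<Sum>l\<in>I. u k l * (c l * \<rho>) $$ (i,j)))"
    proof (rule sum.cong[OF refl])
      fix k assume k: "k \<in> I"
      have "(\<rho> * c k) $$ (i,j) = mat_sum n (\<lambda>l. u k l \<cdot>\<^sub>m (c l * \<rho>)) I $$ (i,j)" unfolding 1[OF k] ..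
      also have "\<dots> = (\<Sum>l\<in>I. u k l * (c l * \<rho>) $$ (i,j))" using ij M c_M by simp
      finally show "tr (Y * (\<rho> * c k)) * (\<rho> * c k) $$ (i,j) = tr (Y * (\<rho> * c k)) * (\<Sum>l\<in>I. u k l * (c l * \<rho>) $$ (i,j))" by simp
    qed
    also have "\<dots> = (\<Sum>k\<in>I. \<Sum>l\<in>I. u k l * tr (Y * (\<rho> * c k)) * (c l * \<rho>) $$ (i,j))"
      by (simp add: sum_distrib_left mult_ac)
    also have "\<dots> = (\<Sum>l\<in>I. \<Sum>k\<in>I. u k l * tr (Y * (\<rho> * c k)) * (c l * \<rho>) $$ (i,j))" by (rule sum.swap)
    also have "\<dots> = (\<Sum>l\<in>I. tr (Y * (c l * \<rho>)) * (c l * \<rho>) $$ (i,j))"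
    proof (rule sum.cong[OF refl])
      fix l assume l: "l \<in> I"
      have "tr (Y * (c l * \<rho>)) = tr (Y * mat_sum n (\<lambda>k. u k l \<cdot>\<^sub>m (\<rho> * c k)) I)" unfolding 2[OF l] ..
      also have "\<dots> = (\<Sum>k\<in>I. u k l * tr (Y * (\<rho> * c k)))"
        using M c_M Y by (simp add: mat_sum_mult_left tr_mat_sum M_smult M_tr)
      finally show "(\<Sum>k\<in>I. u k l * tr (Y * (\<rho> * c k)) * (c l * \<rho>) $$ (i,j)) = tr (Y * (c l * \<rho>)) * (c l * \<rho>) $$ (i,j)"
        by (simp add: sum_distrib_right)
    qed
    finally show "mat_sum n (\<lambda>k. tr (Y * (\<rho> * c k)) \<cdot>\<^sub>m (\<rho> * c k)) I $$ (i,j) = mat_sum n (\<lambda>k. tr (Y * (c k * \<rho>)) \<cdot>\<^sub>m (c k * \<rho>)) I $$ (i,j)"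
      using ij M c_M by simp
  qed auto
qed

end

section \<open>The tangent space at a Gaussian state\<close>

context clifford
begin

definition tangent :: "complex mat \<Rightarrow> complex mat set" where
  "tangent \<rho> = {A. A \<in> M \<and>
     (\<exists>(\<gamma> :: real \<Rightarrow> complex mat) (e::real). e > 0 \<and> \<gamma> 0 = \<rho> \<and>
        (\<forall>s\<in>{-e<..<e}. gauss (\<gamma> s)) \<and>
        (\<forall>i<n. \<forall>j<n. smooth_on {-e<..<e} (\<lambda>s. \<gamma> s $$ (i,j)) \<and>
            ((\<lambda>s. \<gamma> s $$ (i,j)) has_vector_derivative A $$ (i,j)) (at 0)))}"

lemma gauss_D: "gauss \<rho> \<Longrightarrow> \<rho> \<in> M" "gauss \<rho> \<Longrightarrow> hermitian n \<rho>" "gauss \<rho> \<Longrightarrow> tr \<rho> = 1"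
  by (auto simp: gauss_def faithful_state_def posdef_def hermitian_def)

lemma tangent_mat_deriv:
  assumes "A \<in> tangent \<rho>" and \<rho>: "gauss \<rho>"
  obtains \<gamma> where "\<gamma> 0 = \<rho>" "\<And>s. gauss (\<gamma> s)" "mat_deriv \<gamma> A"
proof -
  obtain \<gamma> e where A: "A \<in> M" and e: "e > 0" and 0: "\<gamma> 0 = \<rho>" and g: "\<And>s. s \<in> {-e<..<e} \<Longrightarrow> gauss (\<gamma> s)"
    and d: "\<And>i j. i < n \<Longrightarrow> j < n \<Longrightarrow> ((\<lambda>s. \<gamma> s $$ (i,j)) has_vector_derivative A $$ (i,j)) (at 0)"
    using assms(1) unfolding tangent_def by blast
  \<comment> \<open>Outside the interval the curve is frozen at \<open>\<rho>\<close>. The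
    derivative at 0 is unaffected, and Gaussianity now holds for all \<open>s\<close>.\<close>
  define \<gamma>' where "\<gamma>' s = (if s \<in> {-e<..<e} then \<gamma> s else \<rho>)" for s
  have g': "gauss (\<gamma>' s)" for s using g \<rho> by (simp add: \<gamma>'_def)
  show ?thesis
  proof (rule that[of \<gamma>'])
    show "\<gamma>' 0 = \<rho>" using 0 by (simp add: \<gamma>'_def)
    show "gauss (\<gamma>' s)" for s by (rule g')
    show "mat_deriv \<gamma>' A" unfolding mat_deriv_def
    proof (intro conjI allI impI)
      fix i j assume ij: "i < n" "j < n"
      show "((\<lambda>s. \<gamma>' s $$ (i,j)) has_vector_derivative A $$ (i,j)) (at 0)"
        unfolding has_vector_derivative_def
        by (rule has_derivative_transform_within_open[OF d[OF ij, unfolded has_vector_derivative_def], of "{-e<..<e}"])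
           (use e in \<open>auto simp: \<gamma>'_def\<close>)
    qed (use A g' gauss_D in auto)
  qed
qed

text \<open>Product rule on both sides of \<open>gauss_bilinear\<close>; uniqueness of derivatives
  equates the results.\<close>

lemma gauss_bilinear_deriv:
  assumes 0: "\<gamma> 0 = \<rho>" and g: "\<And>s. gauss (\<gamma> s)" and d: "mat_deriv \<gamma> A" and Y: "Y \<in> M"
  shows "mat_sum n (\<lambda>k. tr (Y * (\<rho> * c k)) \<cdot>\<^sub>m (A * c k)) I + mat_sum n (\<lambda>k. tr (Y * (A * c k)) \<cdot>\<^sub>m (\<rho> * c k)) I
    = mat_sum n (\<lambda>k. tr (Y * (c k * \<rho>)) \<cdot>\<^sub>m (c k * A)) I + mat_sum n (\<lambda>k. tr (Y * (c k * A)) \<cdot>\<^sub>m (c k * \<rho>)) I"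
proof (rule M_eqI)
  have AM: "A \<in> M" and \<rho>M: "\<rho> \<in> M" and gM: "\<gamma> s \<in> M" for s using d 0 by (auto simp: mat_deriv_def)
  fix i j assume ij: "i < n" "j < n"
  have eq: "(\<Sum>k\<in>I. tr (Y * (\<gamma> s * c k)) * (\<gamma> s * c k) $$ (i,j)) = (\<Sum>k\<in>I. tr (Y * (c k * \<gamma> s)) * (c k * \<gamma> s) $$ (i,j))" for s
    using arg_cong[OF gauss_bilinear[OF g[of s] Y], of "\<lambda>Z. Z $$ (i,j)"] ij c_M gM by simp
  have l: "((\<lambda>s. \<Sum>k\<in>I. tr (Y * (\<gamma> s * c k)) * (\<gamma> s * c k) $$ (i,j)) has_vector_derivative
     (\<Sum>k\<in>I. tr (Y * (\<gamma> 0 * c k)) * (A * c k) $$ (i,j) + tr (Y * (A * c k)) * (\<gamma> 0 * c k) $$ (i,j))) (at 0)"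
    by (intro has_vector_derivative_sum has_vector_derivative_mult mat_deriv_tr mat_deriv_index mat_deriv_left mat_deriv_right d Y c_M ij)
  have r: "((\<lambda>s. \<Sum>k\<in>I. tr (Y * (c k * \<gamma> s)) * (c k * \<gamma> s) $$ (i,j)) has_vector_derivative
     (\<Sum>k\<in>I. tr (Y * (c k * \<gamma> 0)) * (c k * A) $$ (i,j) + tr (Y * (c k * A)) * (c k * \<gamma> 0) $$ (i,j))) (at 0)"
    by (intro has_vector_derivative_sum has_vector_derivative_mult mat_deriv_tr mat_deriv_index mat_deriv_left mat_deriv_right d Y c_M ij)
  show "(mat_sum n (\<lambda>k. tr (Y * (\<rho> * c k)) \<cdot>\<^sub>m (A * c k)) I + mat_sum n (\<lambda>k. tr (Y * (A * c k)) \<cdot>\<^sub>m (\<rho> * c k)) I) $$ (i,j)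
    = (mat_sum n (\<lambda>k. tr (Y * (c k * \<rho>)) \<cdot>\<^sub>m (c k * A)) I + mat_sum n (\<lambda>k. tr (Y * (c k * A)) \<cdot>\<^sub>m (c k * \<rho>)) I) $$ (i,j)"
    using has_vector_derivative_unique_at[OF l[unfolded eq] r] ij AM \<rho>M c_M by (simp add: 0 sum.distrib)
qed auto

text \<open>Hermiticity and unit trace pass to the derivative. For the third claim the
  differentiated identity is tested against \<open>R * c m\<close>, where \<open>R\<close> inverts
  \<open>\<rho>\<close>. One sum on each side then collapses to a single term; multiplied by
  \<open>R\<close> from the right, these two terms form the commutator of \<open>A * R\<close> with
  \<open>c m\<close>, while the other two sums land in the Majorana span.\<close>

lemma tangent_imp:
  assumes A: "A \<in> tangent \<rho>" and g: "gauss \<rho>"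
  shows "hermitian n A" "tr A = 0" "\<exists>X\<in>quadratics. A = X * \<rho>"
proof -
  obtain \<gamma> where \<gamma>: "\<gamma> 0 = \<rho>" "\<And>s. gauss (\<gamma> s)" "mat_deriv \<gamma> A" using tangent_mat_deriv[OF A g] by blast
  show "hermitian n A" using mat_deriv_hermitian[OF \<gamma>(3)] gauss_D(2)[OF \<gamma>(2)] by blast
  have "((\<lambda>s. tr (\<gamma> s)) has_vector_derivative 0) (at 0)" using gauss_D(3)[OF \<gamma>(2)] by simp
  then show "tr A = 0" using mat_deriv_tr[OF \<gamma>(3)] has_vector_derivative_unique_at by blast
  obtain U lam where U: "unitary n U" and lam: "\<And>i. lam i > 0" and \<rho>: "\<rho> = spec U (\<lambda>i. complex_of_real (lam i))" 
    and p: "preserves \<rho>" using g by (rule gauss_spec) (rule that)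
  let ?l = "\<lambda>i. complex_of_real (lam i)"
  have nz: "\<forall>i<n. ?l i \<noteq> 0" using lam by (auto simp: less_imp_neq[symmetric])
  define R where "R = spec U (\<lambda>i. 1 / ?l i)"
  have PR: "\<rho> * R = 1\<^sub>m n" "R * \<rho> = 1\<^sub>m n"
    unfolding R_def \<rho> spec_mult[OF U] spec_one[OF U, symmetric] by (rule spec_cong, use nz in simp)+
  have M: "\<rho> \<in> M" "R \<in> M" "A \<in> M" using U A by (simp_all add: \<rho> R_def tangent_def)
  have cancel: "\<rho> * (R * A) = A" "R * (\<rho> * A) = A" if "A \<in> M" for A
    using that M PR M_assoc[of \<rho> R A] M_assoc[of R \<rho> A] by simp_all
  have "A * R * c m - c m * (A * R) \<in> maj_span" if m: "m \<in> I" for m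
  proof -
    note cm = c_M[OF m]
    \<comment> \<open>Only that \<open>a k\<close> and \<open>b k\<close> are scalars matters; their
      values are never computed.\<close>
    define a where "a k = tr ((R * c m) * (A * c k))" for k
    define b where "b k = tr ((R * c m) * (c k * A))" for k
    have Rc: "R * (c m * \<rho>) \<in> maj_span"
    proof -
      have "hmul n U (\<lambda>i j. (1 / ?l i) * ?l j) (c m) \<in> maj_span" 
        by (rule preserves_spec_fun[OF U nz p[unfolded \<rho>] c_in_maj_span[OF m], of _ "\<lambda>z. 1 / z"]) simp
      moreover have "hmul n U (\<lambda>i j. (1 / ?l i) * ?l j) (c m) = R * (c m * \<rho>)"
        unfolding \<rho> R_def using U cm by (intro spec_sandwich[symmetric])
      ultimately show ?thesis by simp
    qed
    have cR: "\<rho> * (c k * R) \<in> maj_span" if k: "k \<in> I" for k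
    proof -
      have "hmul n U (\<lambda>i j. ?l i / ?l j) (c k) \<in> maj_span" 
        by (rule preserves_specD[OF U nz p[unfolded \<rho>] c_in_maj_span[OF k]])
      moreover have "hmul n U (\<lambda>i j. ?l i / ?l j) (c k) = \<rho> * (c k * R)"
        using U c_M[OF k] by (simp add: \<rho> R_def spec_sandwich)
      ultimately show ?thesis by simp
    qed
    have T1: "mat_sum n (\<lambda>k. tr ((R * c m) * (\<rho> * c k)) \<cdot>\<^sub>m (A * c k)) I = of_nat n \<cdot>\<^sub>m (A * (R * (c m * \<rho>)))"
    proof -
      have "of_nat n \<cdot>\<^sub>m (A * (R * (c m * \<rho>))) = of_nat n \<cdot>\<^sub>m (A * mat_sum n (\<lambda>k. (tr (R * (c m * \<rho>) * c k) / of_nat n) \<cdot>\<^sub>m c k) I)"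
        using maj_span_expand[OF Rc] by simp
      also have "\<dots> = mat_sum n (\<lambda>k. tr ((R * c m) * (\<rho> * c k)) \<cdot>\<^sub>m (A * c k)) I"
        using M cm c_M n_pos by (simp add: mat_sum_mult_left mat_sum_smult M_smult smult_smult_mat M_assoc cong: mat_sum_cong)
      finally show ?thesis by simp
    qed
    have T3: "mat_sum n (\<lambda>k. tr ((R * c m) * (c k * \<rho>)) \<cdot>\<^sub>m (c k * A)) I = of_nat n \<cdot>\<^sub>m (c m * A)"
    proof -
      have t: "tr ((R * c m) * (c k * \<rho>)) = (if m = k then of_nat n else 0)" if k: "k \<in> I" for k
      proof -
        have "tr ((R * c m) * (c k * \<rho>)) = tr (R * ((c m * c k) * \<rho>))" using M cm c_M[OF k] by (simp add: M_assoc)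
        also have "\<dots> = tr ((c m * c k) * (\<rho> * R))" using M cm c_M[OF k] by (intro M_tr_cycle) auto
        finally show ?thesis using PR M cm c_M[OF k] tr_cc[OF m k] by simp
      qed
      show ?thesis
      proof (rule M_eqI)
        fix i j assume ij: "i < n" "j < n"
        have "mat_sum n (\<lambda>k. tr ((R * c m) * (c k * \<rho>)) \<cdot>\<^sub>m (c k * A)) I $$ (i,j) = (\<Sum>k\<in>I. if m = k then of_nat n * (c k * A) $$ (i,j) else 0)"
        proof -
          have "mat_sum n (\<lambda>k. tr ((R * c m) * (c k * \<rho>)) \<cdot>\<^sub>m (c k * A)) I $$ (i,j) = (\<Sum>k\<in>I. tr ((R * c m) * (c k * \<rho>)) * (c k * A) $$ (i,j))"
            using ij M c_M by (simp del: assoc_mult_mat)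
          also have "\<dots> = (\<Sum>k\<in>I. if m = k then of_nat n * (c k * A) $$ (i,j) else 0)"
            by (rule sum.cong[OF refl]) (simp add: t del: assoc_mult_mat)
          finally show ?thesis .
        qed
        then show "mat_sum n (\<lambda>k. tr ((R * c m) * (c k * \<rho>)) \<cdot>\<^sub>m (c k * A)) I $$ (i,j) = (of_nat n \<cdot>\<^sub>m (c m * A)) $$ (i,j)"
          using ij M cm m by simp
      qed (use M cm in auto)
    qed
    have "of_nat n \<cdot>\<^sub>m (A * (R * (c m * \<rho>))) + mat_sum n (\<lambda>k. a k \<cdot>\<^sub>m (\<rho> * c k)) I
       = of_nat n \<cdot>\<^sub>m (c m * A) + mat_sum n (\<lambda>k. b k \<cdot>\<^sub>m (c k * \<rho>)) I"
      using gauss_bilinear_deriv[OF \<gamma>, of "R * c m"] M cm unfolding T1 T3 a_def b_def by simp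
    then have "(of_nat n \<cdot>\<^sub>m (A * (R * (c m * \<rho>))) + mat_sum n (\<lambda>k. a k \<cdot>\<^sub>m (\<rho> * c k)) I) * R
       = (of_nat n \<cdot>\<^sub>m (c m * A) + mat_sum n (\<lambda>k. b k \<cdot>\<^sub>m (c k * \<rho>)) I) * R" by simp
    moreover have "mat_sum n (\<lambda>k. a k \<cdot>\<^sub>m (\<rho> * c k)) I * R = mat_sum n (\<lambda>k. a k \<cdot>\<^sub>m (\<rho> * (c k * R))) I"
      using M c_M by (simp add: mat_sum_mult_right M_smult M_assoc cong: mat_sum_cong)
    moreover have "mat_sum n (\<lambda>k. b k \<cdot>\<^sub>m (c k * \<rho>)) I * R = mat_sum n (\<lambda>k. b k \<cdot>\<^sub>m c k) I"
      using M c_M PR by (simp add: mat_sum_mult_right M_smult M_assoc cong: mat_sum_cong)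
    ultimately have E: "of_nat n \<cdot>\<^sub>m (A * R * c m) + mat_sum n (\<lambda>k. a k \<cdot>\<^sub>m (\<rho> * (c k * R))) I
       = of_nat n \<cdot>\<^sub>m (c m * (A * R)) + mat_sum n (\<lambda>k. b k \<cdot>\<^sub>m c k) I"
      using M cm PR by (simp add: M_distrib M_smult M_assoc)
    have "A * R * c m - c m * (A * R) = (1 / of_nat n) \<cdot>\<^sub>m (mat_sum n (\<lambda>k. b k \<cdot>\<^sub>m c k) I - mat_sum n (\<lambda>k. a k \<cdot>\<^sub>m (\<rho> * (c k * R))) I)"
    proof (rule M_eqI)
      fix i j assume ij: "i < n" "j < n"
      let ?a = "mat_sum n (\<lambda>k. a k \<cdot>\<^sub>m (\<rho> * (c k * R))) I $$ (i,j)" and ?b = "mat_sum n (\<lambda>k. b k \<cdot>\<^sub>m c k) I $$ (i,j)"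
      have "of_nat n * (A * R * c m) $$ (i,j) + ?a = of_nat n * (c m * (A * R)) $$ (i,j) + ?b"
        using arg_cong[OF E, of "\<lambda>Z. Z $$ (i,j)"] ij M cm by (simp del: assoc_mult_mat mat_sum_index)
      then have "(A * R * c m) $$ (i,j) - (c m * (A * R)) $$ (i,j) = (1 / of_nat n) * (?b - ?a)"
        using n_pos by (simp add: field_simps del: assoc_mult_mat mat_sum_index)
      then show "(A * R * c m - c m * (A * R)) $$ (i,j) = ((1 / of_nat n) \<cdot>\<^sub>m (mat_sum n (\<lambda>k. b k \<cdot>\<^sub>m c k) I - mat_sum n (\<lambda>k. a k \<cdot>\<^sub>m (\<rho> * (c k * R))) I)) $$ (i,j)"
        using ij M cm by (simp del: assoc_mult_mat mat_sum_index)
    qed (use M cm in auto)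
    also have "\<dots> \<in> maj_span"
      using c_in_maj_span cR by (intro mat_subspaceD(4)[OF maj_span_sub] mat_subspace_minus[OF maj_span_sub] mat_subspace_mat_sum[OF maj_span_sub]) auto
    finally show ?thesis .
  qed
  then have "A * R \<in> quadratics" using M by (simp add: quadratics_def)
  moreover have "A = (A * R) * \<rho>" using M PR by (simp add: M_assoc)
  ultimately show "\<exists>X\<in>quadratics. A = X * \<rho>" by blast
qed

text \<open>The curve \<open>\<rho>\<^sup>1\<^sup>/\<^sup>2 exp(s Y) \<rho>\<^sup>1\<^sup>/\<^sup>2\<close>, normalised, with \<open>Y = \<rho>\<^sup>-\<^sup>1\<^sup>/\<^sup>2 A \<rho>\<^sup>-\<^sup>1\<^sup>/\<^sup>2\<close>
  hermitian, needs exponentials of diagonalisable matrices only.\<close>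

lemma tangentI:
  assumes g: "gauss \<rho>" and A: "hermitian n A" "tr A = 0" and X: "X \<in> quadratics" "A = X * \<rho>"
  shows "A \<in> tangent \<rho>"
proof -
  obtain U lam where U: "unitary n U" and lam: "\<And>i. lam i > 0" and \<rho>: "\<rho> = spec U (\<lambda>i. complex_of_real (lam i))" 
    and p: "preserves \<rho>" using g by (rule gauss_spec) (rule that)
  let ?l = "\<lambda>i. complex_of_real (lam i)"
  define r where "r i = complex_of_real (sqrt (lam i))" for i
  have nz: "\<forall>i<n. ?l i \<noteq> 0" using lam by (auto simp: less_imp_neq[symmetric])
  have rnz: "r i \<noteq> 0" and rr: "r i * r i = ?l i" for i 
    using lam[of i] by (simp_all add: r_def less_imp_neq[symmetric] flip: of_real_mult)
  have rc: "cnj (r i) = r i" for i by (simp add: r_def)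
  have AM: "A \<in> M" using A hermitian_M by simp
  have XM: "X \<in> M" using X quadratics_M by simp
  define S where "S = spec U r"
  define Si where "Si = spec U (\<lambda>i. 1 / r i)"
  have SM: "S \<in> M" "Si \<in> M" using U by (simp_all add: S_def Si_def)
  have SS: "S * S = \<rho>" unfolding S_def \<rho> spec_mult[OF U] by (rule spec_cong) (rule rr)
  have SSi: "S * Si = 1\<^sub>m n" "Si * S = 1\<^sub>m n"
    unfolding S_def Si_def spec_mult[OF U] spec_one[OF U, symmetric] by (rule spec_cong, use rnz in simp)+
  have Sadj: "adj S = S" "adj Si = Si" by (simp_all add: S_def Si_def spec_adj[OF U] rc)
  have cancel: "S * (Si * B) = B" "Si * (S * B) = B" if "B \<in> M" for B
    using that SM SSi M_assoc[of S Si B] M_assoc[of Si S B] by simp_all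
  define Y where "Y = Si * (A * Si)"
  have YM: "Y \<in> M" using SM AM by (simp add: Y_def)
  have YQ: "Y \<in> quadratics"
  proof -
    \<comment> \<open>As a multiplier of \<open>X\<close> this is the power -1/2 of the modular
      operator, because \<open>lam j / (r i * r j) = r j / r i\<close>.\<close>
    have "Y = Si * (hmul n U (\<lambda>i j. ?l j) X * Si)" unfolding Y_def X(2) \<rho> spec_mult_right[OF U XM] ..
    also have "\<dots> = hmul n U (\<lambda>i j. (1 / r i * (1 / r j)) * ?l j) X"
      unfolding Si_def using U XM by (simp add: spec_sandwich hmul_hmul)
    also have "\<dots> \<in> quadratics"
    proof (rule preserves_quadratics_fun[OF U nz p[unfolded \<rho>] X(1), of _ "\<lambda>z. complex_of_real (1 / sqrt (Re z))"])
      fix i j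
      have "(1 / r i * (1 / r j)) * ?l j = r j / r i" using rnz[of i] rnz[of j] rr[of j, symmetric] by simp
      also have "\<dots> = complex_of_real (1 / sqrt (Re (?l i / ?l j)))"
        by (simp add: r_def real_sqrt_divide flip: of_real_divide)
      finally show "(1 / r i * (1 / r j)) * ?l j = complex_of_real (1 / sqrt (Re (?l i / ?l j)))" .
    qed
    finally show ?thesis .
  qed
  have "hermitian n Y" using A YM SM by (simp add: hermitian_def Y_def M_adj Sadj M_assoc)
  then obtain V nu where V: "unitary n V" and Y: "Y = spec V (\<lambda>i. complex_of_real (nu i))" by (rule hermitian_spec)
  note VM = unitary_M[OF V]
  define T where "T s = spec V (\<lambda>i. exp (complex_of_real s * complex_of_real (nu i)))" for s
  have TM: "T s \<in> M" for s using V by (simp add: T_def)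
  have TT: "T s * T t = T (s + t)" for s t
    unfolding T_def spec_mult[OF V] by (rule spec_cong) (simp add: exp_add distrib_right)
  have T0: "T 0 = 1\<^sub>m n" unfolding T_def spec_one[OF V, symmetric] by (rule spec_cong) simp
  have Tadj: "adj (T s) = T s" for s unfolding T_def spec_adj[OF V] by (rule spec_cong) (simp add: exp_of_real flip: of_real_mult)
  define P where "P s = S * (T s * S)" for s
  have PM: "P s \<in> M" for s using SM TM by (simp add: P_def)
  \<comment> \<open>Half of the exponent goes to each side, so that \<open>P s\<close> is
    \<open>adj (Z s) * Z s\<close> with \<open>Z s\<close> invertible, hence positive
    definite.\<close>
  define Z where "Z s = T (s/2) * S" for s
  have ZM: "Z s \<in> M" for s using SM TM by (simp add: Z_def)
  have PZ: "P s = adj (Z s) * Z s" for s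
  proof -
    have "adj (Z s) * Z s = S * (T (s/2) * (T (s/2) * S))" using SM TM by (simp add: Z_def M_adj Sadj Tadj M_assoc)
    also have "T (s/2) * (T (s/2) * S) = (T (s/2) * T (s/2)) * S" using SM TM by (intro M_assoc[symmetric])
    finally show ?thesis by (simp add: TT P_def)
  qed
  have WZ: "(Si * T (-(s/2))) * Z s = 1\<^sub>m n" "Si * T (-(s/2)) \<in> M" for s
  proof -
    have "(Si * T (-(s/2))) * Z s = Si * ((T (-(s/2)) * T (s/2)) * S)" using SM TM by (simp add: Z_def M_assoc)
    then show "(Si * T (-(s/2))) * Z s = 1\<^sub>m n" using SM SSi by (simp add: TT T0)
  qed (use SM TM in simp)
  define t where "t s = tr (P s)" for s
  have tpos: "\<exists>q>0. t s = complex_of_real q" for s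
    using tr_adj_mult_pos[OF ZM WZ(2) WZ(1) n_pos, of s] unfolding t_def PZ by metis
  then have tnz: "t s \<noteq> 0" for s by (metis of_real_eq_0_iff less_irrefl)
  define \<gamma> where "\<gamma> s = inverse (t s) \<cdot>\<^sub>m P s" for s
  have P0: "P 0 = \<rho>" using SM SS by (simp add: P_def T0)
  have t0: "t 0 = 1" using gauss_D(3)[OF g] by (simp add: t_def P0)
  have preS: "preserves S" unfolding S_def
  proof (rule preserves_specI[OF U])
    fix y assume y: "y \<in> maj_span"
    show "hmul n U (\<lambda>i j. r i / r j) y \<in> maj_span"
      by (rule preserves_spec_fun[OF U nz p[unfolded \<rho>] y, of _ "\<lambda>z. complex_of_real (sqrt (Re z))"])
        (simp add: r_def real_sqrt_divide flip: of_real_divide)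
  qed (simp add: rnz)
  have preT: "preserves (T s)" for s
    unfolding T_def by (rule preserves_exp[OF V YQ[unfolded Y]])
  have gauss\<gamma>: "gauss (\<gamma> s)" for s
  proof (rule gaussI)
    obtain q where q: "q > 0" "t s = complex_of_real q" using tpos by blast
    have "posdef n (complex_of_real (inverse q) \<cdot>\<^sub>m (adj (Z s) * Z s))"
      by (rule posdef_scale_adj_mult[OF ZM WZ(2) WZ(1)]) (use q in simp)
    then have "posdef n (\<gamma> s)" by (simp add: \<gamma>_def PZ q)
    moreover have "tr (\<gamma> s) = 1" using tnz[of s] PM by (simp add: \<gamma>_def M_tr t_def)
    ultimately show "faithful_state n (\<gamma> s)" by (simp add: faithful_state_def)
    show "preserves (\<gamma> s)" unfolding \<gamma>_def P_def 
      using SM TM preS preT by (intro preserves_smult preserves_mult) auto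
  qed
  have Ti: "(\<lambda>s. T s $$ (i,j)) \<in> exp_alg" if "i < n" "j < n" for i j
  proof -
    have "(\<lambda>s. \<Sum>l<n. V $$ (i,l) * (exp (complex_of_real s * complex_of_real (nu l)) * cnj (V $$ (j,l)))) \<in> exp_alg"
      by (intro exp_alg_sum exp_alg.intros) auto
    then show ?thesis unfolding T_def by (simp add: spec_index[OF V that])
  qed
  have Pi: "(\<lambda>s. P s $$ (i,j)) \<in> exp_alg" if ij: "i < n" "j < n" for i j
  proof -
    have "(\<lambda>s. \<Sum>k<n. S $$ (i,k) * (\<Sum>l<n. T s $$ (k,l) * S $$ (l,j))) \<in> exp_alg"
      by (intro exp_alg_sum exp_alg.intros Ti) auto
    moreover have "P s $$ (i,j) = (\<Sum>k<n. S $$ (i,k) * (\<Sum>l<n. T s $$ (k,l) * S $$ (l,j)))" for s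
      unfolding P_def using ij SM TM by (simp add: M_mult_index)
    ultimately show ?thesis by simp
  qed
  have te: "t \<in> exp_alg"
  proof -
    have "t = (\<lambda>s. \<Sum>i<n. P s $$ (i,i))" using carrier_matD(1)[OF PM] by (simp add: t_def tr_def fun_eq_iff)
    then show ?thesis using Pi by (auto intro!: exp_alg_sum)
  qed
  have \<gamma>i: "\<gamma> s $$ (i,j) = inverse (t s) * P s $$ (i,j)" if "i < n" "j < n" for s i j
    using that PM by (simp add: \<gamma>_def)
  have dT: "mat_deriv T Y"
    unfolding mat_deriv_def
  proof (intro conjI allI impI YM TM)
    fix i j assume ij: "i < n" "j < n"
    have "((\<lambda>s. \<Sum>l<n. V $$ (i,l) * (exp (complex_of_real s * complex_of_real (nu l)) * cnj (V $$ (j,l)))) has_vector_derivative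
       (\<Sum>l<n. V $$ (i,l) * ((complex_of_real (nu l) * exp (complex_of_real 0 * complex_of_real (nu l))) * cnj (V $$ (j,l))))) (at 0)"
      by (intro has_vector_derivative_sum has_vector_derivative_mult_right has_vector_derivative_mult_left exp_has_vector_derivative)
    then show "((\<lambda>s. T s $$ (i,j)) has_vector_derivative Y $$ (i,j)) (at 0)"
      unfolding T_def Y spec_index[OF V ij] by simp
  qed
  have "mat_deriv P (S * (Y * S))" unfolding P_def by (intro mat_deriv_left mat_deriv_right dT SM)
  moreover have "S * (Y * S) = A" using SM AM SSi by (simp add: Y_def M_assoc cancel)
  ultimately have dP: "mat_deriv P A" by simp
  \<comment> \<open>The trace is stationary at 0 because \<open>A\<close> is traceless, so
    normalising leaves the derivative \<open>A\<close> of \<open>P\<close> unchanged.\<close>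
  have "(t has_vector_derivative 0) (at 0)" using mat_deriv_tr[OF dP] A(2) by (simp add: t_def[abs_def])
  from has_vector_derivative_inverse[OF this tnz]
  have dt: "((\<lambda>s. inverse (t s)) has_vector_derivative 0) (at 0)" by simp
  show ?thesis unfolding tangent_def
  proof (intro CollectI conjI AM exI[of _ \<gamma>] exI[of _ "1::real"] allI impI ballI gauss\<gamma>)
    have "inverse (t 0) \<cdot>\<^sub>m P 0 = 1 \<cdot>\<^sub>m \<rho>" by (simp add: t0 P0)
    then show "\<gamma> 0 = \<rho>" by (simp add: \<gamma>_def one_smult_mat)
    fix i j assume ij: "i < n" "j < n"
    show "smooth_on {- 1<..<1} (\<lambda>s. \<gamma> s $$ (i,j))"
      unfolding \<gamma>i[OF ij] by (rule frac_alg_smooth[OF te tnz]) (intro frac_alg.mult frac_alg.inv frac_alg.base Pi ij)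
    have "((\<lambda>s. inverse (t s) * P s $$ (i,j)) has_vector_derivative inverse (t 0) * A $$ (i,j) + 0 * P 0 $$ (i,j)) (at 0)"
      by (intro has_vector_derivative_mult dt mat_deriv_index[OF dP] ij)
    then show "((\<lambda>s. \<gamma> s $$ (i,j)) has_vector_derivative A $$ (i,j)) (at 0)" 
      unfolding \<gamma>i[OF ij] by (simp add: t0)
  qed simp
qed

lemma tangent_iff:
  assumes "gauss \<rho>"
  shows "A \<in> tangent \<rho> \<longleftrightarrow> hermitian n A \<and> tr A = 0 \<and> (\<exists>X\<in>quadratics. A = X * \<rho>)"
  using tangent_imp[OF _ assms] tangentI[OF assms] by blast

end

section \<open>Metrics and moments\<close>

context square_mats
begin

text \<open>The adjoint and the trace each swap the indices of the multiplier, and real weights are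
  unchanged by conjugation.\<close>

lemma form_swap:
  assumes U: "unitary n U" and B: "B \<in> M" and T: "T \<in> M"
  shows "tr (adj B * hmul n U (\<lambda>i j. complex_of_real (G i j)) T) = 
    tr (adj (hmul n U (\<lambda>i j. complex_of_real (G i j)) B) * T)"
  using assms by (simp add: tr_hmul_right hmul_adj)

text \<open>The weights \<open>lam i powr (-a) * lam j powr (a - 1)\<close> are homogeneous of
  degree -1, so splitting off \<open>1 / lam j\<close> leaves a function of the ratio alone. The
  split-off factor is later cancelled by the \<open>\<rho>\<close> in
  \<open>X * \<rho>\<close>.\<close>

lemma Omega_alpha_hmul:
  assumes U: "unitary n U" and lam: "\<And>i. lam i > 0" and \<sigma>: "\<sigma> \<in> M"
  shows "Omega_alpha n a (spec U (\<lambda>i. complex_of_real (lam i))) \<sigma> = 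
    hmul n U (\<lambda>i j. complex_of_real (((lam i / lam j) powr (-a) + (lam i / lam j) powr (a - 1)) / 2 / lam j)) \<sigma>"
proof -
  let ?p = "\<lambda>s. spec U (\<lambda>i. complex_of_real (lam i powr s))"
  let ?F = "\<lambda>s t i j. complex_of_real (lam i powr s) * complex_of_real (lam j powr t)"
  have 1: "lam i powr (-a) * lam j powr (a - 1) = (lam i / lam j) powr (-a) / lam j" for i j
    using lam[of i] lam[of j] by (simp add: powr_divide powr_diff powr_minus field_simps)
  have 2: "lam i powr (a - 1) * lam j powr (-a) = (lam i / lam j) powr (a - 1) / lam j" for i j
    using lam[of i] lam[of j] by (simp add: powr_divide powr_diff powr_minus field_simps)
  have mp: "mpowr n (spec U (\<lambda>i. complex_of_real (lam i))) s = ?p s" for s by (rule mpowr_spec[OF U lam])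
  have "Omega_alpha n a (spec U (\<lambda>i. complex_of_real (lam i))) \<sigma>
      = (1/2) \<cdot>\<^sub>m (hmul n U (?F (-a) (a - 1)) \<sigma> + hmul n U (?F (a - 1) (-a)) \<sigma>)"
    unfolding Omega_alpha_def mp using U \<sigma> by (simp add: M_assoc spec_sandwich)
  also have "\<dots> = hmul n U (\<lambda>i j. (1/2) * (?F (-a) (a - 1) i j + ?F (a - 1) (-a) i j)) \<sigma>"
    using U \<sigma> by (simp only: hmul_fun_add[OF U \<sigma>] hmul_fun_smult[OF U \<sigma>])
  also have "\<dots> = hmul n U (\<lambda>i j. complex_of_real (((lam i / lam j) powr (-a) + (lam i / lam j) powr (a - 1)) / 2 / lam j)) \<sigma>"
    by (rule hmul_cong) (simp only: 1 2 of_real_mult[symmetric], simp add: add_divide_distrib distrib_left)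
  finally show ?thesis .
qed

lemma hmul_fun_sum:
  assumes U: "unitary n U" and X: "X \<in> M" and "finite S"
  shows "hmul n U (\<lambda>i j. \<Sum>k\<in>S. F k i j) X = mat_sum n (\<lambda>k. hmul n U (F k) X) S"
  using assms(3)
proof (induction S)
  case empty
  have "hmul n U (\<lambda>i j. 0 * 1) X = 0 \<cdot>\<^sub>m hmul n U (\<lambda>i j. 1) X" by (rule hmul_fun_smult[OF U X])
  then show ?case using U X by (intro M_eqI) auto
next
  case (insert k S)
  have "hmul n U (\<lambda>i j. \<Sum>k\<in>insert k S. F k i j) X = hmul n U (\<lambda>i j. F k i j + (\<Sum>k\<in>S. F k i j)) X"
    using insert.hyps by simp
  also have "\<dots> = hmul n U (F k) X + mat_sum n (\<lambda>k. hmul n U (F k) X) S"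
    unfolding hmul_fun_add[OF U X] insert.IH ..
  also have "\<dots> = mat_sum n (\<lambda>k. hmul n U (F k) X) (insert k S)"
    using insert.hyps U by (intro M_eqI) auto
  finally show ?case .
qed

text \<open>The function \<open>g\<close> of the overview, at an eigenvalue \<open>x\<close> of the
  modular operator.\<close>

definition omega_fun :: "nat \<Rightarrow> (nat \<Rightarrow> real) \<Rightarrow> (nat \<Rightarrow> real) \<Rightarrow> real \<Rightarrow> real" where
  "omega_fun m w \<alpha> x = (\<Sum>k\<in>{1..m}. w k * ((x powr (- \<alpha> k) + x powr (\<alpha> k - 1)) / 2))"

lemma Omega_hmul:
  assumes U: "unitary n U" and lam: "\<And>i. lam i > 0" and \<sigma>: "\<sigma> \<in> M"
  shows "Omega n m w \<alpha> (spec U (\<lambda>i. complex_of_real (lam i))) \<sigma> = 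
    hmul n U (\<lambda>i j. complex_of_real (omega_fun m w \<alpha> (lam i / lam j) / lam j)) \<sigma>"
proof -
  let ?F = "\<lambda>k i j. complex_of_real (((lam i / lam j) powr (-\<alpha> k) + (lam i / lam j) powr (\<alpha> k - 1)) / 2 / lam j)"
  have "Omega n m w \<alpha> (spec U (\<lambda>i. complex_of_real (lam i))) \<sigma> = mat_sum n (\<lambda>k. hmul n U (\<lambda>i j. complex_of_real (w k) * ?F k i j) \<sigma>) {1..m}"
    unfolding Omega_def Omega_alpha_hmul[OF assms] hmul_fun_smult[OF U \<sigma>]
    using U by (intro M_eqI) auto
  also have "\<dots> = hmul n U (\<lambda>i j. \<Sum>k\<in>{1..m}. complex_of_real (w k) * ?F k i j) \<sigma>"
    by (rule hmul_fun_sum[OF U \<sigma>, symmetric]) simp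
  also have "\<dots> = hmul n U (\<lambda>i j. complex_of_real (omega_fun m w \<alpha> (lam i / lam j) / lam j)) \<sigma>"
    by (rule hmul_cong) (simp add: omega_fun_def sum_divide_distrib)
  finally show ?thesis .
qed

text \<open>The weights sum to 1, so at least one term is strictly positive.\<close>

lemma omega_fun_pos:
  assumes w: "\<forall>i\<in>{1..m}. w i \<ge> 0" and "(\<Sum>i\<in>{1..m}. w i) = 1" and x: "x > 0"
  shows "omega_fun m w \<alpha> x > 0"
proof -
  have "\<exists>k\<in>{1..m}. w k \<noteq> 0"
  proof (rule ccontr)
    assume "\<not> ?thesis"
    then have "(\<Sum>i\<in>{1..m}. w i) = 0" by (intro sum.neutral) blast
    then show False using assms(2) by simp
  qed
  then obtain k where k: "k \<in> {1..m}" "w k \<noteq> 0" by blast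
  have pos: "(x powr (- \<alpha> k) + x powr (\<alpha> k - 1)) / 2 > 0" for k using x by (simp add: add_pos_pos)
  have "0 < w k * ((x powr (- \<alpha> k) + x powr (\<alpha> k - 1)) / 2)"
    using w k pos[of k] by (intro mult_pos_pos) (auto simp: less_le)
  also have "\<dots> \<le> omega_fun m w \<alpha> x"
    unfolding omega_fun_def
    by (rule member_le_sum[OF k(1), of "\<lambda>k. w k * ((x powr (- \<alpha> k) + x powr (\<alpha> k - 1)) / 2)"])
       (use w pos in \<open>auto intro!: mult_nonneg_nonneg simp: less_imp_le\<close>)
  finally show ?thesis .
qed

end

context clifford
begin

text \<open>The remaining products reduce to the given ones: \<open>k = l\<close> gives the trace,
  and \<open>k > l\<close> differs by a sign.\<close>

lemma moments_quadratics:
  assumes A: "A \<in> M" "tr A = 0" and \<sigma>: "\<sigma> \<in> M" "tr \<sigma> = 0"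
    and mom: "\<And>k l. 1 \<le> k \<Longrightarrow> k < l \<Longrightarrow> l \<le> 2*N \<Longrightarrow> tr (c k * c l * A) = tr (c k * c l * \<sigma>)"
    and Y: "Y \<in> quadratics"
  shows "tr (Y * A) = tr (Y * \<sigma>)"
proof -
  have "mat_subspace {Y \<in> M. tr (Y * A) = tr (Y * \<sigma>)}"
    unfolding mat_subspace_def using A(1) \<sigma>(1) by (auto simp: M_distrib M_smult M_tr)
  then have "Y \<in> {Y \<in> M. tr (Y * A) = tr (Y * \<sigma>)}"
  proof (rule quadratics_in[OF _ _ _ Y])
    show "1\<^sub>m n \<in> {Y \<in> M. tr (Y * A) = tr (Y * \<sigma>)}" using A \<sigma> by simp
    fix k l assume kl: "k \<in> I" "l \<in> I"
    note M = c_M[OF kl(1)] c_M[OF kl(2)]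
    have "tr (c k * c l * A) = tr (c k * c l * \<sigma>)"
    proof (cases k l rule: linorder_cases)
      case less
      then show ?thesis using kl by (intro mom) (auto simp: I_def)
    next
      case equal
      then show ?thesis using kl A \<sigma> c_square[OF kl(1)] by simp
    next
      case greater
      then have "tr (c l * c k * A) = tr (c l * c k * \<sigma>)" using kl by (intro mom) (auto simp: I_def)
      moreover have "c k * c l = (-1) \<cdot>\<^sub>m (c l * c k)" using c_anti[OF kl] greater by simp
      ultimately show ?thesis using M A(1) \<sigma>(1) by (simp add: M_smult M_tr)
    qed
    then show "c k * c l \<in> {Y \<in> M. tr (Y * A) = tr (Y * \<sigma>)}" using M by simp
  qed
  then show ?thesis by simp
qed

text \<open>Let \<open>x\<close> be the projection of \<open>\<sigma>\<close> onto the span of the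
  products of quadratics with \<open>\<rho>\<close>. The form's operator maps that space onto
  \<open>quadratics\<close>, so orthogonality is the trace condition. The adjoint of
  \<open>x\<close> satisfies the same conditions and lies in the same space, so the hermitian part
  of \<open>x\<close> is a solution.\<close>

lemma exists_moment_solution:
  assumes U: "unitary n U" and lam: "\<And>i. lam i > 0" and \<rho>: "\<rho> = spec U (\<lambda>i. complex_of_real (lam i))"
    and p: "preserves \<rho>" and G: "\<And>i j. G i j = g (lam i / lam j) / lam j" and g: "\<And>x. x > 0 \<Longrightarrow> g x > 0"
    and \<sigma>: "hermitian n \<sigma>"
  shows "\<exists>A. hermitian n A \<and> (\<exists>X\<in>quadratics. A = X * \<rho>) \<and> (\<forall>Y\<in>quadratics. tr (Y * A) = tr (Y * \<sigma>))"
proof -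
  let ?l = "\<lambda>i. complex_of_real (lam i)"
  let ?O = "hmul n U (\<lambda>i j. complex_of_real (G i j))"
  have nz: "\<forall>i<n. ?l i \<noteq> 0" using lam by (auto simp: less_imp_neq[symmetric])
  have Gpos: "G i j > 0" for i j using g lam by (simp add: G)
  have \<rho>M: "\<rho> \<in> M" and \<rho>adj: "adj \<rho> = \<rho>" using U by (simp_all add: \<rho> spec_adj)
  have \<sigma>M: "\<sigma> \<in> M" and \<sigma>adj: "adj \<sigma> = \<sigma>" using \<sigma> hermitian_M by auto
  \<comment> \<open>\<open>projection\<close> works with finitely many generators; these span
    \<open>quadratics\<close> by \<open>quadratics_decompose\<close>.\<close>
  let ?gens = "insert (1\<^sub>m n) ((\<lambda>(k,l). c k * c l) ` (I \<times> I))"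
  let ?S = "(\<lambda>X. X * \<rho>) ` ?gens"
  have gens: "?gens \<subseteq> quadratics" using one_quadratics cc_quadratics by auto
  have S: "finite ?S" "?S \<subseteq> M" using gens quadratics_M \<rho>M by auto
  obtain x where x: "x \<in> mspan ?S" and orth: "\<forall>b\<in>?S. tr (adj b * ?O (\<sigma> - x)) = 0"
    using projection[where G = G, OF U Gpos S \<sigma>M] by blast
  have "mat_subspace {X * \<rho> |X. X \<in> quadratics}"
    unfolding mat_subspace_def
  proof (intro conjI ballI allI)
    show "{X * \<rho> |X. X \<in> quadratics} \<subseteq> M" using quadratics_M \<rho>M by auto
    have "0\<^sub>m n n = 0\<^sub>m n n * \<rho>" using left_mult_zero_mat[OF \<rho>M, of n] by simp
    then show "0\<^sub>m n n \<in> {X * \<rho> |X. X \<in> quadratics}" using mat_subspaceD(2)[OF quadratics_sub] by blast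
    fix A B a assume "A \<in> {X * \<rho> |X. X \<in> quadratics}"
    then obtain X where X: "X \<in> quadratics" "A = X * \<rho>" by blast
    then have "a \<cdot>\<^sub>m A = (a \<cdot>\<^sub>m X) * \<rho>" using quadratics_M \<rho>M by (simp add: M_smult)
    then show "a \<cdot>\<^sub>m A \<in> {X * \<rho> |X. X \<in> quadratics}" using mat_subspaceD(4)[OF quadratics_sub X(1)] by blast
    assume "B \<in> {X * \<rho> |X. X \<in> quadratics}"
    then obtain X' where X': "X' \<in> quadratics" "B = X' * \<rho>" by blast
    then have "A + B = (X + X') * \<rho>" using X quadratics_M \<rho>M by (simp add: M_distrib)
    then show "A + B \<in> {X * \<rho> |X. X \<in> quadratics}" using mat_subspaceD(3)[OF quadratics_sub X(1) X'(1)] by blast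
  qed
  then have "mspan ?S \<subseteq> {X * \<rho> |X. X \<in> quadratics}" using gens by (intro mspan_least) blast+
  then obtain X where X: "X \<in> quadratics" "x = X * \<rho>" using x by blast
  have XM: "X \<in> M" and xM: "x \<in> M" using X quadratics_M \<rho>M by auto
  have orthQ: "tr (adj (B * \<rho>) * ?O (\<sigma> - x)) = 0" if B: "B \<in> quadratics" for B
  proof -
    let ?V = "{B \<in> M. tr (adj (B * \<rho>) * ?O (\<sigma> - x)) = 0}"
    have "mat_subspace ?V" unfolding mat_subspace_def using U \<rho>M
      by (auto simp: M_distrib M_adj M_tr M_smult adj_smult M_assoc left_mult_zero_mat[OF hmul_closed[OF U]])
    moreover have "1\<^sub>m n \<in> ?V" using orth by auto
    moreover have "c k * c l \<in> ?V" if "k \<in> I" "l \<in> I" for k l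
      using orth that c_M[OF that(1)] c_M[OF that(2)] by auto
    ultimately have "B \<in> ?V" using B by (rule quadratics_in)
    then show ?thesis by simp
  qed
  have mom: "tr (Y * x) = tr (Y * \<sigma>)" if Y: "Y \<in> quadratics" for Y
  proof -
    have YM: "Y \<in> M" using Y quadratics_M by simp
    \<comment> \<open>Dividing by \<open>g\<close> of the modular operator makes \<open>?O\<close>
      send \<open>B * \<rho>\<close> to \<open>adj Y\<close>.\<close>
    define B where "B = hmul n U (\<lambda>i j. complex_of_real (1 / g (lam i / lam j))) (adj Y)"
    have BQ: "B \<in> quadratics" unfolding B_def
      by (rule preserves_quadratics_fun[OF U nz p[unfolded \<rho>] quadratics_adj[OF Y], of _ "\<lambda>z. complex_of_real (1 / g (Re z))"])
         (simp flip: of_real_divide)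
    have "?O (B * \<rho>) = hmul n U (\<lambda>i j. complex_of_real (G i j) * (?l j * complex_of_real (1 / g (lam i / lam j)))) (adj Y)"
      unfolding \<rho> B_def using U YM by (simp add: spec_mult_right hmul_hmul)
    also have "\<dots> = hmul n U (\<lambda>i j. 1) (adj Y)"
    proof (rule hmul_cong)
      fix i j
      have "G i j * (lam j * (1 / g (lam i / lam j))) = 1" using lam[of j] g[of "lam i / lam j"] lam[of i] by (simp add: G)
      then show "complex_of_real (G i j) * (?l j * complex_of_real (1 / g (lam i / lam j))) = 1"
        by (simp only: of_real_mult[symmetric] of_real_1)
    qed
    finally have "?O (B * \<rho>) = adj Y" using hmul_one[OF U] YM by simp
    then have "tr (Y * (\<sigma> - x)) = 0"
      using orthQ[OF BQ] form_swap[OF U, of "B * \<rho>" "\<sigma> - x" G] quadratics_M[OF BQ] \<rho>M \<sigma>M xM by simp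
    then show ?thesis using YM \<sigma>M xM by (simp add: M_distrib M_tr)
  qed
  have mom': "tr (Y * adj x) = tr (Y * \<sigma>)" if Y: "Y \<in> quadratics" for Y
  proof -
    have YM: "Y \<in> M" using Y quadratics_M by simp
    have flip: "tr (Y * adj Z) = cnj (tr (adj Y * Z))" if Z: "Z \<in> M" for Z
    proof -
      have "cnj (tr (adj Y * Z)) = tr (adj (adj Y * Z))" using YM Z by (simp add: M_tr)
      also have "\<dots> = tr (adj Z * Y)" using YM Z by (simp add: M_adj)
      finally show ?thesis using M_tr_comm[OF YM, of "adj Z"] Z by simp
    qed
    show ?thesis using flip[OF xM] flip[OF \<sigma>M] mom[OF quadratics_adj[OF Y]] \<sigma>adj by simp
  qed
  \<comment> \<open>\<open>adj x\<close> is \<open>\<rho> * adj X\<close>; conjugating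
    \<open>adj X\<close> by \<open>\<rho>\<close> moves \<open>\<rho>\<close> to the right.\<close>
  define X' where "X' = hmul n U (\<lambda>i j. ?l i / ?l j) (adj X)"
  have X'quadratics: "X' \<in> quadratics" unfolding X'_def by (rule preserves_quadratics_fun[OF U nz p[unfolded \<rho>] quadratics_adj[OF X(1)], of _ "\<lambda>z. z"]) simp
  have X'\<rho>: "X' * \<rho> = adj x"
  proof -
    have "X' * \<rho> = hmul n U (\<lambda>i j. ?l j * (?l i / ?l j)) (adj X)" unfolding X'_def \<rho> using U XM by (simp add: spec_mult_right hmul_hmul)
    also have "\<dots> = hmul n U (\<lambda>i j. ?l i) (adj X)" by (rule hmul_cong) (use nz in simp)
    also have "\<dots> = \<rho> * adj X" unfolding \<rho> using U XM by (simp add: spec_mult_left)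
    also have "\<dots> = adj x" using X XM \<rho>M \<rho>adj by (simp add: M_adj)
    finally show ?thesis .
  qed
  define A where "A = (1/2) \<cdot>\<^sub>m (x + adj x)"
  have "hermitian n A" using xM by (auto simp: hermitian_def A_def adj_smult M_adj intro!: M_eqI)
  moreover have "A = ((1/2) \<cdot>\<^sub>m (X + X')) * \<rho>"
    using XM quadratics_M[OF X'quadratics] \<rho>M by (simp add: A_def X(2)[symmetric] X'\<rho> M_smult M_distrib)
  moreover have "(1/2) \<cdot>\<^sub>m (X + X') \<in> quadratics" using X(1) X'quadratics mat_subspaceD(3,4)[OF quadratics_sub] by simp
  moreover have "tr (Y * A) = tr (Y * \<sigma>)" if Y: "Y \<in> quadratics" for Y
    using quadratics_M[OF Y] xM mom[OF Y] mom'[OF Y] by (simp add: A_def M_smult M_distrib M_tr)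
  ultimately show ?thesis by blast
qed

text \<open>Pythagoras: \<open>B - \<sigma>\<close> splits into \<open>B - A\<close> and
  \<open>A - \<sigma>\<close>. \<open>\<Omega>\<close> sends the first summand into
  \<open>quadratics\<close>, and the second has zero trace against all of \<open>quadratics\<close>,
  so the cross terms vanish.\<close>

theorem tangent_minimiser:
  assumes \<rho>: "gauss \<rho>" and \<sigma>: "hermitian n \<sigma>" "tr \<sigma> = 0"
    and w: "\<forall>i\<in>{1..m}. w i \<ge> 0" "(\<Sum>i\<in>{1..m}. w i) = 1"
  obtains A where "A \<in> tangent \<rho>"
    "\<And>k l. k \<in> I \<Longrightarrow> l \<in> I \<Longrightarrow> tr (c k * c l * A) = tr (c k * c l * \<sigma>)"
    "\<And>B. B \<in> tangent \<rho> \<Longrightarrow> B \<noteq> A \<Longrightarrow> 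
      Re (metric n m w \<alpha> \<rho> (A - \<sigma>) (A - \<sigma>)) < Re (metric n m w \<alpha> \<rho> (B - \<sigma>) (B - \<sigma>))"
    "\<And>B. B \<in> tangent \<rho> \<Longrightarrow> (\<And>k l. 1 \<le> k \<Longrightarrow> k < l \<Longrightarrow> l \<le> 2*N \<Longrightarrow> tr (c k * c l * B) = tr (c k * c l * \<sigma>)) \<Longrightarrow> B = A"
proof -
  obtain U lam where U: "unitary n U" and lam: "\<And>i. lam i > 0" and \<rho>s: "\<rho> = spec U (\<lambda>i. complex_of_real (lam i))" 
    and p: "preserves \<rho>" using \<rho> by (rule gauss_spec) (rule that)
  let ?l = "\<lambda>i. complex_of_real (lam i)"
  have nz: "\<forall>i<n. ?l i \<noteq> 0" using lam by (auto simp: less_imp_neq[symmetric])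
  define g where "g = omega_fun m w \<alpha>"
  have g: "g x > 0" if "x > 0" for x unfolding g_def by (rule omega_fun_pos[OF w that])
  define G where "G i j = g (lam i / lam j) / lam j" for i j
  have Gpos: "G i j > 0" for i j using g lam by (simp add: G_def)
  define \<Omega> where "\<Omega> = hmul n U (\<lambda>i j. complex_of_real (G i j))"
  have OM: "\<Omega> X \<in> M" for X using U by (simp add: \<Omega>_def)
  have \<sigma>M: "\<sigma> \<in> M" and \<sigma>adj: "adj \<sigma> = \<sigma>" using \<sigma> hermitian_M by auto
  have metric: "metric n m w \<alpha> \<rho> X X = tr (adj X * \<Omega> X)" if "X \<in> M" for X
    unfolding metric_def \<rho>s Omega_hmul[OF U lam that] \<Omega>_def G_def g_def ..
  have TM: "B \<in> M" if "B \<in> tangent \<rho>" for B using that by (simp add: tangent_def)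
  have OQ: "\<Omega> B \<in> quadratics" if B: "B \<in> tangent \<rho>" for B
  proof -
    obtain X where X: "X \<in> quadratics" "B = X * \<rho>" using B tangent_iff[OF \<rho>] by blast
    have "\<Omega> B = hmul n U (\<lambda>i j. complex_of_real (G i j) * ?l j) X"
      unfolding \<Omega>_def X(2) \<rho>s using U quadratics_M[OF X(1)] by (simp add: spec_mult_right hmul_hmul)
    also have "\<dots> = hmul n U (\<lambda>i j. complex_of_real (g (lam i / lam j))) X"
    proof (rule hmul_cong)
      fix i j
      have "G i j * lam j = g (lam i / lam j)" using lam[of j] by (simp add: G_def)
      then show "complex_of_real (G i j) * ?l j = complex_of_real (g (lam i / lam j))"
        by (simp only: of_real_mult[symmetric])
    qed
    also have "\<dots> \<in> quadratics"
      by (rule preserves_quadratics_fun[OF U nz p[unfolded \<rho>s] X(1), of _ "\<lambda>z. complex_of_real (g (Re z))"])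
         (simp flip: of_real_divide)
    finally show ?thesis .
  qed
  obtain A where A: "hermitian n A" "\<exists>X\<in>quadratics. A = X * \<rho>" and mom: "\<And>Y. Y \<in> quadratics \<Longrightarrow> tr (Y * A) = tr (Y * \<sigma>)"
    using exists_moment_solution[where G = G and g = g, OF U lam \<rho>s p G_def g \<sigma>(1)] by blast
  \<comment> \<open>Vanishing trace is the moment condition for the operator 1.\<close>
  have "tr A = 0" using mom[OF one_quadratics] A(1) \<sigma>M \<sigma>(2) hermitian_M(1) by simp
  then have AT: "A \<in> tangent \<rho>" using A tangent_iff[OF \<rho>] by blast
  note AM = TM[OF AT]
  \<comment> \<open>Stated for every tangent \<open>A'\<close> with the right moments: two different
    ones would each be strictly better than the other, which gives uniqueness at the end.\<close>
  have min: "Re (metric n m w \<alpha> \<rho> (A' - \<sigma>) (A' - \<sigma>)) < Re (metric n m w \<alpha> \<rho> (B - \<sigma>) (B - \<sigma>))"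
    if A'T: "A' \<in> tangent \<rho>" and mom': "\<And>Y. Y \<in> quadratics \<Longrightarrow> tr (Y * A') = tr (Y * \<sigma>)" and B: "B \<in> tangent \<rho>" "B \<noteq> A'" for A' B
  proof -
    note BM = TM[OF B(1)] and A'M = TM[OF A'T]
    define D where "D = B - A'"
    define \<tau> where "\<tau> = A' - \<sigma>"
    have DM: "D \<in> M" "\<tau> \<in> M" using BM A'M \<sigma>M by (simp_all add: D_def \<tau>_def)
    have D0: "D \<noteq> 0\<^sub>m n n"
    proof
      assume z: "D = 0\<^sub>m n n"
      have "B = D + A'" using BM A'M by (intro M_eqI) (auto simp: D_def)
      then show False using z A'M B(2) by simp
    qed
    have "\<Omega> D = \<Omega> B - \<Omega> A'" unfolding D_def \<Omega>_def by (rule hmul_minus[OF U BM A'M])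
    then have ODQ: "adj (\<Omega> D) \<in> quadratics" using mat_subspace_minus[OF quadratics_sub OQ[OF B(1)] OQ[OF A'T]] quadratics_adj by simp
    have cross: "tr (adj (\<Omega> D) * \<tau>) = 0"
      using mom'[OF ODQ] quadratics_M[OF ODQ] A'M \<sigma>M by (simp add: \<tau>_def M_distrib M_tr)
    have c1: "tr (adj D * \<Omega> \<tau>) = 0"
      using form_swap[OF U DM, of G] cross unfolding \<Omega>_def by simp
    have "tr (adj \<tau> * \<Omega> D) = tr (adj (adj (\<Omega> D) * \<tau>))" using OM DM by (simp add: M_adj)
    also have "\<dots> = 0" using cross M_tr(4)[of "adj (\<Omega> D) * \<tau>"] OM DM by simp
    finally have c2: "tr (adj \<tau> * \<Omega> D) = 0" .
    have s: "B - \<sigma> = D + \<tau>" using BM A'M \<sigma>M by (intro M_eqI) (auto simp: D_def \<tau>_def)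
    have "\<Omega> (D + \<tau>) = \<Omega> D + \<Omega> \<tau>" unfolding \<Omega>_def by (rule hmul_add[OF U DM])
    then have "tr (adj (D + \<tau>) * \<Omega> (D + \<tau>)) = tr (adj D * \<Omega> D) + tr (adj \<tau> * \<Omega> \<tau>)"
      using DM OM c1 c2 by (simp add: M_adj M_distrib M_tr)
    moreover have "Re (tr (adj D * \<Omega> D)) > 0" unfolding \<Omega>_def by (rule form_pos[OF U DM(1) Gpos D0])
    ultimately show ?thesis using DM by (simp add: metric s \<tau>_def[symmetric])
  qed
  show ?thesis
  proof (rule that[OF AT])
    show "tr (c k * c l * A) = tr (c k * c l * \<sigma>)" if "k \<in> I" "l \<in> I" for k l
      by (rule mom[OF cc_quadratics[OF that]])
    show "Re (metric n m w \<alpha> \<rho> (A - \<sigma>) (A - \<sigma>)) < Re (metric n m w \<alpha> \<rho> (B - \<sigma>) (B - \<sigma>))"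
      if "B \<in> tangent \<rho>" "B \<noteq> A" for B by (rule min[OF AT mom that])
    fix B assume B: "B \<in> tangent \<rho>" 
      and Bm: "\<And>k l. 1 \<le> k \<Longrightarrow> k < l \<Longrightarrow> l \<le> 2*N \<Longrightarrow> tr (c k * c l * B) = tr (c k * c l * \<sigma>)"
    have B0: "tr B = 0" using B tangent_iff[OF \<rho>] by blast
    have momB: "tr (Y * B) = tr (Y * \<sigma>)" if "Y \<in> quadratics" for Y
      by (rule moments_quadratics[OF TM[OF B] B0 \<sigma>M \<sigma>(2) Bm that])
    show "B = A"
    proof (rule ccontr)
      assume "B \<noteq> A"
      then show False using min[OF AT mom B] min[OF B momB AT] by force
    qed
  qed
qed

end

section \<open>From mode operators and semigroups to the abstract setting\<close>

lemma majorana_eq: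
  assumes "a ((k+1) div 2) \<in> carrier_mat d d"
  shows "majorana a k = (if odd k then 1 else -\<i>) \<cdot>\<^sub>m adj (a ((k+1) div 2)) + (if odd k then 1 else \<i>) \<cdot>\<^sub>m a ((k+1) div 2)"
proof (cases "odd k")
  case False
  define j where "j = (k+1) div 2"
  \<comment> \<open>For even \<open>k\<close> the two index formulas agree, so both parities get the
    shape \<open>u\<close> times \<open>adj a\<close> plus \<open>cnj u\<close> times
    \<open>a\<close>, with \<open>u\<close> equal to 1 or \<open>-\<i>\<close>.\<close>
  have j: "k div 2 = j" using False unfolding j_def by presburger
  have "majorana a k = (-\<i>) \<cdot>\<^sub>m (adj (a j) - a j)"
    unfolding majorana_def j using False by simp
  then show ?thesis using False assms unfolding j_def[symmetric]
    by (intro eq_matI) (auto simp: right_diff_distrib)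
qed (use assms in \<open>auto simp: majorana_def intro!: eq_matI\<close>)

lemma CAR_clifford:
  assumes "CAR N a"
  shows "clifford (2^N) N (majorana a)"
proof
  interpret square_mats "2^N" .
  have aM: "a j \<in> M" if "j \<in> {1..N}" for j using assms that by (simp add: CAR_def)
  have mode: "(k+1) div 2 \<in> {1..N}" if "k \<in> {1..2*N}" for k using that by auto
  fix k assume k: "k \<in> {1..2*N}"
  note ak = aM[OF mode[OF k]]
  note mk = majorana_eq[of a k, OF ak]
  show kM: "majorana a k \<in> M" unfolding mk using ak by simp
  show "adj (majorana a k) = majorana a k" unfolding mk using ak by (intro M_eqI) (auto simp: M_adj adj_smult)
  fix l assume l: "l \<in> {1..2*N}"
  note al = aM[OF mode[OF l]]
  note ml = majorana_eq[of a l, OF al]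
  let ?j = "(k+1) div 2" and ?i = "(l+1) div 2"
  let ?d = "if ?j = ?i then 1 else 0 :: complex"
  have r1: "adj (a ?j) * a ?i + a ?i * adj (a ?j) = ?d \<cdot>\<^sub>m 1\<^sub>m (2^N)"
    using assms mode[OF k] mode[OF l] by (auto simp: CAR_def intro!: eq_matI)
  have r2: "adj (a ?i) * a ?j + a ?j * adj (a ?i) = ?d \<cdot>\<^sub>m 1\<^sub>m (2^N)"
    using assms mode[OF k] mode[OF l] by (auto simp: CAR_def intro!: eq_matI)
  have r3: "a ?j * a ?i + a ?i * a ?j = 0\<^sub>m (2^N) (2^N)"
    using assms mode[OF k] mode[OF l] by (simp add: CAR_def)
  have r4: "adj (a ?i) * adj (a ?j) + adj (a ?j) * adj (a ?i) = 0\<^sub>m (2^N) (2^N)"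
    using arg_cong[OF r3, of adj] ak al by (simp add: M_adj)
  let ?u = "if odd k then 1 else -\<i>" and ?v = "if odd l then 1 else -\<i>"
  show "majorana a k * majorana a l + majorana a l * majorana a k = (if k = l then 2 else 0) \<cdot>\<^sub>m 1\<^sub>m (2^N)"
  proof (rule M_eqI)
    fix p q :: nat assume pq: "p < 2^N" "q < 2^N"
    have e: "(X + Y) $$ (p,q) = X $$ (p,q) + Y $$ (p,q)" if "X \<in> M" "Y \<in> M" for X Y using that pq by simp
    define x1 x2 x3 x4 x5 x6 x7 x8 where xs: "x1 = (adj (a ?j) * a ?i) $$ (p,q)" "x2 = (a ?i * adj (a ?j)) $$ (p,q)"
      "x3 = (adj (a ?i) * a ?j) $$ (p,q)" "x4 = (a ?j * adj (a ?i)) $$ (p,q)"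
      "x5 = (a ?j * a ?i) $$ (p,q)" "x6 = (a ?i * a ?j) $$ (p,q)"
      "x7 = (adj (a ?i) * adj (a ?j)) $$ (p,q)" "x8 = (adj (a ?j) * adj (a ?i)) $$ (p,q)"
    have o: "(1\<^sub>m (2^N) :: complex mat) $$ (p,q) = (if p = q then 1 else 0)" using pq by simp
    have R: "x1 + x2 = ?d * (if p = q then 1 else 0)" "x3 + x4 = ?d * (if p = q then 1 else 0)" "x5 + x6 = 0" "x7 + x8 = 0"
      using arg_cong[OF r1, of "\<lambda>Z. Z $$ (p,q)"] arg_cong[OF r2, of "\<lambda>Z. Z $$ (p,q)"]
        arg_cong[OF r3, of "\<lambda>Z. Z $$ (p,q)"] arg_cong[OF r4, of "\<lambda>Z. Z $$ (p,q)"] pq ak al o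
      unfolding xs by (simp_all del: index_add_mat split del: if_split)
    have "(majorana a k * majorana a l + majorana a l * majorana a k) $$ (p,q) = 
       ?u * ?v * (x7 + x8) + cnj ?u * cnj ?v * (x5 + x6) + ?u * cnj ?v * (x1 + x2) + cnj ?u * ?v * (x3 + x4)"
      unfolding mk ml xs using pq ak al by (simp add: M_distrib M_smult algebra_simps)
    also have "\<dots> = (?u * cnj ?v + cnj ?u * ?v) * ?d * (if p = q then 1 else 0)"
      unfolding R by (simp add: algebra_simps)
    \<comment> \<open>Within one mode the bracket is twice the real part of
      \<open>?u * cnj ?v\<close>: 2 for equal parity, that is for \<open>k = l\<close>, and 0
      otherwise.\<close>
    also have "(?u * cnj ?v + cnj ?u * ?v) * ?d = (if k = l then 2 else 0)"
    proof (cases "?j = ?i")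
      case True
      then have "odd k = odd l \<longleftrightarrow> k = l" by presburger
      then show ?thesis using True by auto
    qed auto
    finally show "(majorana a k * majorana a l + majorana a l * majorana a k) $$ (p,q) = ((if k = l then 2 else 0) \<cdot>\<^sub>m 1\<^sub>m (2^N)) $$ (p,q)"
      using pq by simp
  qed (use ak al in \<open>auto simp: mk ml\<close>)
qed simp

text \<open>To the right of 0 the difference quotient with the candidate \<open>b\<close> subtracted
  is constantly \<open>- b\<close>, and it tends to 0. The semigroup offers only this one-sided
  derivative.\<close>

lemma one_sided_derivative_zero:
  fixes f :: "real \<Rightarrow> complex"
  assumes "(f has_vector_derivative b) (at 0 within {0..})" "\<And>u. u \<ge> 0 \<Longrightarrow> f u = a"
  shows "b = 0"
proof -
  have "(f has_derivative (\<lambda>h. h *\<^sub>R b)) (at 0 within {0<..})"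
    using assms(1) unfolding has_vector_derivative_def by (rule has_derivative_subset) auto
  then have "((\<lambda>y. (f y - f 0 - (y - 0) *\<^sub>R b) /\<^sub>R norm (y - 0)) \<longlongrightarrow> 0) (at_right 0)"
    by (simp add: has_derivative_at_within)
  moreover have "\<forall>\<^sub>F y in at_right 0. (f y - f 0 - (y - 0) *\<^sub>R b) /\<^sub>R norm (y - 0) = - b"
    using assms(2) by (auto simp: eventually_at_filter intro!: always_eventually)
  ultimately have "((\<lambda>y. - b) \<longlongrightarrow> 0) (at_right (0::real))" by (rule Lim_transform_eventually)
  then have "- b = 0" using tendsto_unique[OF _ tendsto_const] by (metis trivial_limit_at_right_real)
  then show ?thesis by simp
qed

text \<open>For \<open>u \<ge> 0\<close> the operators \<open>E u \<rho>\<close> are hermitian with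
  constant trace, so the corresponding combinations of entries are constant and their right
  derivatives at 0 vanish.\<close>

lemma generator_hermitian_traceless:
  assumes "markov_semigroup_with_generator d E L" and \<rho>: "posdef d \<rho>"
  shows "hermitian d (L \<rho>)" "tr (L \<rho>) = 0"
proof -
  interpret square_mats d .
  have \<rho>M: "\<rho> \<in> M" using \<rho> by (simp add: posdef_def hermitian_def)
  have LM: "L \<rho> \<in> M" and der: "\<And>i j. i < d \<Longrightarrow> j < d \<Longrightarrow> ((\<lambda>u. E u \<rho> $$ (i,j)) has_vector_derivative L \<rho> $$ (i,j)) (at 0 within {0..})"
    and EM: "\<And>u. u \<ge> 0 \<Longrightarrow> E u \<rho> \<in> M" and tp: "\<And>u. u \<ge> 0 \<Longrightarrow> tr (E u \<rho>) = tr \<rho>"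
    and cp: "\<And>u. u \<ge> 0 \<Longrightarrow> completely_positive d (E u)"
    using assms(1) \<rho>M unfolding markov_semigroup_with_generator_def linear_map_on_def trace_preserving_def by blast+
  have "psd d \<rho>" unfolding psd_def
  proof (intro conjI ballI)
    fix v :: "complex vec" assume v: "v \<in> carrier_vec d"
    have "Im (qform \<rho> v) = 0 \<and> Re (qform \<rho> v) \<ge> 0"
    proof (cases "v = 0\<^sub>v d")
      case True
      then show ?thesis by (simp add: qform_def)
    next
      case False
      then show ?thesis using \<rho> v by (auto simp: posdef_def less_imp_le)
    qed
    then show "Im (qform \<rho> v) = 0" "Re (qform \<rho> v) \<ge> 0" by auto
  qed (use \<rho> in \<open>simp add: posdef_def\<close>)
  have herm: "hermitian d (E u \<rho>)" if u: "u \<ge> 0" for u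
  proof -
    \<comment> \<open>Complete positivity at \<open>k = 1\<close> is plain positivity, which carries
      hermiticity.\<close>
    have "psd (1*d) (ampliate 1 d (E u) \<rho>)" 
      using \<open>psd d \<rho>\<close> by (intro cp[OF u, unfolded completely_positive_def, rule_format]) simp_all
    moreover have "ampliate 1 d (E u) \<rho> = E u \<rho>"
    proof -
      have *: "mat d d (($$) \<rho>) = \<rho>" using \<rho>M by (intro eq_matI) auto
      show ?thesis unfolding ampliate_def using EM[OF u] by (intro eq_matI) (auto simp: *)
    qed
    ultimately show ?thesis by (simp add: psd_def)
  qed
  have "adj (L \<rho>) = L \<rho>"
  proof (rule M_eqI)
    fix i j assume ij: "i < d" "j < d"
    have "((\<lambda>u. E u \<rho> $$ (i,j) - cnj (E u \<rho> $$ (j,i))) has_vector_derivative (L \<rho> $$ (i,j) - cnj (L \<rho> $$ (j,i)))) (at 0 within {0..})"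
      by (intro has_vector_derivative_diff der ij bounded_linear.has_vector_derivative[OF bounded_linear_cnj])
    moreover have "E u \<rho> $$ (i,j) - cnj (E u \<rho> $$ (j,i)) = 0" if u: "u \<ge> 0" for u
    proof -
      have "adj (E u \<rho>) $$ (i,j) = E u \<rho> $$ (i,j)" using herm[OF u] by (simp add: hermitian_def)
      then show ?thesis using EM[OF u] ij by simp
    qed
    ultimately have "L \<rho> $$ (i,j) - cnj (L \<rho> $$ (j,i)) = 0" by (rule one_sided_derivative_zero)
    then show "adj (L \<rho>) $$ (i,j) = L \<rho> $$ (i,j)" using LM ij by simp
  qed (use LM in auto)
  then show "hermitian d (L \<rho>)" using LM by (simp add: hermitian_def)
  have "((\<lambda>u. \<Sum>i<d. E u \<rho> $$ (i,i)) has_vector_derivative (\<Sum>i<d. L \<rho> $$ (i,i))) (at 0 within {0..})"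
    by (intro has_vector_derivative_sum der) auto
  moreover have "(\<Sum>i<d. E u \<rho> $$ (i,i)) = tr \<rho>" if "u \<ge> 0" for u
    using tp[OF that] carrier_matD(1)[OF EM[OF that]] by (simp add: tr_def)
  ultimately have "(\<Sum>i<d. L \<rho> $$ (i,i)) = 0" by (rule one_sided_derivative_zero)
  then show "tr (L \<rho>) = 0" using carrier_matD(1)[OF LM] by (simp add: tr_def)
qed

theorem theorem1:
  fixes N m :: nat
    and a :: "nat \<Rightarrow> complex mat"
    and E :: "real \<Rightarrow> complex mat \<Rightarrow> complex mat"
    and L :: "complex mat \<Rightarrow> complex mat"
    and w \<alpha> :: "nat \<Rightarrow> real"
    and \<rho> :: "complex mat"
  assumes "N \<ge> 1"
    and "CAR N a"
    and "markov_semigroup_with_generator (2^N) E L"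
    and "\<forall>i\<in>{1..m}. w i \<ge> 0 \<and> 0 \<le> \<alpha> i \<and> \<alpha> i \<le> 1"
    and "(\<Sum>i\<in>{1..m}. w i) = 1"
    and "\<rho> \<in> gaussian_states N a"
  shows "(\<exists>!A. A \<in> tangent_space N a \<rho> \<and>
            (\<forall>B\<in>tangent_space N a \<rho>.
               Re (metric (2^N) m w \<alpha> \<rho> (A - L \<rho>) (A - L \<rho>))
                 \<le> Re (metric (2^N) m w \<alpha> \<rho> (B - L \<rho>) (B - L \<rho>))))
       \<and> (\<exists>!A. A \<in> tangent_space N a \<rho> \<and>
            (\<forall>k l. 1 \<le> k \<and> k < l \<and> l \<le> 2*N \<longrightarrow>
               tr (majorana a k * majorana a l * A) = tr (majorana a k * majorana a l * L \<rho>)))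
       \<and> (\<forall>A. A \<in> tangent_space N a \<rho> \<and>
            (\<forall>B\<in>tangent_space N a \<rho>.
               Re (metric (2^N) m w \<alpha> \<rho> (A - L \<rho>) (A - L \<rho>))
                 \<le> Re (metric (2^N) m w \<alpha> \<rho> (B - L \<rho>) (B - L \<rho>)))
            \<longrightarrow> (\<forall>k l. 1 \<le> k \<and> k < l \<and> l \<le> 2*N \<longrightarrow>
               tr (majorana a k * majorana a l * A) = tr (majorana a k * majorana a l * L \<rho>)))"
proof -
  interpret clifford "2^N" N "majorana a" by (rule CAR_clifford[OF assms(2)])
  have quad: "quadratic_op N a K = quad (\<lambda>k l. complex_of_real (K k l))" for K
    unfolding quadratic_op_def I_def[symmetric] by (rule M_eqI) (auto simp: quad_index)
  have gauss: "\<rho> \<in> gaussian_states N a \<longleftrightarrow> gauss \<rho>" for \<rho>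
    unfolding gaussian_states_def gauss_def quad I_def by blast
  have tangent: "tangent_space N a \<rho> = tangent \<rho>"
    unfolding tangent_space_def tangent_def gauss ..
  have \<rho>: "gauss \<rho>" using assms(6) gauss by simp
  have "posdef (2^N) \<rho>" using \<rho> by (simp add: gauss_def faithful_state_def)
  note L = generator_hermitian_traceless[OF assms(3) this]
  have w: "\<forall>i\<in>{1..m}. w i \<ge> 0" using assms(4) by blast
  obtain A where A: "A \<in> tangent \<rho>"
    "\<And>k l. k \<in> I \<Longrightarrow> l \<in> I \<Longrightarrow> tr (majorana a k * majorana a l * A) = tr (majorana a k * majorana a l * L \<rho>)"
    "\<And>B. B \<in> tangent \<rho> \<Longrightarrow> B \<noteq> A \<Longrightarrow> 
      Re (metric (2^N) m w \<alpha> \<rho> (A - L \<rho>) (A - L \<rho>)) < Re (metric (2^N) m w \<alpha> \<rho> (B - L \<rho>) (B - L \<rho>))"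
    "\<And>B. B \<in> tangent \<rho> \<Longrightarrow> (\<And>k l. 1 \<le> k \<Longrightarrow> k < l \<Longrightarrow> l \<le> 2*N \<Longrightarrow> 
       tr (majorana a k * majorana a l * B) = tr (majorana a k * majorana a l * L \<rho>)) \<Longrightarrow> B = A"
    using tangent_minimiser[OF \<rho> L w assms(5), of \<alpha>] by blast
  have mom: "\<forall>k l. 1 \<le> k \<and> k < l \<and> l \<le> 2*N \<longrightarrow>
     tr (majorana a k * majorana a l * A) = tr (majorana a k * majorana a l * L \<rho>)"
    using A(2) by (simp add: I_def)
  have min: "B = A" if "B \<in> tangent \<rho>" 
    "Re (metric (2^N) m w \<alpha> \<rho> (B - L \<rho>) (B - L \<rho>)) \<le> Re (metric (2^N) m w \<alpha> \<rho> (A - L \<rho>) (A - L \<rho>))" for B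
    using A(3)[OF that(1)] that(2) by force
  have le: "Re (metric (2^N) m w \<alpha> \<rho> (A - L \<rho>) (A - L \<rho>)) \<le> Re (metric (2^N) m w \<alpha> \<rho> (B - L \<rho>) (B - L \<rho>))"
    if "B \<in> tangent \<rho>" for B using A(3)[OF that] by (cases "B = A") auto
  show ?thesis
    unfolding tangent
  proof (intro conjI)
    show "\<exists>!A. A \<in> tangent \<rho> \<and> (\<forall>B\<in>tangent \<rho>. Re (metric (2^N) m w \<alpha> \<rho> (A - L \<rho>) (A - L \<rho>))
                 \<le> Re (metric (2^N) m w \<alpha> \<rho> (B - L \<rho>) (B - L \<rho>)))"
      by (rule ex1I[of _ A]) (use A(1) le min in blast)+
    show "\<exists>!A. A \<in> tangent \<rho> \<and> (\<forall>k l. 1 \<le> k \<and> k < l \<and> l \<le> 2*N \<longrightarrow>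
               tr (majorana a k * majorana a l * A) = tr (majorana a k * majorana a l * L \<rho>))"
      by (rule ex1I[of _ A]) (use A(1,4) mom in blast)+
    show "\<forall>A. A \<in> tangent \<rho> \<and> (\<forall>B\<in>tangent \<rho>. Re (metric (2^N) m w \<alpha> \<rho> (A - L \<rho>) (A - L \<rho>))
                 \<le> Re (metric (2^N) m w \<alpha> \<rho> (B - L \<rho>) (B - L \<rho>)))
            \<longrightarrow> (\<forall>k l. 1 \<le> k \<and> k < l \<and> l \<le> 2*N \<longrightarrow>
               tr (majorana a k * majorana a l * A) = tr (majorana a k * majorana a l * L \<rho>))"
      using mom min A(1) by blast
  qed
qed

end
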